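(* For $t\geq 1$ let $m_t$ be the maximum order of the canonical group over all face 2-coloured spherical triangulations whose underlying graphs are simple and which have $t$ faces of each colour. Then $$\limsup_{t\rightarrow\infty}(m_t)^{1/t}<6^{1/5}.$$
   Context: A face 2-coloured spherical triangulation is a triangulation of the sphere whose faces are properly coloured black and white (faces sharing an edge have different colours). Let $V$ be its vertex set and let $\mathcal{A}_W$ be the abelian group generated by $V$ subject to $r+c+s=0$ for each white face with vertices $r,c,s$. Then $\mathcal{A}_W\cong\mathbb{Z}\oplus\mathbb{Z}\oplus\mathcal{C}$ for a finite abelian group $\mathcal{C}$, called the canonical group of the triangulation. *)

theory Defs
  imports "HOL-Analysis.Analysis" "HOL-Algebra.Algebra"
begin

section \<open>Triangulations of the sphere\<close>

abbreviation S2 :: "(real^3) set" where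
  "S2 \<equiv> sphere 0 1"

text \<open>A drawing of a finite graph on the sphere together with a classification of faces as white
  or black. An edge is stored as the set of points of the curve representing it, a face as an open
  region of the sphere.\<close>

record coloured_drawing =
  verts :: "(real^3) set"
  edges :: "(real^3) set set"
  white :: "(real^3) set set"
  black :: "(real^3) set set"

text \<open>The end-vertices of an edge \<open>e\<close> are the two elements of \<open>e \<inter> verts T\<close>. Edges are arcs, so loops
  are excluded, but parallel edges are not. Excluding loops loses nothing: the vertices of a face
  2-coloured spherical triangulation have a proper 3-colouring.\<close>

definition graph_on_sphere :: "coloured_drawing \<Rightarrow> bool" where
  "graph_on_sphere T \<longleftrightarrow>
     finite (verts T) \<and> verts T \<subseteq> S2 \<and> finite (edges T) \<and>
     (\<forall>e\<in>edges T. e \<subseteq> S2 \<and>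
        (\<exists>g. arc g \<and> path_image g = e \<and> e \<inter> verts T = {pathstart g, pathfinish g})) \<and>
     (\<forall>e\<in>edges T. \<forall>f\<in>edges T. e \<noteq> f \<longrightarrow> e \<inter> f \<subseteq> verts T)"

definition simple_drawing :: "coloured_drawing \<Rightarrow> bool" where
  "simple_drawing T \<longleftrightarrow>
     (\<forall>e\<in>edges T. \<forall>f\<in>edges T. e \<inter> verts T = f \<inter> verts T \<longrightarrow> e = f)"

definition faces :: "coloured_drawing \<Rightarrow> (real^3) set set" where
  "faces T = components (S2 - (verts T \<union> \<Union>(edges T)))"

text \<open>The boundary is taken relative to the sphere: within \<open>\<real>\<^sup>3\<close> a face has empty interior.\<close>

definition bdry :: "(real^3) set \<Rightarrow> (real^3) set" where
  "bdry F = top_of_set S2 frontier_of F"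

definition face_verts :: "coloured_drawing \<Rightarrow> (real^3) set \<Rightarrow> (real^3) set" where
  "face_verts T F = verts T \<inter> bdry F"

text \<open>The boundary of a triangular face is a 3-cycle of the graph; its three edges form a Jordan curve
  on the sphere, so that the closure of the face is a disc.\<close>

definition triangular_face :: "coloured_drawing \<Rightarrow> (real^3) set \<Rightarrow> bool" where
  "triangular_face T F \<longleftrightarrow>
     (\<exists>r c s. \<exists>e\<in>edges T. \<exists>f\<in>edges T. \<exists>g\<in>edges T.
        r \<noteq> c \<and> c \<noteq> s \<and> r \<noteq> s \<and>
        e \<inter> verts T = {r, c} \<and> f \<inter> verts T = {c, s} \<and> g \<inter> verts T = {s, r} \<and>
        bdry F = e \<union> f \<union> g)"

definition share_edge :: "coloured_drawing \<Rightarrow> (real^3) set \<Rightarrow> (real^3) set \<Rightarrow> bool" where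
  "share_edge T F G \<longleftrightarrow> (\<exists>e\<in>edges T. e \<subseteq> bdry F \<and> e \<subseteq> bdry G)"

definition face_2_coloured_triangulation :: "coloured_drawing \<Rightarrow> bool" where
  "face_2_coloured_triangulation T \<longleftrightarrow>
     graph_on_sphere T \<and> (\<forall>F\<in>faces T. triangular_face T F) \<and>
     white T \<union> black T = faces T \<and> white T \<inter> black T = {} \<and>
     (\<forall>F\<in>faces T. \<forall>G\<in>faces T. F \<noteq> G \<and> share_edge T F G \<longrightarrow> (F \<in> white T \<longleftrightarrow> G \<in> black T))"


section \<open>The canonical group\<close>

definition white_relations :: "coloured_drawing \<Rightarrow> ((real^3) \<Rightarrow>\<^sub>0 int) set" where
  "white_relations T = {\<Sum>v\<in>face_verts T F. frag_of v | F. F \<in> white T}"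

definition white_group :: "coloured_drawing \<Rightarrow> ((real^3) \<Rightarrow>\<^sub>0 int) set monoid" where
  "white_group T =
     free_Abelian_group (verts T) Mod generate (free_Abelian_group (verts T)) (white_relations T)"

definition torsion_subgroup :: "'a monoid \<Rightarrow> 'a monoid" where
  "torsion_subgroup G =
     G\<lparr>carrier := {x \<in> carrier G. \<exists>n::nat. n > 0 \<and> x [^]\<^bsub>G\<^esub> n = \<one>\<^bsub>G\<^esub>}\<rparr>"

text \<open>The finite group \<open>C\<close> in a decomposition of \<open>white_group T\<close> as \<open>\<int> \<oplus> \<int> \<oplus> C\<close> is its torsion
  subgroup, see \<open>canonical_group_iso\<close>.\<close>

definition canonical_group :: "coloured_drawing \<Rightarrow> ((real^3) \<Rightarrow>\<^sub>0 int) set monoid" where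
  "canonical_group T = torsion_subgroup (white_group T)"

lemma group_white_group: "group (white_group T)"
proof -
  let ?F = "free_Abelian_group (verts T)"
  interpret F: comm_group ?F by (rule abelian_free_Abelian_group)
  have "white_relations T \<subseteq> carrier ?F"
  proof
    fix x assume "x \<in> white_relations T"
    then obtain F where x: "x = (\<Sum>v\<in>face_verts T F. frag_of v)"
      by (auto simp: white_relations_def)
    have "Poly_Mapping.keys (\<Sum>v\<in>face_verts T F. frag_of v) \<subseteq> (\<Union>v\<in>face_verts T F. Poly_Mapping.keys (frag_of v))"
      by (rule Poly_Mapping.keys_sum)
    also have "\<dots> \<subseteq> verts T" by (auto simp: face_verts_def)
    finally show "x \<in> carrier ?F" by (simp add: x free_Abelian_group_def)
  qed
  then have "subgroup (generate ?F (white_relations T)) ?F"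
    by (rule F.generate_is_subgroup)
  then have "generate ?F (white_relations T) \<lhd> ?F"
    by (rule F.subgroup_imp_normal)
  then show ?thesis
    unfolding white_group_def by (rule normal.factorgroup_is_group)
qed

lemma torsion_subgroup_iso:
  assumes "group G" "group H" "h \<in> iso G H"
  shows "torsion_subgroup G \<cong> torsion_subgroup H"
proof -
  interpret group_hom G H h
    using assms by (simp add: group_hom_def group_hom_axioms_def iso_def)
  have bij: "bij_betw h (carrier G) (carrier H)" using assms(3) by (simp add: iso_def)
  have pow1: "h x [^]\<^bsub>H\<^esub> n = \<one>\<^bsub>H\<^esub> \<longleftrightarrow> x [^]\<^bsub>G\<^esub> n = \<one>\<^bsub>G\<^esub>" if "x \<in> carrier G" for x and n :: nat
  proof -
    have "h x [^]\<^bsub>H\<^esub> n = h (x [^]\<^bsub>G\<^esub> n)" using that by (simp add: hom_nat_pow)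
    moreover have "h (x [^]\<^bsub>G\<^esub> n) = h \<one>\<^bsub>G\<^esub> \<longleftrightarrow> x [^]\<^bsub>G\<^esub> n = \<one>\<^bsub>G\<^esub>"
      by (rule inj_on_eq_iff[OF bij_betw_imp_inj_on[OF bij]])
         (use that G.nat_pow_closed G.one_closed in blast)+
    ultimately show ?thesis by (metis hom_one)
  qed
  have "bij_betw h (carrier (torsion_subgroup G)) (carrier (torsion_subgroup H))"
    using bij_betw_Collect[OF bij, of "\<lambda>y. \<exists>n::nat. n > 0 \<and> y [^]\<^bsub>H\<^esub> n = \<one>\<^bsub>H\<^esub>"
        "\<lambda>x. \<exists>n::nat. n > 0 \<and> x [^]\<^bsub>G\<^esub> n = \<one>\<^bsub>G\<^esub>"] pow1
    by (simp add: torsion_subgroup_def)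
  moreover have "h \<in> hom (torsion_subgroup G) (torsion_subgroup H)"
    using pow1 by (auto simp: hom_def torsion_subgroup_def)
  ultimately show ?thesis by (auto simp: is_iso_def iso_def)
qed

lemma torsion_subgroup_Z_Z_finite:
  assumes "group C" "finite (carrier C)"
  shows "C \<cong> torsion_subgroup (integer_group \<times>\<times> (integer_group \<times>\<times> C))"
proof -
  let ?P = "integer_group \<times>\<times> (integer_group \<times>\<times> C)"
  interpret C: group C by fact
  have pow: "(a, b, c) [^]\<^bsub>?P\<^esub> n = (int n * a, int n * b, c [^]\<^bsub>C\<^esub> n)" for a b c and n :: nat
    by (induction n) (auto simp: algebra_simps)
  have "\<exists>n::nat. n > 0 \<and> c [^]\<^bsub>C\<^esub> n = \<one>\<^bsub>C\<^esub>" if "c \<in> carrier C" for c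
    using C.pow_order_eq_1[OF that] C.order_gt_0_iff_finite assms(2) by auto
  then have car: "carrier (torsion_subgroup ?P) = {0} \<times> {0} \<times> carrier C"
    unfolding torsion_subgroup_def by (auto simp: pow)
  have "(\<lambda>c. (0, 0, c)) \<in> iso C (torsion_subgroup ?P)"
    unfolding iso_def hom_def bij_betw_def car
    by (auto simp: torsion_subgroup_def inj_on_def)
  then show ?thesis by (auto simp: is_iso_def)
qed

lemma canonical_group_iso:
  assumes "group C" "finite (carrier C)"
    and "white_group T \<cong> integer_group \<times>\<times> (integer_group \<times>\<times> C)"
  shows "canonical_group T \<cong> C"
proof -
  have "group (integer_group \<times>\<times> (integer_group \<times>\<times> C))"
    using assms(1) by (simp add: DirProd_group)
  then have *: "canonical_group T \<cong> torsion_subgroup (integer_group \<times>\<times> (integer_group \<times>\<times> C))"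
    using torsion_subgroup_iso[OF group_white_group] assms(3)
    unfolding canonical_group_def is_iso_def by fastforce
  obtain h where h: "h \<in> iso C (torsion_subgroup (integer_group \<times>\<times> (integer_group \<times>\<times> C)))"
    using torsion_subgroup_Z_Z_finite[OF assms(1,2)] by (auto simp: is_iso_def)
  have "torsion_subgroup (integer_group \<times>\<times> (integer_group \<times>\<times> C)) \<cong> C"
    using group.iso_sym[OF assms(1)] h by (auto simp: is_iso_def)
  with * show ?thesis by (rule iso_trans)
qed

definition canonical_orders :: "nat \<Rightarrow> nat set" where
  "canonical_orders t =
     {order (canonical_group T) | T :: coloured_drawing.
        face_2_coloured_triangulation T \<and> simple_drawing T \<and>
        card (white T) = t \<and> card (black T) = t}"

text \<open>The supremum is a maximum, as \<open>canonical_orders t\<close> is finite. For a few small \<open>t\<close>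
  (such as \<open>t = 2\<close>) the set is empty and \<open>max_canonical_order t = 0\<close>.\<close>

definition max_canonical_order :: "nat \<Rightarrow> nat" where
  "max_canonical_order t = Sup (canonical_orders t)"

end

theory Submission
  imports Defs "Jordan_Normal_Form.Determinant"
begin

text \<open>The vertices have a proper 3-colouring, and contracting the triangulation onto one colour class
  \<open>R\<close> gives an Eulerian digraph: each black face is an arc from its vertex in \<open>R\<close> to the vertex in \<open>R\<close> of
  the white face across the opposite edge. The order of the canonical group is at most the
  determinant of the reduced Laplacian \<open>D - A\<close> of this digraph, which is at most \<open>\<Prod> d\<^sub>r\<close>, where \<open>d\<^sub>r\<close>
  is the number of white faces at \<open>r\<close>. As
  \<open>ln det (1 - D\<^sup>-\<^sup>1 A)\<close> is minus the sum of all \<open>tr ((D\<^sup>-\<^sup>1 A)\<^sup>k) / k\<close>, each directed 3-cycle saves a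
  factor \<open>exp (- 1 / (d d' d''))\<close>.

  The degrees \<open>d\<close> of \<open>R\<close> sum to \<open>t\<close>, and \<open>ln d / d \<le> ln 2 / 2 < ln 6 / 5\<close> unless \<open>d = 3\<close>. A vertex with \<open>d = 3\<close>
  is surrounded by a directed 3-cycle of each of the other two classes, and the saving from one of
  them, together with what the neighbours on it lose against \<open>ln 6 / 5\<close> when their degrees are not 3,
  outweighs the excess \<open>ln 3 - 3 ln 6 / 5\<close>. Multiplying the bounds for the three classes gives the theorem.

  The sphere enters through the Jordan curve theorem, which yields \<open>|V| - |E| + |F| \<ge> 2\<close>, and the
  3-colouring is read off a real solution of the white relations, which exists by this inequality.\<close>

section \<open>Determinants and lattices\<close>

text \<open>A single class does not reach the bound by itself: the vertices with \<open>wdeg\<close>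
  3 that are in excess have the contracted colour \<open>i\<close>, while the 3-cycles that pay
  surround vertices of another colour \<open>j\<close>. The bound for a class therefore carries the
  error (number of such vertices of colour \<open>i\<close> minus number of those of colour
  \<open>j\<close>) / 36, and these errors cancel when (\<open>i\<close>, \<open>j\<close>) runs
  through (0, 1), (1, 2), (2, 0). An excess of c for each vertex with \<open>wdeg\<close> 3
  corresponds to the rate (ln 3 - c) / 3, which is below ln 6 / 5 exactly when 5 c > ln (9 / 8),
  that is, when c exceeds about 0.0236. The choice c = 1 / 36 = 1 / (3 * 3 * 4) leaves a little
  room, and is the saving of a 3-cycle through vertices of degrees 3, 3, 4.\<close>

lemma det_schur_step:
  fixes a :: "nat \<Rightarrow> nat \<Rightarrow> 'a::field"
  assumes a0: "a 0 0 \<noteq> 0"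
  shows "Determinant.det (Matrix.mat (Suc n) (Suc n) (\<lambda>(i,j). a i j)) =
    a 0 0 * Determinant.det (Matrix.mat n n (\<lambda>(i,j). a (Suc i) (Suc j) - a (Suc i) 0 * a 0 (Suc j) / a 0 0))"
proof -
  define A where "A = Matrix.mat (Suc n) (Suc n) (\<lambda>(i,j). a i j)"
  define S where "S = Matrix.mat n n (\<lambda>(i,j). a (Suc i) (Suc j) - a (Suc i) 0 * a 0 (Suc j) / a 0 0)"
  define l where "l = Matrix.mat n 1 (\<lambda>(i,j). a (Suc i) 0 / a 0 0)"
  define u where "u = Matrix.mat 1 n (\<lambda>(i,j). a 0 (Suc j))"
  define d where "d = Matrix.mat 1 1 (\<lambda>(i,j). a 0 0)"
  define L where "L = four_block_mat (1\<^sub>m 1) (0\<^sub>m 1 n) l (1\<^sub>m n)"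
  define U where "U = four_block_mat d u (0\<^sub>m n 1) S"
  have carr: "S \<in> carrier_mat n n" "l \<in> carrier_mat n 1" "u \<in> carrier_mat 1 n" "d \<in> carrier_mat 1 1"
    by (auto simp: S_def l_def u_def d_def)
  \<comment> \<open>Gaussian elimination of the first column as a block factorisation:
    \<open>L\<close> is unit lower triangular, and \<open>S\<close> is the Schur complement of the
    entry (0, 0).\<close>
  have "L * U = four_block_mat d u (l * d) (l * u + S)"
    unfolding L_def U_def using carr
    by (subst mult_four_block_mat[of _ 1 1 _ n _ n _ _ 1 _ n]) auto
  also have "\<dots> = A"
    unfolding A_def
    by (rule eq_matI)
      (auto simp: carr S_def l_def u_def d_def a0 scalar_prod_def less_Suc_eq_0_disj)
  finally have A: "A = L * U" ..
  have dimL: "L \<in> carrier_mat (1 + n) (1 + n)" unfolding L_def by (rule four_block_carrier_mat) auto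
  have dimU: "U \<in> carrier_mat (1 + n) (1 + n)" unfolding U_def using carr(4,1) by (rule four_block_carrier_mat)
  have "Determinant.det A = Determinant.det L * Determinant.det U"
    unfolding A using dimL dimU by (rule det_mult)
  also have "Determinant.det L = 1"
    unfolding L_def by (subst det_four_block_mat_upper_right_zero[OF one_carrier_mat refl carr(2) one_carrier_mat]) simp
  also have "Determinant.det U = Determinant.det d * Determinant.det S"
    unfolding U_def using carr(4,3) refl carr(1) by (rule det_four_block_mat_lower_left_zero_col)
  also have "Determinant.det d = a 0 0" using det_single[OF carr(4)] by (simp add: d_def)
  finally show ?thesis by (simp add: A_def S_def)
qed

lemma det_zero_row:
  fixes a :: "nat \<Rightarrow> nat \<Rightarrow> 'a::comm_ring_1"
  assumes "k < n" "\<And>j. j < n \<Longrightarrow> a k j = 0"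
  shows "Determinant.det (Matrix.mat n n (\<lambda>(i,j). a i j)) = 0"
proof -
  have "(\<Prod>i = 0..<n. a i (p i)) = 0" if "p permutes {0..<n}" for p
  proof (rule prod_zero)
    have "p k < n" using permutes_in_image[OF that, of k] assms(1) by simp
    then show "\<exists>i\<in>{0..<n}. a i (p i) = 0" using assms by (intro bexI[of _ k]) auto
  qed simp
  moreover have "p i < n" if "p permutes {0..<n}" "i < n" for p i
    using permutes_in_image[OF that(1), of i] that(2) by simp
  ultimately show ?thesis
    by (subst det_def'[of _ n]) (auto intro!: sum.neutral)
qed

text \<open>The 2-cycles make the induction work: eliminating an index turns the 3-cycles through it into
  2-cycles, and the 2-cycles through it reduce the diagonal.\<close>

lemma det_dominant_le:
  fixes a :: "nat \<Rightarrow> nat \<Rightarrow> real"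
  defines "b \<equiv> \<lambda>a i j. if i = j then 0 else - a i j / a i i"
  assumes "\<And>i j. i < n \<Longrightarrow> j < n \<Longrightarrow> i \<noteq> j \<Longrightarrow> a i j \<le> 0"
    and "\<And>i. i < n \<Longrightarrow> 0 \<le> (\<Sum>j<n. a i j)"
  shows "0 \<le> Determinant.det (Matrix.mat n n (\<lambda>(i,j). a i j))"
    and "Determinant.det (Matrix.mat n n (\<lambda>(i,j). a i j)) \<le> (\<Prod>i<n. a i i) *
      exp (- ((\<Sum>i<n. \<Sum>j<n. b a i j * b a j i) / 2 + (\<Sum>i<n. \<Sum>j<n. \<Sum>k<n. b a i j * b a j k * b a k i) / 3))"
proof -
  have "0 \<le> Determinant.det (Matrix.mat n n (\<lambda>(i,j). a i j)) \<and>
    Determinant.det (Matrix.mat n n (\<lambda>(i,j). a i j)) \<le> (\<Prod>i<n. a i i) *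
      exp (- ((\<Sum>i<n. \<Sum>j<n. b a i j * b a j i) / 2 + (\<Sum>i<n. \<Sum>j<n. \<Sum>k<n. b a i j * b a j k * b a k i) / 3))"
    using assms(2,3)
  proof (induction n arbitrary: a)
    case 0
    then show ?case by simp
  next
    case (Suc n)
    note off = Suc.prems(1) and row = Suc.prems(2)
    have diag: "0 \<le> a i i" if "i < Suc n" for i
    proof -
      have "0 \<le> (\<Sum>j<Suc n. a i j)" using row that .
      also have "\<dots> = a i i + (\<Sum>j\<in>{..<Suc n}-{i}. a i j)" using that by (subst sum.remove[of _ i]) auto
      also have "\<dots> \<le> a i i" using off that by (auto intro!: sum_nonpos)
      finally show ?thesis .
    qed
    show ?case
    proof (cases "a 0 0 = 0")
      case True
      \<comment> \<open>A zero diagonal entry, nonpositive other entries and a nonnegative row sum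
        leave only the zero row.\<close>
      have "a 0 j = 0" if "j < Suc n" for j
      proof (cases "j = 0")
        case False
        have "0 \<le> (\<Sum>j<Suc n. a 0 j)" using row by simp
        also have "\<dots> = a 0 j + (\<Sum>i\<in>{..<Suc n}-{j}. a 0 i)" using that by (subst sum.remove[of _ j]) auto
        also have "(\<Sum>i\<in>{..<Suc n}-{j}. a 0 i) \<le> 0"
        proof (intro sum_nonpos)
          fix i assume "i \<in> {..<Suc n} - {j}"
          then show "a 0 i \<le> 0" using off[of 0 i] True by (cases "i = 0") auto
        qed
        finally show ?thesis using off[of 0 j] that False by auto
      qed (use True in simp)
      then have "Determinant.det (Matrix.mat (Suc n) (Suc n) (\<lambda>(i,j). a i j)) = 0"
        by (intro det_zero_row[of 0]) auto
      moreover have "(\<Prod>i<Suc n. a i i) = 0" using True by (intro prod_zero) auto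
      ultimately show ?thesis by (simp only: mult_zero_left order.refl simp_thms)
    next
      case False
      with diag have a0: "a 0 0 > 0" by force
      define a' where "a' = (\<lambda>i j. a (Suc i) (Suc j) - a (Suc i) 0 * a 0 (Suc j) / a 0 0)"
      have det: "Determinant.det (Matrix.mat (Suc n) (Suc n) (\<lambda>(i,j). a i j)) =
          a 0 0 * Determinant.det (Matrix.mat n n (\<lambda>(i,j). a' i j))"
        unfolding a'_def using False by (rule det_schur_step)
      have ge: "0 \<le> a (Suc i) 0 * a 0 (Suc j) / a 0 0" if "i < n" "j < n" for i j
        using off[of "Suc i" 0] off[of 0 "Suc j"] that a0 by (auto simp: mult_nonpos_nonpos)
      have off': "a' i j \<le> 0" if "i < n" "j < n" "i \<noteq> j" for i j
        using off[of "Suc i" "Suc j"] ge[of i j] that by (auto simp: a'_def)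
      have row': "0 \<le> (\<Sum>j<n. a' i j)" if "i < n" for i
      proof -
        have r1: "0 \<le> a (Suc i) 0 + (\<Sum>j<n. a (Suc i) (Suc j))"
          using row[of "Suc i"] that by (simp only: sum.lessThan_Suc_shift)
        have r0: "0 \<le> a 0 0 + (\<Sum>j<n. a 0 (Suc j))"
          using row[of 0] by (simp only: sum.lessThan_Suc_shift)
        have "(\<Sum>j<n. a' i j) = (\<Sum>j<n. a (Suc i) (Suc j)) - a (Suc i) 0 / a 0 0 * (\<Sum>j<n. a 0 (Suc j))"
          by (simp add: a'_def sum_subtractf sum_distrib_left)
        also have "\<dots> = (a (Suc i) 0 + (\<Sum>j<n. a (Suc i) (Suc j))) - a (Suc i) 0 / a 0 0 * (a 0 0 + (\<Sum>j<n. a 0 (Suc j)))"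
          using a0 by (simp add: field_simps)
        moreover have "a (Suc i) 0 / a 0 0 * (a 0 0 + (\<Sum>j<n. a 0 (Suc j))) \<le> 0"
          using r0 off[of "Suc i" 0] that a0 by (intro mult_nonpos_nonneg) (auto simp: divide_nonpos_pos)
        ultimately show ?thesis using r1 by linarith
      qed
      note IH = Suc.IH[of a', OF off' row']
      have diag': "0 \<le> a' i i" if "i < n" for i
      proof -
        have "0 \<le> (\<Sum>j<n. a' i j)" using row' that .
        also have "\<dots> = a' i i + (\<Sum>j\<in>{..<n}-{i}. a' i j)" using that by (subst sum.remove[of _ i]) auto
        also have "\<dots> \<le> a' i i" using off' that by (auto intro!: sum_nonpos)
        finally show ?thesis .
      qed
      have prod_ge: "0 \<le> (\<Prod>i<Suc n. a i i)" using diag by (intro prod_nonneg) auto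
      show ?thesis
      proof (cases "\<exists>i<n. a' i i = 0")
        \<comment> \<open>Here \<open>b a'\<close> takes the default quotient 0 somewhere, so
          \<open>B\<close> cannot be compared with \<open>B'\<close>. But the product in the
          induction hypothesis vanishes and forces the determinant to be 0.\<close>
        case True
        then have "(\<Prod>i<n. a' i i) = 0" by (auto intro!: prod_zero)
        with IH have "Determinant.det (Matrix.mat n n (\<lambda>(i,j). a' i j)) = 0" by auto
        then show ?thesis using prod_ge by (simp add: det)
      next
        case nz: False
        have pos': "a' i i > 0" if "i < n" for i using diag' nz that by force
        have le: "a' i i \<le> a (Suc i) (Suc i)" if "i < n" for i using ge[OF that that] by (simp add: a'_def)
        have pos: "a (Suc i) (Suc i) > 0" if "i < n" for i using pos'[OF that] le[OF that] by linarith
        define B where "B = b a"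
        define B' where "B' = b a'"
        have B0: "B i i = 0" for i by (simp add: B_def b_def)
        have Bnn: "0 \<le> B i j" if "i < Suc n" "j < Suc n" for i j
          using off[of i j] diag[of i] that by (auto simp: B_def b_def divide_nonpos_nonneg)
        \<comment> \<open>Elimination adds to the step from i to j the detour through 0, and the
          smaller diagonal entry can only enlarge the quotient.\<close>
        have B'ge: "B (Suc i) (Suc j) + B (Suc i) 0 * B 0 (Suc j) \<le> B' i j" if "i < n" "j < n" "i \<noteq> j" for i j
        proof -
          have "B (Suc i) (Suc j) + B (Suc i) 0 * B 0 (Suc j) = (- a' i j) / a (Suc i) (Suc i)"
            using that a0 pos[of i] by (simp add: B_def b_def a'_def field_simps)
          also have "\<dots> \<le> (- a' i j) / a' i i"
            using le[of i] pos'[of i] off'[of i j] that by (intro divide_left_mono) (auto simp: mult_pos_pos pos)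
          finally show ?thesis using that by (simp add: B'_def b_def)
        qed
        have B'nn: "0 \<le> B' i j" if "i < n" "j < n" for i j
          using off'[of i j] diag'[of i] that by (auto simp: B'_def b_def divide_nonpos_nonneg)
        have B'B: "B (Suc i) (Suc j) \<le> B' i j" if "i < n" "j < n" for i j
        proof (cases "i = j")
          case False
          have "0 \<le> B (Suc i) 0 * B 0 (Suc j)" using Bnn that by (intro mult_nonneg_nonneg) auto
          with B'ge[OF that False] show ?thesis by linarith
        qed (use B0 B'nn that in auto)
        \<comment> \<open>Expand (x + p) (y + q), where p and q are the detours through 0: the mixed
          terms are the 3-cycles through 0, and p q \<ge> 0 is dropped.\<close>
        have two: "B (Suc i) (Suc j) * B (Suc j) (Suc i) + B 0 (Suc i) * B (Suc i) (Suc j) * B (Suc j) 0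
             + B 0 (Suc j) * B (Suc j) (Suc i) * B (Suc i) 0 \<le> B' i j * B' j i" if "i < n" "j < n" for i j
        proof (cases "i = j")
          case False
          let ?x = "B (Suc i) (Suc j)" and ?y = "B (Suc j) (Suc i)"
          let ?p = "B (Suc i) 0 * B 0 (Suc j)" and ?q = "B (Suc j) 0 * B 0 (Suc i)"
          have nn: "0 \<le> ?x" "0 \<le> ?y" "0 \<le> ?p" "0 \<le> ?q" using Bnn that by auto
          have "?x * ?y + ?x * ?q + ?y * ?p \<le> (?x + ?p) * (?y + ?q)"
            using mult_nonneg_nonneg[OF nn(3,4)] by (simp add: distrib_left distrib_right mult.commute[of "?y"])
          also have "\<dots> \<le> B' i j * B' j i"
            using B'ge[OF that False] B'ge[of j i] that False nn B'nn by (intro mult_mono) auto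
          finally show ?thesis by (simp add: algebra_simps)
        qed (use B0 B'nn that in \<open>auto simp: B'_def b_def\<close>)
        have three: "B (Suc i) (Suc j) * B (Suc j) (Suc k) * B (Suc k) (Suc i) \<le> B' i j * B' j k * B' k i"
          if "i < n" "j < n" "k < n" for i j k
          using that B'B B'nn Bnn by (intro mult_mono) auto
        define s1 where "s1 = (\<Sum>i<n. B (Suc i) 0 * B 0 (Suc i))"
        define s2 where "s2 = (\<Sum>i<n. \<Sum>j<n. B (Suc i) (Suc j) * B (Suc j) (Suc i))"
        define s3 where "s3 = (\<Sum>i<n. \<Sum>j<n. \<Sum>k<n. B (Suc i) (Suc j) * B (Suc j) (Suc k) * B (Suc k) (Suc i))"
        define t where "t = (\<Sum>i<n. \<Sum>j<n. B 0 (Suc i) * B (Suc i) (Suc j) * B (Suc j) 0)"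
        have t': "(\<Sum>i<n. \<Sum>j<n. B 0 (Suc j) * B (Suc j) (Suc i) * B (Suc i) 0) = t"
          unfolding t_def by (rule sum.swap)
        have e2: "(\<Sum>i<Suc n. \<Sum>j<Suc n. B i j * B j i) = s2 + 2 * s1"
          by (simp only: sum.lessThan_Suc_shift sum.distrib B0 s1_def s2_def) (simp add: mult.commute)
        have e3: "(\<Sum>i<Suc n. \<Sum>j<Suc n. \<Sum>k<Suc n. B i j * B j k * B k i) = s3 + 3 * t"
        proof -
          have x: "(\<Sum>i<n. \<Sum>k<n. B (Suc i) 0 * B 0 (Suc k) * B (Suc k) (Suc i)) = t"
            unfolding t_def by (subst sum.swap) (simp add: mult_ac)
          have y: "(\<Sum>i<n. \<Sum>j<n. B (Suc i) (Suc j) * B (Suc j) 0 * B 0 (Suc i)) = t"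
            unfolding t_def by (simp add: mult_ac)
          show ?thesis
            by (simp only: sum.lessThan_Suc_shift sum.distrib B0 mult_zero_left mult_zero_right sum.neutral_const
                add_0_left add_0_right s3_def[symmetric] t_def[symmetric] x y)
        qed
        define E' where "E' = (\<Sum>i<n. \<Sum>j<n. B' i j * B' j i) / 2 + (\<Sum>i<n. \<Sum>j<n. \<Sum>k<n. B' i j * B' j k * B' k i) / 3"
        have "s2 + t + (\<Sum>i<n. \<Sum>j<n. B 0 (Suc j) * B (Suc j) (Suc i) * B (Suc i) 0) \<le> (\<Sum>i<n. \<Sum>j<n. B' i j * B' j i)"
          unfolding s2_def t_def sum.distrib[symmetric] by (intro sum_mono two) auto
        moreover have "s3 \<le> (\<Sum>i<n. \<Sum>j<n. \<Sum>k<n. B' i j * B' j k * B' k i)"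
          unfolding s3_def by (intro sum_mono three) auto
        \<comment> \<open>A 3-cycle through 0 counts 3 / 3 on the left; on the right it shows up as
          two ordered 2-cycles of weight 1 / 2 each. The 2-cycles through 0 go into
          \<open>s1\<close>.\<close>
        ultimately have E: "(s2 + 2 * s1) / 2 + (s3 + 3 * t) / 3 \<le> s1 + E'"
          unfolding E'_def t' by argo
        \<comment> \<open>The 2-cycle through 0 shrinks the diagonal entry by a factor 1 - x \<le>
          exp (- x).\<close>
        have "a' i i \<le> a (Suc i) (Suc i) * exp (- (B (Suc i) 0 * B 0 (Suc i)))" if "i < n" for i
        proof -
          have "a' i i = a (Suc i) (Suc i) * (1 + (- (B (Suc i) 0 * B 0 (Suc i))))"
            using pos[OF that] a0 by (simp add: a'_def B_def b_def field_simps)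
          also have "\<dots> \<le> a (Suc i) (Suc i) * exp (- (B (Suc i) 0 * B 0 (Suc i)))"
            using pos[OF that] by (intro mult_left_mono exp_ge_add_one_self) auto
          finally show ?thesis .
        qed
        then have "(\<Prod>i<n. a' i i) \<le> (\<Prod>i<n. a (Suc i) (Suc i) * exp (- (B (Suc i) 0 * B 0 (Suc i))))"
          using diag' by (intro prod_mono) auto
        also have "\<dots> = (\<Prod>i<n. a (Suc i) (Suc i)) * exp (- s1)"
          by (simp add: prod.distrib exp_sum s1_def sum_negf[symmetric])
        finally have P: "(\<Prod>i<n. a' i i) \<le> (\<Prod>i<n. a (Suc i) (Suc i)) * exp (- s1)" .
        have "Determinant.det (Matrix.mat n n (\<lambda>(i,j). a' i j)) \<le> (\<Prod>i<n. a' i i) * exp (- E')"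
          using IH unfolding E'_def B'_def by blast
        also have "\<dots> \<le> ((\<Prod>i<n. a (Suc i) (Suc i)) * exp (- s1)) * exp (- E')"
          by (intro mult_right_mono P) simp
        also have "\<dots> = (\<Prod>i<n. a (Suc i) (Suc i)) * exp (- (s1 + E'))"
          by (simp add: exp_add[symmetric])
        also have "\<dots> \<le> (\<Prod>i<n. a (Suc i) (Suc i)) * exp (- ((s2 + 2 * s1) / 2 + (s3 + 3 * t) / 3))"
          using E diag by (intro mult_left_mono prod_nonneg) auto
        finally have "a 0 0 * Determinant.det (Matrix.mat n n (\<lambda>(i,j). a' i j)) \<le>
            a 0 0 * ((\<Prod>i<n. a (Suc i) (Suc i)) * exp (- ((s2 + 2 * s1) / 2 + (s3 + 3 * t) / 3)))"
          using a0 by (intro mult_left_mono) auto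
        also have "\<dots> = (\<Prod>i<Suc n. a i i) * exp (- ((s2 + 2 * s1) / 2 + (s3 + 3 * t) / 3))"
          by (simp only: prod.lessThan_Suc_shift mult.assoc)
        finally show ?thesis
          using IH a0 unfolding det e2[symmetric] e3[symmetric] B_def by auto
      qed
    qed
  qed
  then show "0 \<le> Determinant.det (Matrix.mat n n (\<lambda>(i,j). a i j))"
    and "Determinant.det (Matrix.mat n n (\<lambda>(i,j). a i j)) \<le> (\<Prod>i<n. a i i) *
      exp (- ((\<Sum>i<n. \<Sum>j<n. b a i j * b a j i) / 2 + (\<Sum>i<n. \<Sum>j<n. \<Sum>k<n. b a i j * b a j k * b a k i) / 3))"
    by auto
qed

section \<open>Real kernels and integer row lattices\<close>

lemma homogeneous_system_nontrivial:
  fixes f :: "'i \<Rightarrow> 'v \<Rightarrow> real"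
  assumes "finite I" "finite V" "card I < card V"
  shows "\<exists>p. (\<exists>v\<in>V. p v \<noteq> 0) \<and> (\<forall>i\<in>I. (\<Sum>v\<in>V. f i v * p v) = 0)"
proof -
  define n where "n = card V"
  obtain g where g: "bij_betw g {..<n} V" using ex_bij_betw_nat_finite[OF assms(2)] by (auto simp: n_def atLeast0LessThan)
  obtain h where h: "bij_betw h {..<card I} I" using ex_bij_betw_nat_finite[OF assms(1)] by (auto simp: atLeast0LessThan)
  \<comment> \<open>Zero rows pad the system to a square matrix; as there are fewer equations than
    unknowns, at least one such row occurs.\<close>
  define A where "A = Matrix.mat n n (\<lambda>(i,j). if i < card I then f (h i) (g j) else 0)"
  have A: "A \<in> carrier_mat n n" by (simp add: A_def)
  have "Determinant.det A = 0"
    unfolding A_def using assms(3) by (intro det_zero_row[of "card I"]) (auto simp: n_def)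
  then obtain x where x: "x \<in> carrier_vec n" "x \<noteq> 0\<^sub>v n" "A *\<^sub>v x = 0\<^sub>v n"
    using det_0_iff_vec_prod_zero_field[OF A] by blast
  define p where "p = (\<lambda>v. vec_index x (inv_into {..<n} g v))"
  have pg: "p (g j) = vec_index x j" if "j < n" for j
    using that g by (simp add: p_def bij_betw_def)
  obtain j where j: "j < n" "vec_index x j \<noteq> 0"
    using x(1,2) by (auto simp: vec_eq_iff)
  have "\<exists>v\<in>V. p v \<noteq> 0" using j pg[OF j(1)] bij_betwE[OF g] by (intro bexI[of _ "g j"]) auto
  moreover have "(\<Sum>v\<in>V. f i v * p v) = 0" if "i \<in> I" for i
  proof -
    have "i \<in> h ` {..<card I}" using h that by (simp add: bij_betw_def)
    then obtain k where k: "k < card I" "h k = i" by auto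
    then have kn: "k < n" using assms(3) by (simp add: n_def)
    have "(\<Sum>v\<in>V. f i v * p v) = (\<Sum>j<n. f i (g j) * p (g j))"
      using sum.reindex_bij_betw[OF g, of "\<lambda>v. f i v * p v"] by simp
    also have "\<dots> = (\<Sum>j<n. A $$ (k,j) * vec_index x j)"
      using k kn by (intro sum.cong) (auto simp: A_def pg)
    also have "\<dots> = vec_index (A *\<^sub>v x) k"
      using A x(1) kn by (simp add: scalar_prod_def atLeast0LessThan)
    also have "\<dots> = 0" using x(3) kn by simp
    finally show ?thesis .
  qed
  ultimately show ?thesis by blast
qed

text \<open>Euclid's algorithm on the first column: while two entries are nonzero, the larger one is
  replaced by a remainder modulo the smaller one, which lowers the sum of the absolute values. The
  row operations are collected in the unimodular \<open>P\<close>, so the row lattice is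
  unchanged.\<close>

lemma int_mat_clear_column:
  fixes M :: "int mat"
  assumes "M \<in> carrier_mat m m" "0 < m"
  shows "\<exists>P\<in>carrier_mat m m. \<bar>Determinant.det P\<bar> = 1 \<and> (\<forall>i. 0 < i \<and> i < m \<longrightarrow> (P * M) $$ (i,0) = 0)"
  using assms(1)
proof (induction "\<Sum>i<m. nat \<bar>M $$ (i,0)\<bar>" arbitrary: M rule: less_induct)
  case less
  note M = less.prems
  show ?case
  proof (cases "\<exists>i j. i < m \<and> j < m \<and> i \<noteq> j \<and> M $$ (i,0) \<noteq> 0 \<and> M $$ (j,0) \<noteq> 0")
    case True
    then obtain i j where ij: "i < m" "j < m" "i \<noteq> j" "M $$ (i,0) \<noteq> 0" "\<bar>M $$ (i,0)\<bar> \<le> \<bar>M $$ (j,0)\<bar>"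
      by (metis linorder_le_cases)
    define q where "q = - (M $$ (j,0) div M $$ (i,0))"
    define A where "A = addrow_mat m q j i"
    have A: "A \<in> carrier_mat m m" "Determinant.det A = 1"
      unfolding A_def using ij by (auto simp: det_addrow_mat)
    have AM: "A * M = addrow q j i M" unfolding A_def using addrow_mat[OF M ij(1)] by simp
    have AMc: "A * M \<in> carrier_mat m m" using A M by simp
    have ent: "(A * M) $$ (k,0) = (if k = j then M $$ (j,0) mod M $$ (i,0) else M $$ (k,0))" if "k < m" for k
      using that M assms(2) ij unfolding AM
      by (auto simp: q_def minus_div_mult_eq_mod[symmetric])
    have "(\<Sum>k<m. nat \<bar>(A * M) $$ (k,0)\<bar>) < (\<Sum>k<m. nat \<bar>M $$ (k,0)\<bar>)"
    proof (rule sum_strict_mono_ex1)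
      have lt: "\<bar>M $$ (j,0) mod M $$ (i,0)\<bar> < \<bar>M $$ (j,0)\<bar>"
        using abs_mod_less[OF ij(4), of "M $$ (j,0)"] ij(5) by linarith
      show "\<forall>k\<in>{..<m}. nat \<bar>(A * M) $$ (k,0)\<bar> \<le> nat \<bar>M $$ (k,0)\<bar>"
        using lt by (auto simp: ent)
      show "\<exists>k\<in>{..<m}. nat \<bar>(A * M) $$ (k,0)\<bar> < nat \<bar>M $$ (k,0)\<bar>"
        using lt ij by (intro bexI[of _ j]) (auto simp: ent)
    qed simp
    from less.hyps[OF this AMc] obtain P where P: "P \<in> carrier_mat m m" "\<bar>Determinant.det P\<bar> = 1"
      "\<And>i. 0 < i \<Longrightarrow> i < m \<Longrightarrow> (P * (A * M)) $$ (i,0) = 0" by blast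
    have "P * (A * M) = (P * A) * M" using P A M by simp
    moreover have "\<bar>Determinant.det (P * A)\<bar> = 1" using P A by (simp add: det_mult)
    ultimately show ?thesis using P A by (intro bexI[of _ "P * A"]) auto
  next
    case False
    show ?thesis
    proof (cases "\<exists>i. 0 < i \<and> i < m \<and> M $$ (i,0) \<noteq> 0")
      case True
      then obtain i where i: "0 < i" "i < m" "M $$ (i,0) \<noteq> 0" by blast
      have z: "M $$ (k,0) = 0" if "k < m" "k \<noteq> i" for k using False i that by blast
      have "swaprows_mat m 0 i * M = swaprows 0 i M"
        using swaprows_mat[OF M assms(2) i(2)] by simp
      then show ?thesis using i z M assms(2)
        by (intro bexI[of _ "swaprows_mat m 0 i"]) (auto simp: det_swaprows_mat)
    next
      case False
      then show ?thesis using M by (intro bexI[of _ "1\<^sub>m m"]) auto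
    qed
  qed
qed

text \<open>Once the first column is cleared down to a pivot g, the first coordinate is reduced
  modulo the absolute value of g and the others by induction modulo the rows of the lower right
  block. The numbers of choices multiply to the absolute value of the determinant.\<close>

lemma int_lattice_representatives:
  fixes M :: "int mat"
  assumes "M \<in> carrier_mat n n" "Determinant.det M \<noteq> 0"
  shows "\<exists>R::(nat \<Rightarrow> int) set. finite R \<and> card R \<le> nat \<bar>Determinant.det M\<bar> \<and>
    (\<forall>c. \<exists>r\<in>R. \<exists>y. \<forall>j<n. c j = r j + (\<Sum>i<n. y i * M $$ (i,j)))"
  using assms
proof (induction n arbitrary: M)
  case 0
  then show ?case by (intro exI[of _ "{\<lambda>_. 0}"]) auto
next
  case (Suc n)
  note M = Suc.prems(1)
  obtain P where P: "P \<in> carrier_mat (Suc n) (Suc n)" "\<bar>Determinant.det P\<bar> = 1"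
      "\<And>i. 0 < i \<Longrightarrow> i < Suc n \<Longrightarrow> (P * M) $$ (i,0) = 0"
    using int_mat_clear_column[OF M] by blast
  define M' where "M' = P * M"
  have M': "M' \<in> carrier_mat (Suc n) (Suc n)" using P M by (simp add: M'_def)
  define g where "g = M' $$ (0,0)"
  define u where "u = Matrix.mat 1 n (\<lambda>(i,j). M' $$ (0, Suc j))"
  define S where "S = Matrix.mat n n (\<lambda>(i,j). M' $$ (Suc i, Suc j))"
  define d where "d = Matrix.mat 1 1 (\<lambda>(i,j). g)"
  have carr: "S \<in> carrier_mat n n" "u \<in> carrier_mat 1 n" "d \<in> carrier_mat 1 1"
    by (auto simp: S_def u_def d_def)
  have "M' = four_block_mat d u (0\<^sub>m n 1) S"
    using M' P(3)[folded M'_def] carr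
    by (intro eq_matI) (auto simp: S_def u_def d_def g_def less_Suc_eq_0_disj)
  then have "Determinant.det M' = Determinant.det d * Determinant.det S"
    using det_four_block_mat_lower_left_zero_col[OF carr(3,2) refl carr(1)] by simp
  also have "Determinant.det d = g" using det_single[OF carr(3)] by (simp add: d_def)
  finally have "Determinant.det M' = g * Determinant.det S" .
  moreover have "\<bar>Determinant.det M'\<bar> = \<bar>Determinant.det M\<bar>"
    unfolding M'_def using P M by (simp add: det_mult abs_mult)
  ultimately have absdet: "\<bar>Determinant.det M\<bar> = \<bar>g\<bar> * \<bar>Determinant.det S\<bar>" by (simp add: abs_mult)
  with Suc.prems(2) have g: "g \<noteq> 0" and S0: "Determinant.det S \<noteq> 0" by auto
  from Suc.IH[OF carr(1) S0] obtain R where R: "finite R" "card R \<le> nat \<bar>Determinant.det S\<bar>"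
    "\<And>c. \<exists>r\<in>R. \<exists>y. \<forall>j<n. c j = r j + (\<Sum>i<n. y i * S $$ (i,j))" by blast
  define R' where "R' = (\<lambda>(k,r). case_nat k r) ` ({0..<\<bar>g\<bar>} \<times> R)"
  have fin: "finite R'" using R by (simp add: R'_def)
  have "card R' \<le> card ({0..<\<bar>g\<bar>} \<times> R)" unfolding R'_def using R by (intro card_image_le) auto
  also have "\<dots> = nat \<bar>g\<bar> * card R" by (simp add: card_cartesian_product)
  also have "\<dots> \<le> nat \<bar>g\<bar> * nat \<bar>Determinant.det S\<bar>" using R by (intro mult_left_mono) auto
  also have "\<dots> = nat \<bar>Determinant.det M\<bar>" by (simp add: absdet nat_mult_distrib)
  finally have card: "card R' \<le> nat \<bar>Determinant.det M\<bar>" .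
  have "\<exists>r\<in>R'. \<exists>y. \<forall>j<Suc n. c j = r j + (\<Sum>i<Suc n. y i * M $$ (i,j))" for c
  proof -
    \<comment> \<open>The sign enters because remainders are taken modulo the absolute value of g,
      while the pivot of the subtracted row is g itself.\<close>
    define y0 where "y0 = sgn g * (c 0 div \<bar>g\<bar>)"
    have c0: "c 0 = c 0 mod \<bar>g\<bar> + y0 * g"
    proof -
      have "(c 0 div \<bar>g\<bar>) * \<bar>g\<bar> = y0 * g"
        by (cases "g \<ge> 0") (simp_all add: y0_def sgn_if)
      then show ?thesis using div_mult_mod_eq[of "c 0" "\<bar>g\<bar>"] by linarith
    qed
    obtain r y where ry: "r \<in> R" "\<And>j. j < n \<Longrightarrow> c (Suc j) - y0 * M' $$ (0, Suc j) = r j + (\<Sum>i<n. y i * S $$ (i,j))"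
      using R(3)[of "\<lambda>j. c (Suc j) - y0 * M' $$ (0, Suc j)"] by blast
    define r' where "r' = case_nat (c 0 mod \<bar>g\<bar>) r"
    define y' where "y' = case_nat y0 y"
    have "r' \<in> R'" unfolding R'_def r'_def using ry(1) g by (auto intro!: image_eqI[of _ _ "(c 0 mod \<bar>g\<bar>, r)"])
    moreover have "c j = r' j + (\<Sum>i<Suc n. y' i * M' $$ (i,j))" if "j < Suc n" for j
    proof (cases j)
      case 0
      have "(\<Sum>i<n. y' (Suc i) * M' $$ (Suc i, 0)) = 0"
        using P(3)[folded M'_def] by (intro sum.neutral) auto
      then show ?thesis using c0 unfolding 0 sum.lessThan_Suc_shift
        by (simp add: r'_def y'_def g_def)
    next
      case (Suc k)
      with that have k: "k < n" by simp
      have "(\<Sum>i<n. y' (Suc i) * M' $$ (Suc i, j)) = (\<Sum>i<n. y i * S $$ (i,k))"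
        by (intro sum.cong) (auto simp: y'_def S_def k Suc)
      then show ?thesis using ry(2)[OF k] unfolding Suc sum.lessThan_Suc_shift
        by (simp add: r'_def y'_def)
    qed
    moreover have "(\<Sum>i<Suc n. y' i * M' $$ (i,j)) = (\<Sum>k<Suc n. (\<Sum>i<Suc n. y' i * P $$ (i,k)) * M $$ (k,j))"
      if "j < Suc n" for j
    proof -
      have "(\<Sum>i<Suc n. y' i * M' $$ (i,j)) = (\<Sum>i<Suc n. \<Sum>k<Suc n. y' i * P $$ (i,k) * M $$ (k,j))"
        using that P(1) M unfolding M'_def
        by (intro sum.cong) (auto simp: scalar_prod_def sum_distrib_left mult_ac atLeast0LessThan simp del: sum.lessThan_Suc)
      also have "\<dots> = (\<Sum>k<Suc n. \<Sum>i<Suc n. y' i * P $$ (i,k) * M $$ (k,j))" by (rule sum.swap)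
      finally show ?thesis by (simp only: sum_distrib_right)
    qed
    ultimately have "\<forall>j<Suc n. c j = r' j + (\<Sum>k<Suc n. (\<Sum>i<Suc n. y' i * P $$ (i,k)) * M $$ (k,j))"
      by (auto simp del: sum.lessThan_Suc)
    with \<open>r' \<in> R'\<close> show ?thesis
      by (intro bexI[of _ r'] exI[of _ "\<lambda>k. \<Sum>i<Suc n. y' i * P $$ (i,k)"])
  qed
  with fin card show ?case by blast
qed

section \<open>Graphs on the sphere\<close>

text \<open>The chart through which planar results (Jordan curves, complements of countable sets,
  invariance of dimension) reach the sphere. The pole \<open>b\<close> is left free and chosen to
  suit each use.\<close>

lemma stereographic:
  fixes b :: "real^3"
  assumes "b \<in> S2"
  obtains h k where "homeomorphism (S2 - {b}) (UNIV :: complex set) h k"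
    "\<forall>x. x \<in> S2 \<longrightarrow> x \<noteq> b \<longrightarrow> k (h x) = x" "\<forall>z. h (k z) = z" "\<forall>z. k z \<in> S2" "\<forall>z. k z \<noteq> b"
    "continuous_on (S2 - {b}) h" "continuous_on UNIV k"
proof -
  obtain h k where hk: "homeomorphism (S2 - {b}) (UNIV :: complex set) h k"
    using homeomorphic_punctured_sphere_affine[of 1 b 0 "UNIV :: complex set"] assms
    by (auto simp: homeomorphic_def)
  note * = hk[unfolded homeomorphism_def]
  have "k z \<in> S2 - {b}" for z using * by (metis UNIV_I image_eqI)
  then show ?thesis using * by (intro that[OF hk]) blast+
qed

lemma S2_connected: "connected S2"
  by (simp add: connected_sphere_eq)

lemma S2_uminus: "a \<in> S2 \<Longrightarrow> - a \<in> S2 \<and> - a \<noteq> a"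
proof -
  assume a: "a \<in> S2"
  then have "a \<noteq> 0" by auto
  then have "- a \<noteq> a" by (metis neg_eq_iff_add_eq_0 scaleR_2 scaleR_eq_0_iff zero_neq_numeral)
  with a show ?thesis by simp
qed

lemma S2_nonempty: "S2 \<noteq> {}"
  by simp

lemma infinite_S2: "infinite S2"
proof
  assume "finite S2"
  then obtain a where "S2 = {a}"
    using connected_finite_iff_sing[OF S2_connected] S2_nonempty by auto
  then show False using S2_uminus[of a] by auto
qed

text \<open>Projection from one of the removed points turns the set into the plane minus finitely
  many points.\<close>

lemma connected_S2_minus_finite:
  assumes "finite V"
  shows "connected (S2 - V)"
proof (cases "V \<inter> S2 = {}")
  case True
  then have "S2 - V = S2" by auto
  then show ?thesis using S2_connected by simp
next
  case False
  then obtain b where b: "b \<in> V" "b \<in> S2" by auto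
  obtain h k where hk: "homeomorphism (S2 - {b}) (UNIV :: complex set) h k"
      and kh: "\<forall>x. x \<in> S2 \<longrightarrow> x \<noteq> b \<longrightarrow> k (h x) = x" and hk': "\<forall>z. h (k z) = z"
      and kim: "\<forall>z. k z \<in> S2" and kb: "\<forall>z. k z \<noteq> b"
      and conth: "continuous_on (S2 - {b}) h" and contk: "continuous_on UNIV k"
    using stereographic[OF b(2)] .
  note kh = kh[rule_format] and hk' = hk'[rule_format] and kim = kim[rule_format] and kb = kb[rule_format]
  have "connected (- (h ` (V \<inter> S2 - {b})))"
    by (intro path_connected_imp_connected path_connected_complement_countable)
      (use assms in \<open>auto intro: countable_finite\<close>)
  then have "connected (k ` (- (h ` (V \<inter> S2 - {b}))))"
    using contk by (intro connected_continuous_image) (auto intro: continuous_on_subset)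
  moreover have "k ` (- (h ` (V \<inter> S2 - {b}))) = S2 - V"
  proof (intro equalityI subsetI)
    fix x assume "x \<in> k ` (- (h ` (V \<inter> S2 - {b})))"
    then obtain z where z: "x = k z" "z \<notin> h ` (V \<inter> S2 - {b})" by auto
    then have "x \<in> S2" "x \<noteq> b" "h x = z" using kh hk' kim kb by metis+
    moreover from z(2) \<open>h x = z\<close> have "x \<notin> V \<inter> S2 - {b}" by blast
    ultimately show "x \<in> S2 - V" by blast
  next
    fix x assume x: "x \<in> S2 - V"
    with b have xb: "x \<in> S2" "x \<noteq> b" by auto
    have "h x \<notin> h ` (V \<inter> S2 - {b})"
    proof
      assume "h x \<in> h ` (V \<inter> S2 - {b})"
      then obtain y where y: "y \<in> V" "y \<in> S2" "y \<noteq> b" "h x = h y" by blast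
      then have "x = y" using xb kh by metis
      with y x show False by blast
    qed
    then show "x \<in> k ` (- (h ` (V \<inter> S2 - {b})))" using kh[OF xb] by (metis ComplI image_eqI)
  qed
  ultimately show ?thesis by simp
qed

text \<open>Otherwise a nonempty open subset of the plane would map continuously and injectively
  into the parameter interval, against invariance of dimension.\<close>

lemma arc_nowhere_dense_S2:
  fixes g :: "real \<Rightarrow> real^3"
  assumes "arc g" "openin (top_of_set S2) U" "U \<subseteq> path_image g"
  shows "U = {}"
proof (rule ccontr)
  assume "U \<noteq> {}"
  then obtain a where a: "a \<in> U" by auto
  \<comment> \<open>With the antipode as pole, the point a of \<open>U\<close> survives the
    puncture.\<close>
  define b where "b = - a"
  have "a \<in> S2" using a assms(2) openin_imp_subset by blast
  then have b: "b \<in> S2" "b \<noteq> a" using S2_uminus by (auto simp: b_def)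
  obtain h k where hk: "homeomorphism (S2 - {b}) (UNIV :: complex set) h k"
      and kh: "\<forall>x. x \<in> S2 \<longrightarrow> x \<noteq> b \<longrightarrow> k (h x) = x" and hk': "\<forall>z. h (k z) = z"
      and kim: "\<forall>z. k z \<in> S2" and kb: "\<forall>z. k z \<noteq> b"
      and conth: "continuous_on (S2 - {b}) h" and contk: "continuous_on UNIV k"
    using stereographic[OF b(1)] .
  note kh = kh[rule_format] and hk' = hk'[rule_format] and kim = kim[rule_format] and kb = kb[rule_format]
  obtain g' where g': "homeomorphism {0..1} (path_image g) g g'"
    using homeomorphism_arc[OF assms(1)] .
  define W where "W = U - {b}"
  obtain T where "open T" "U = S2 \<inter> T" using assms(2) by (auto simp: openin_open)
  then have "openin (top_of_set (S2 - {b})) W" unfolding W_def openin_open by blast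
  then have op: "open (h ` W)" using homeomorphism_imp_open_map[OF hk, of W] by simp
  have kW: "k (h x) = x" if "x \<in> W" for x
    using kh[of x] openin_imp_subset[OF assms(2)] that unfolding W_def by blast
  have Wg: "W \<subseteq> path_image g" using assms(3) by (auto simp: W_def)
  have khW: "k ` h ` W = W" using kW by force
  have "continuous_on (h ` W) (g' \<circ> k)"
  proof (rule continuous_on_compose)
    show "continuous_on (h ` W) k" using contk continuous_on_subset by blast
    show "continuous_on (k ` h ` W) g'"
      unfolding khW using g' Wg by (auto simp: homeomorphism_def intro: continuous_on_subset)
  qed
  moreover have "inj_on (g' \<circ> k) (h ` W)"
  proof (rule comp_inj_on)
    show "inj_on k (h ` W)" using kW by (auto simp: inj_on_def)
    show "inj_on g' (k ` h ` W)"
      unfolding khW using g' Wg by (intro inj_on_inverseI[of _ g]) (auto simp: homeomorphism_def)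
  qed
  moreover have "a \<in> W" using a b(2) unfolding W_def by blast
  then have "h ` W \<noteq> {}" by blast
  ultimately have "DIM(complex) \<le> DIM(real)" using op invariance_of_dimension[of "h ` W" "g' \<circ> k"] by blast
  then show False by simp
qed

text \<open>The condition \<open>graph_on_sphere\<close> in terms of vertices and edges only, for adding edges one by one.\<close>

definition arc_graph :: "(real^3) set \<Rightarrow> (real^3) set set \<Rightarrow> bool" where
  "arc_graph V E \<longleftrightarrow>
     finite V \<and> V \<subseteq> S2 \<and> finite E \<and>
     (\<forall>e\<in>E. e \<subseteq> S2 \<and> (\<exists>g. arc g \<and> path_image g = e \<and> e \<inter> V = {pathstart g, pathfinish g})) \<and>
     (\<forall>e\<in>E. \<forall>f\<in>E. e \<noteq> f \<longrightarrow> e \<inter> f \<subseteq> V)"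

lemma arc_graph_subset: "arc_graph V E \<Longrightarrow> E' \<subseteq> E \<Longrightarrow> arc_graph V E'"
  unfolding arc_graph_def by (meson finite_subset subsetD)

lemma arc_graphE:
  assumes "arc_graph V E" "e \<in> E"
  obtains g where "arc g" "path_image g = e" "e \<inter> V = {pathstart g, pathfinish g}" "pathstart g \<noteq> pathfinish g"
    "compact e" "e \<subseteq> S2"
proof -
  obtain g where g: "arc g" "path_image g = e" "e \<inter> V = {pathstart g, pathfinish g}" "e \<subseteq> S2"
  proof -
    have "\<forall>e\<in>E. e \<subseteq> S2 \<and> (\<exists>g. arc g \<and> path_image g = e \<and> e \<inter> V = {pathstart g, pathfinish g})"
      using assms(1) unfolding arc_graph_def by (elim conjE)
    from bspec[OF this assms(2)] show ?thesis using that by metis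
  qed
  have "compact e" using g(2) compact_arc_image[OF g(1)] by simp
  then show ?thesis using that g arc_distinct_ends[OF g(1)] by metis
qed

lemma arc_graph_closed:
  assumes "arc_graph V E"
  shows "closed (V \<union> \<Union>E)"
proof -
  have "closed e" if "e \<in> E" for e
    using arc_graphE[OF assms that] compact_imp_closed by metis
  moreover have "finite V" "finite E" using assms by (auto simp: arc_graph_def)
  ultimately show ?thesis by (intro closed_Un closed_Union) (auto intro: finite_imp_closed)
qed

lemma arc_graph_complement_open:
  assumes "arc_graph V E"
  shows "openin (top_of_set S2) (S2 - (V \<union> \<Union>E))"
  unfolding Diff_eq by (intro openin_open_Int open_Compl arc_graph_closed[OF assms])

text \<open>Edges are removed one at a time: what remains of \<open>U\<close> is open because graphs
  are closed, and no nonempty open set fits into a single arc. For the vertices alone, a finite open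
  set would be clopen in the connected, infinite sphere.\<close>

lemma arc_graph_dense:
  assumes "arc_graph V E" "openin (top_of_set S2) U" "U \<noteq> {}"
  shows "U - (V \<union> \<Union>E) \<noteq> {}"
proof -
  have "finite E" using assms by (simp add: arc_graph_def)
  then show ?thesis using assms
  proof (induction E)
    case empty
    have "finite V" using empty by (simp add: arc_graph_def)
    have "infinite U"
    proof
      assume "finite U"
      then have "closedin (top_of_set S2) U"
        using openin_imp_subset[OF empty(2)] by (simp add: closed_subset finite_imp_closed)
      then have "U = S2" using S2_connected empty(2,3) unfolding connected_clopen by blast
      with \<open>finite U\<close> infinite_S2 show False by simp
    qed
    then show ?case using \<open>finite V\<close> by (metis Diff_eq_empty_iff Union_empty finite_subset sup_bot_right)
  next
    case (insert e E)
    have gr: "arc_graph V E" using insert.prems(1) by (rule arc_graph_subset) auto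
    define U' where "U' = U - (V \<union> \<Union>E)"
    have "U' \<noteq> {}" unfolding U'_def using insert.IH gr insert.prems by blast
    have "U' = U \<inter> (S2 - (V \<union> \<Union>E))" using openin_imp_subset[OF insert.prems(2)] by (auto simp: U'_def)
    then have "openin (top_of_set S2) U'"
      using insert.prems(2) arc_graph_complement_open[OF gr] openin_Int by metis
    moreover obtain g where "arc g" "path_image g = e" "e \<inter> V = {pathstart g, pathfinish g}" "pathstart g \<noteq> pathfinish g" "compact e" "e \<subseteq> S2"
      by (rule arc_graphE[OF insert.prems(1) insertI1])
    ultimately have "\<not> U' \<subseteq> e" using arc_nowhere_dense_S2[of g U'] \<open>U' \<noteq> {}\<close> by blast
    then show ?case by (auto simp: U'_def)
  qed
qed

text \<open>Projected from a pole \<open>b\<close> off the loop, the loop becomes a planar Jordan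
  curve, whose bounded side lifts to \<open>I\<close>.\<close>

lemma jordan_curve_S2:
  fixes c :: "real \<Rightarrow> real^3"
  assumes "simple_path c" "pathfinish c = pathstart c" "path_image c \<subseteq> S2" "b \<in> S2" "b \<notin> path_image c"
  obtains I O' where "openin (top_of_set S2) I" "openin (top_of_set S2) O'" "I \<inter> O' = {}"
    "I \<union> O' = S2 - path_image c" "path_image c \<subseteq> closure I" "path_image c \<subseteq> closure O'"
proof -
  let ?J = "path_image c"
  obtain h k where hk: "homeomorphism (S2 - {b}) (UNIV :: complex set) h k"
      and kh: "\<forall>x. x \<in> S2 \<longrightarrow> x \<noteq> b \<longrightarrow> k (h x) = x" and hk': "\<forall>z. h (k z) = z"
      and kim: "\<forall>z. k z \<in> S2" and kb: "\<forall>z. k z \<noteq> b"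
      and conth: "continuous_on (S2 - {b}) h" and contk: "continuous_on UNIV k"
    using stereographic[OF assms(4)] .
  note kh = kh[rule_format] and hk' = hk'[rule_format] and kim = kim[rule_format] and kb = kb[rule_format]
  have J: "?J \<subseteq> S2 - {b}" using assms by auto
  have "simple_path (h \<circ> c)"
    using assms(1)
  proof (rule simple_path_continuous_image)
    show "continuous_on ?J h" using conth J continuous_on_subset by blast
    show "inj_on h ?J" using J kh by (intro inj_on_inverseI[of _ k]) blast
  qed
  moreover have "pathfinish (h \<circ> c) = pathstart (h \<circ> c)"
    using assms(2) by (simp add: pathfinish_compose pathstart_compose)
  ultimately obtain inner outer where io: "open inner" "open outer" "bounded inner" "inner \<inter> outer = {}"
      "inner \<union> outer = - path_image (h \<circ> c)" "frontier inner = path_image (h \<circ> c)"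
      "frontier outer = path_image (h \<circ> c)"
    using Jordan_curve by metis
  have im: "path_image (h \<circ> c) = h ` ?J" by (simp add: path_image_compose)
  have J': "k ` h ` ?J = ?J"
  proof -
    have "k (h x) = x" if "x \<in> ?J" for x using J kh that by blast
    then show ?thesis by (simp add: image_image)
  qed
  have clin: "closure inner = inner \<union> h ` ?J" using io im by (metis closure_Un_frontier)
  have clout: "closure outer = outer \<union> h ` ?J" using io im by (metis closure_Un_frontier)
  define I where "I = k ` inner"
  \<comment> \<open>The pole belongs to the unbounded side, so this side is defined as a complement
    and not as the image of \<open>outer\<close>. It is open because the closure of the bounded side
    is compact.\<close>
  define O' where "O' = S2 - (?J \<union> I)"
  have hk2: "homeomorphism UNIV (S2 - {b}) k h" using hk by (rule homeomorphism_symD)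
  have "openin (top_of_set (S2 - {b})) I"
    unfolding I_def using homeomorphism_imp_open_map[OF hk2, of inner] io(1) by simp
  moreover have "openin (top_of_set S2) (S2 - {b})" by (simp add: openin_delete)
  ultimately have opI: "openin (top_of_set S2) I" using openin_trans by blast
  have "compact (closure inner)" using io(3) by (simp add: compact_closure)
  then have "compact (k ` closure inner)" using contk compact_continuous_image continuous_on_subset by blast
  moreover have kcl: "k ` closure inner = ?J \<union> I" unfolding clin image_Un J' I_def by blast
  ultimately have "closed (?J \<union> I)" by (simp add: compact_imp_closed)
  then have opO: "openin (top_of_set S2) O'" unfolding O'_def Diff_eq by (intro openin_open_Int open_Compl)
  have "k ` closure inner \<subseteq> closure (k ` inner)"
    using contk by (intro continuous_image_closure_subset) auto
  then have clI: "?J \<subseteq> closure I" unfolding kcl I_def[symmetric] by auto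
  have disj: "I \<inter> ?J = {}"
  proof -
    have "inner \<inter> h ` ?J = {}" using io(5) im by auto
    then have "k z \<notin> ?J" if "z \<in> inner" for z using that hk'[of z] by (metis IntI empty_iff imageI)
    then show ?thesis unfolding I_def by blast
  qed
  have "k ` outer \<subseteq> O'"
  proof
    fix x assume "x \<in> k ` outer"
    then obtain z where z: "z \<in> outer" "x = k z" by auto
    then have zz: "h x = z" using hk' by simp
    have "z \<notin> inner" "z \<notin> h ` ?J" using z io(4,5) im by auto
    then have "x \<notin> I" "x \<notin> ?J" using zz hk' by (auto simp: I_def)
    moreover have "x \<in> S2" using z kim by simp
    ultimately show "x \<in> O'" unfolding O'_def by blast
  qed
  moreover have "k ` closure outer \<subseteq> closure (k ` outer)"
    using contk by (intro continuous_image_closure_subset) auto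
  moreover have "?J \<subseteq> k ` closure outer" unfolding clout image_Un J' by auto
  ultimately have clO: "?J \<subseteq> closure O'" by (meson closure_mono order_trans)
  show ?thesis
  proof (rule that[OF opI opO _ _ clI clO])
    show "I \<inter> O' = {}" by (auto simp: O'_def)
    show "I \<union> O' = S2 - ?J" using disj openin_imp_subset[OF opI] by (auto simp: O'_def)
  qed
qed

text \<open>If the ends of the edge \<open>e\<close> are already joined by a path in the rest of the graph, that path
  and \<open>e\<close> contain a Jordan curve through \<open>e\<close>.\<close>

lemma edge_separates:
  assumes "arc_graph V (insert e E)" "e \<notin> E" "e \<inter> V = {u, v}" "path_component (V \<union> \<Union>E) u v"
  obtains I O' where "openin (top_of_set S2) I" "openin (top_of_set S2) O'" "I \<inter> O' = {}"
    "S2 - (V \<union> \<Union>(insert e E)) \<subseteq> I \<union> O'" "e \<subseteq> closure I" "e \<subseteq> closure O'"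
proof -
  let ?X = "V \<union> \<Union>E"
  have gr: "arc_graph V E" using assms(1) by (rule arc_graph_subset) auto
  obtain g where g: "arc g" "path_image g = e" "e \<inter> V = {pathstart g, pathfinish g}" "pathstart g \<noteq> pathfinish g" "compact e" "e \<subseteq> S2"
    by (rule arc_graphE[OF assms(1) insertI1])
  have "e \<inter> f \<subseteq> V" if "f \<in> E" for f using assms(1,2) that by (auto simp: arc_graph_def)
  then have eX: "e \<inter> ?X = {pathstart g, pathfinish g}" using g(3) by blast
  have "{u, v} = {pathstart g, pathfinish g}" using assms(3) g(3) by simp
  then have "path_component ?X (pathfinish g) (pathstart g)"
    using assms(4) path_component_sym by (metis doubleton_eq_iff)
  then obtain p where p: "path p" "path_image p \<subseteq> ?X" "pathstart p = pathfinish g" "pathfinish p = pathstart g"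
    unfolding path_component_def by auto
  \<comment> \<open>The joining path may cross itself; passing to an arc inside it makes the loop
    simple.\<close>
  obtain q where q: "arc q" "path_image q \<subseteq> path_image p" "pathstart q = pathfinish g" "pathfinish q = pathstart g"
    using path_contains_arc[OF p(1,3,4) g(4)[symmetric]] .
  define c where "c = g +++ q"
  have eq: "path_image g \<inter> path_image q \<subseteq> {pathstart g, pathstart q}"
  proof
    fix x assume x: "x \<in> path_image g \<inter> path_image q"
    then have "x \<in> ?X" using q(2) p(2) by (metis IntD2 subsetD)
    with x g(2) have "x \<in> e \<inter> ?X" by simp
    then show "x \<in> {pathstart g, pathstart q}" unfolding eX q(3) .
  qed
  have sp: "simple_path c" unfolding c_def
    using g(1) q(1) q(3)[symmetric] q(4) eq by (rule simple_path_join_loop)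
  have loop: "pathfinish c = pathstart c" using q by (simp add: c_def)
  have imc: "path_image c = e \<union> path_image q" using g q by (simp add: c_def path_image_join)
  have XS: "?X \<subseteq> S2" using gr by (auto simp: arc_graph_def)
  have cS: "path_image c \<subseteq> S2" unfolding imc using XS g(6) q(2) p(2) by blast
  have "openin (top_of_set S2) S2" by (rule openin_subtopology_self)
  then have "S2 - (V \<union> \<Union>(insert e E)) \<noteq> {}"
    using arc_graph_dense[OF assms(1) _ S2_nonempty] by simp
  then obtain b where b: "b \<in> S2" "b \<notin> V \<union> \<Union>(insert e E)" by blast
  have "b \<notin> path_image c" unfolding imc using b(2) q(2) p(2) by blast
  then obtain I O' where IO: "openin (top_of_set S2) I" "openin (top_of_set S2) O'" "I \<inter> O' = {}"
    "I \<union> O' = S2 - path_image c" "path_image c \<subseteq> closure I" "path_image c \<subseteq> closure O'"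
    by (rule jordan_curve_S2[OF sp loop cS b(1)])
  show ?thesis
  proof (rule that[OF IO(1-3)])
    show "S2 - (V \<union> \<Union>(insert e E)) \<subseteq> I \<union> O'" unfolding IO(4) imc using q(2) p(2) by blast
  qed (use IO(5,6) imc in auto)
qed

section \<open>Euler's inequality for graphs of arcs\<close>

lemma card_image_less_if_not_inj:
  assumes "finite A" "x \<in> A" "y \<in> A" "x \<noteq> y" "f x = f y"
  shows "card (f ` A) < card A"
  using assms card_image_le[OF assms(1), of f] eq_card_imp_inj_on[OF assms(1), of f]
  by (metis inj_on_def le_neq_implies_less)

lemma locally_connected_S2_open:
  assumes "openin (top_of_set S2) K"
  shows "locally connected K"
  using locally_open_subset[OF locally_connected_sphere[of 0 1] assms] .

lemma openin_S2_component:
  assumes "openin (top_of_set S2) K"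
  shows "openin (top_of_set S2) (connected_component_set K x)"
  using openin_connected_component_locally_connected[OF locally_connected_S2_open[OF assms]] assms openin_trans
  by blast

text \<open>\<open>F\<close> sends a component of \<open>K'\<close> to the component of
  \<open>K\<close> that contains it. It is onto because components of \<open>K\<close> are open and
  therefore meet \<open>K'\<close>. With it the faces before and after the insertion of an edge are
  compared.\<close>

lemma components_refine:
  fixes K K' :: "(real^3) set"
  assumes "K' \<subseteq> K" "openin (top_of_set S2) K" "\<And>U. openin (top_of_set S2) U \<Longrightarrow> U \<noteq> {} \<Longrightarrow> U \<inter> K' \<noteq> {}"
  obtains F where "components K = F ` components K'"
    "\<forall>z\<in>K'. F (connected_component_set K' z) = connected_component_set K z"
proof -
  \<comment> \<open>The union over all points of C avoids the choice of a representative.\<close>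
  define F where "F = (\<lambda>C. {w. \<exists>z\<in>C. connected_component K z w})"
  have F: "F (connected_component_set K' z) = connected_component_set K z" if "z \<in> K'" for z
  proof (intro equalityI subsetI)
    fix w assume "w \<in> F (connected_component_set K' z)"
    then obtain y where "connected_component K' z y" "connected_component K y w" by (auto simp: F_def)
    then show "w \<in> connected_component_set K z"
      using connected_component_of_subset[OF _ assms(1)] connected_component_trans by (metis mem_Collect_eq)
  next
    fix w assume "w \<in> connected_component_set K z"
    then show "w \<in> F (connected_component_set K' z)" using that by (auto simp: F_def intro!: bexI[of _ z] connected_component_refl)
  qed
  have "components K = F ` components K'"
  proof (intro equalityI subsetI)
    fix C assume "C \<in> components K"
    then obtain x where x: "x \<in> K" "C = connected_component_set K x" by (auto simp: components_def)
    have "C \<inter> K' \<noteq> {}"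
    proof (rule assms(3))
      show "openin (top_of_set S2) C" using openin_S2_component[OF assms(2)] x by simp
      show "C \<noteq> {}" using x connected_component_eq_empty by metis
    qed
    then obtain z where z: "z \<in> C" "z \<in> K'" by auto
    then have "C = connected_component_set K z" using x connected_component_eq by blast
    then show "C \<in> F ` components K'" using F[OF z(2)] z(2) by (auto simp: components_def)
  next
    fix C assume "C \<in> F ` components K'"
    then show "C \<in> components K" using F assms(1) by (force simp: components_def)
  qed
  then show ?thesis using that F by blast
qed

text \<open>The induction over the edges needs a stronger inequality that also counts the path
  components \<open>Pc\<close> of the graph: a new edge either merges two of them, or closes a
  cycle, and then the Jordan curve through it splits a face.\<close>

lemma arc_graph_euler:
  assumes "arc_graph V E" "V \<noteq> {}" "finite (components (S2 - (V \<union> \<Union>E)))"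
  shows "card E + 2 \<le> card V + card (components (S2 - (V \<union> \<Union>E)))"
proof -
  define Pc where "Pc = (\<lambda>E. path_component_set (V \<union> \<Union>E) ` V)"
  have finV: "finite V" using assms(1) by (simp add: arc_graph_def)
  have "finite E" using assms(1) by (simp add: arc_graph_def)
  then have "card E + 1 + card (Pc E) \<le> card V + card (components (S2 - (V \<union> \<Union>E)))"
    using assms
  proof (induction E)
    case empty
    have "card (Pc {}) \<le> card V" unfolding Pc_def using finV by (rule card_image_le)
    moreover have "S2 - V \<noteq> {}" by (metis Diff_eq_empty_iff finite_subset infinite_S2 finV)
    then have "components (S2 - V) \<noteq> {}" by (simp add: components_eq_empty)
    then have "card (components (S2 - V)) \<noteq> 0" using empty.prems(3) by simp
    ultimately show ?case by simp
  next
    case (insert e E)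
    have gr: "arc_graph V E" using insert.prems(1) by (rule arc_graph_subset) auto
    let ?K = "S2 - (V \<union> \<Union>E)" and ?K' = "S2 - (V \<union> \<Union>(insert e E))"
    have opK: "openin (top_of_set S2) ?K" using arc_graph_complement_open[OF gr] .
    have dense: "U \<inter> ?K' \<noteq> {}" if "openin (top_of_set S2) U" "U \<noteq> {}" for U
      using arc_graph_dense[OF insert.prems(1) that] openin_imp_subset[OF that(1)] by blast
    have sub: "?K' \<subseteq> ?K" by auto
    obtain F where F: "components ?K = F ` components ?K'"
      "\<forall>z\<in>?K'. F (connected_component_set ?K' z) = connected_component_set ?K z"
      using components_refine[OF sub opK dense] .
    have finK: "finite (components ?K)" unfolding F(1) using insert.prems(3) by blast
    have IH: "card E + 1 + card (Pc E) \<le> card V + card (components ?K)"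
      using insert.IH gr insert.prems(2) finK by blast
    have leK: "card (components ?K) \<le> card (components ?K')"
      unfolding F(1) using insert.prems(3) by (rule card_image_le)
    have cardE: "card (insert e E) = card E + 1" using insert.hyps by simp
    obtain g where g: "arc g" "path_image g = e" "e \<inter> V = {pathstart g, pathfinish g}" "pathstart g \<noteq> pathfinish g" "compact e" "e \<subseteq> S2"
      by (rule arc_graphE[OF insert.prems(1) insertI1])
    let ?u = "pathstart g" and ?v = "pathfinish g"
    have uv: "?u \<in> V" "?v \<in> V" using g by auto
    let ?X = "V \<union> \<Union>E" and ?X' = "V \<union> \<Union>(insert e E)"
    define G where "G = (\<lambda>C. {w. \<exists>z\<in>C. path_component ?X' z w})"
    have G: "G (path_component_set ?X z) = path_component_set ?X' z" if "z \<in> V" for z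
    proof (intro equalityI subsetI)
      fix w assume "w \<in> G (path_component_set ?X z)"
      then obtain y where "path_component ?X z y" "path_component ?X' y w" by (auto simp: G_def)
      moreover have "?X \<subseteq> ?X'" by auto
      ultimately show "w \<in> path_component_set ?X' z"
        using path_component_of_subset path_component_trans by (metis mem_Collect_eq)
    next
      fix w assume "w \<in> path_component_set ?X' z"
      then show "w \<in> G (path_component_set ?X z)" using path_component_refl[of z ?X] that by (auto simp: G_def)
    qed
    have PcG: "Pc (insert e E) = G ` Pc E" unfolding Pc_def image_image using G by (intro image_cong) auto
    have finPc: "finite (Pc E)" using finV by (simp add: Pc_def)
    show ?case
    proof (cases "path_component ?X ?u ?v")
      case False
      have "path_component ?X' ?u ?v"
        unfolding path_component_def using g arc_imp_path by (intro exI[of _ g]) auto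
      then have "path_component_set ?X' ?u = path_component_set ?X' ?v"
        using path_component_eq[of ?v ?X' ?u] by auto
      then have eq: "G (path_component_set ?X ?u) = G (path_component_set ?X ?v)" using G uv by simp
      have "?v \<in> path_component_set ?X ?v" using uv path_component_refl[of ?v ?X] by simp
      with False have neq: "path_component_set ?X ?u \<noteq> path_component_set ?X ?v" by auto
      have "card (Pc (insert e E)) < card (Pc E)"
        unfolding PcG using finPc _ _ neq eq
        by (rule card_image_less_if_not_inj) (use uv in \<open>auto simp: Pc_def\<close>)
      then show ?thesis using IH leK cardE by linarith
    next
      case True
      obtain I O' where IO: "openin (top_of_set S2) I" "openin (top_of_set S2) O'" "I \<inter> O' = {}"
          "?K' \<subseteq> I \<union> O'" "e \<subseteq> closure I" "e \<subseteq> closure O'"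
        using edge_separates[OF insert.prems(1) insert.hyps(2) g(3) True] .
      have "connected e" using g(1,2) arc_imp_path connected_path_image by blast
      then have "infinite e" using connected_finite_iff_sing[of e] g(2,4) pathstart_in_path_image pathfinish_in_path_image
        by (metis empty_iff singletonD)
      then have "\<not> e \<subseteq> {?u, ?v}" using finite_subset by blast
      then obtain p where p: "p \<in> e" "p \<noteq> ?u" "p \<noteq> ?v" by auto
      have "e \<inter> f \<subseteq> V" if "f \<in> E" for f using insert.prems(1) insert.hyps(2) that by (auto simp: arc_graph_def)
      then have pK: "p \<in> ?K" using p g(3,6) by blast
      define C where "C = connected_component_set ?K p"
      have opC: "openin (top_of_set S2) C" unfolding C_def by (rule openin_S2_component[OF opK])
      have pC: "p \<in> C" using pK by (simp add: C_def)
      obtain W where W: "open W" "C = S2 \<inter> W" using opC by (auto simp: openin_open)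
      \<comment> \<open>The old face \<open>C\<close> is an open neighbourhood of the point p of the
        new edge, so each side of the Jordan curve, having p in its closure, meets \<open>C\<close>
        off the graph.\<close>
      have meet: "\<exists>z\<in>C \<inter> A. z \<in> ?K'" if "openin (top_of_set S2) A" "e \<subseteq> closure A" for A
      proof -
        have "W \<inter> A \<noteq> {}" using open_Int_closure_eq_empty[OF W(1), of A] that(2) p(1) pC W(2) by blast
        then have "C \<inter> A \<noteq> {}" using W openin_imp_subset[OF that(1)] by auto
        then have "C \<inter> A \<inter> ?K' \<noteq> {}" using dense opC that(1) openin_Int by blast
        then show ?thesis by auto
      qed
      obtain z1 where z1: "z1 \<in> C" "z1 \<in> I" "z1 \<in> ?K'" using meet[OF IO(1,5)] by auto
      obtain z2 where z2: "z2 \<in> C" "z2 \<in> O'" "z2 \<in> ?K'" using meet[OF IO(2,6)] by auto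
      let ?D1 = "connected_component_set ?K' z1" and ?D2 = "connected_component_set ?K' z2"
      have "\<not> connected_component ?K' z1 z2"
      proof
        assume "connected_component ?K' z1 z2"
        then obtain D where D: "connected D" "D \<subseteq> ?K'" "z1 \<in> D" "z2 \<in> D" by (auto simp: connected_component_def)
        then have "D \<subseteq> I \<union> O'" "I \<inter> O' \<inter> D = {}" "I \<inter> D \<noteq> {}" "O' \<inter> D \<noteq> {}"
          using IO z1 z2 by auto
        moreover obtain I1 O1 where "open I1" "I = S2 \<inter> I1" "open O1" "O' = S2 \<inter> O1"
          using IO(1,2) by (auto simp: openin_open)
        moreover have "D \<subseteq> S2" using D by auto
        ultimately show False
          using D(1) connectedD[of D I1 O1] by blast
      qed
      moreover have "z2 \<in> ?D2" using z2 by simp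
      ultimately have neq: "?D1 \<noteq> ?D2" by auto
      have "F ?D1 = C" "F ?D2 = C"
        using F(2)[rule_format, OF z1(3)] F(2)[rule_format, OF z2(3)] connected_component_eq[of z1 ?K p] connected_component_eq[of z2 ?K p] z1(1) z2(1)
        unfolding C_def by auto
      then have "card (components ?K) < card (components ?K')"
        unfolding F(1) using insert.prems(3) _ _ neq
        by (intro card_image_less_if_not_inj[of _ ?D1 ?D2]) (use z1 z2 in \<open>auto simp: components_def\<close>)
      moreover have "card (Pc (insert e E)) \<le> card (Pc E)" unfolding PcG using finPc by (rule card_image_le)
      ultimately show ?thesis using IH cardE by linarith
    qed
  qed
  moreover have "card (Pc E) \<noteq> 0" unfolding Pc_def using finV assms(2) by simp
  ultimately show ?thesis by linarith
qed

section \<open>The triples of a face 2-coloured triangulation\<close>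

text \<open>What the combinatorial part needs to know about faces, each reduced to its vertex set.
  In a simple graph an edge is the pair of its ends, hence the uniqueness assumptions.
  \<open>connected\<close> is connectedness of the dual graph, phrased as an induction principle:
  what passes across common pairs holds everywhere. \<open>card_V\<close> is Euler's inequality with
  3 t edges and 2 t faces, and \<open>card_W\<close> excludes the single triangle, whose two faces
  have the same vertices.\<close>

locale bicoloured_triples =
  fixes V :: "'v set" and W B :: "'v set set"
  assumes finite_V: "finite V"
    and triples: "\<And>Z. Z \<in> W \<union> B \<Longrightarrow> Z \<subseteq> V \<and> card Z = 3"
    and W_unique: "\<And>Z Y a b. Z \<in> W \<Longrightarrow> Y \<in> W \<Longrightarrow> a \<noteq> b \<Longrightarrow> {a, b} \<subseteq> Z \<Longrightarrow> {a, b} \<subseteq> Y \<Longrightarrow> Z = Y"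
    and B_unique: "\<And>Z Y a b. Z \<in> B \<Longrightarrow> Y \<in> B \<Longrightarrow> a \<noteq> b \<Longrightarrow> {a, b} \<subseteq> Z \<Longrightarrow> {a, b} \<subseteq> Y \<Longrightarrow> Z = Y"
    and W_imp_B: "\<And>Z a b. Z \<in> W \<Longrightarrow> a \<noteq> b \<Longrightarrow> {a, b} \<subseteq> Z \<Longrightarrow> \<exists>Y\<in>B. {a, b} \<subseteq> Y"
    and B_imp_W: "\<And>Z a b. Z \<in> B \<Longrightarrow> a \<noteq> b \<Longrightarrow> {a, b} \<subseteq> Z \<Longrightarrow> \<exists>Y\<in>W. {a, b} \<subseteq> Y"
    and connected: "\<And>S. S \<subseteq> W \<union> B \<Longrightarrow> S \<noteq> {} \<Longrightarrow>
      (\<And>Z Y a b. Z \<in> S \<Longrightarrow> Y \<in> W \<union> B \<Longrightarrow> a \<noteq> b \<Longrightarrow> {a, b} \<subseteq> Z \<Longrightarrow> {a, b} \<subseteq> Y \<Longrightarrow> Y \<in> S) \<Longrightarrow> S = W \<union> B"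
    and cover: "V = \<Union>(W \<union> B)"
    and card_V: "card W + 2 \<le> card V"
    and card_W: "2 \<le> card W"


lemma sum_const_card_eq:
  fixes c :: "'a::comm_monoid_add"
  assumes "finite A" "finite C" "card A = card C"
  shows "(\<Sum>_\<in>A. c) = (\<Sum>_\<in>C. c)"
proof -
  obtain h where "bij_betw h A C" using finite_same_card_bij[OF assms] by blast
  from sum.reindex_bij_betw[OF this, of "\<lambda>_. c"] show ?thesis .
qed

text \<open>Two different triples at \<open>v\<close> have no other vertex in common, so each
  neighbour of \<open>v\<close> is met exactly once.\<close>

lemma sum_star:
  fixes f :: "'v \<Rightarrow> 'a::comm_monoid_add"
  assumes "finite F" "\<And>A. A \<in> F \<Longrightarrow> finite A"
    and "\<And>A C u. A \<in> F \<Longrightarrow> C \<in> F \<Longrightarrow> u \<noteq> v \<Longrightarrow> {u, v} \<subseteq> A \<Longrightarrow> {u, v} \<subseteq> C \<Longrightarrow> A = C"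
  shows "(\<Sum>A\<in>{A \<in> F. v \<in> A}. \<Sum>u\<in>A. f u) =
    (\<Sum>A\<in>{A \<in> F. v \<in> A}. f v) + (\<Sum>u\<in>{u. u \<noteq> v \<and> (\<exists>A\<in>F. {u, v} \<subseteq> A)}. f u)"
proof -
  have "(\<Sum>A\<in>{A \<in> F. v \<in> A}. \<Sum>u\<in>A. f u) = (\<Sum>A\<in>{A \<in> F. v \<in> A}. f v + (\<Sum>u\<in>A - {v}. f u))"
    using assms(2) by (intro sum.cong) (auto simp: sum.remove)
  also have "\<dots> = (\<Sum>A\<in>{A \<in> F. v \<in> A}. f v) + (\<Sum>A\<in>{A \<in> F. v \<in> A}. \<Sum>u\<in>A - {v}. f u)"
    by (rule sum.distrib)
  also have "(\<Sum>A\<in>{A \<in> F. v \<in> A}. \<Sum>u\<in>A - {v}. f u) = (\<Sum>u\<in>(\<Union>A\<in>{A \<in> F. v \<in> A}. A - {v}). f u)"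
    using assms by (intro sum.UNION_disjoint[symmetric]) auto
  also have "(\<Union>A\<in>{A \<in> F. v \<in> A}. A - {v}) = {u. u \<noteq> v \<and> (\<exists>A\<in>F. {u, v} \<subseteq> A)}" by auto
  finally show ?thesis .
qed

lemma card3_third:
  assumes "card A = 3" "x \<in> A" "y \<in> A" "x \<noteq> y"
  obtains z where "A = {x, y, z}" "z \<noteq> x" "z \<noteq> y"
proof -
  have "card (A - {x, y}) = 1" using assms by (subst card_Diff_subset) auto
  then obtain z where "A - {x, y} = {z}" by (auto simp: card_1_singleton_iff)
  then show ?thesis using that[of z] assms by blast
qed

context bicoloured_triples
begin

lemma finite_triples: "finite W" "finite B"
proof -
  have "W \<union> B \<subseteq> Pow V" using triples by blast
  then have "finite (W \<union> B)" using finite_V by (meson finite_Pow_iff finite_subset)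
  then show "finite W" "finite B" by auto
qed

lemma finite_triple: "Z \<in> W \<union> B \<Longrightarrow> finite Z"
  using triples finite_V finite_subset by metis

text \<open>A triple of both colours would be the whole system, as its pairs lie in no other
  triple.\<close>

lemma disjoint_colours: "W \<inter> B = {}"
proof (rule ccontr)
  assume "W \<inter> B \<noteq> {}"
  then obtain Z where Z: "Z \<in> W" "Z \<in> B" by blast
  have "{Z} = W \<union> B"
  proof (rule connected)
    fix A Y a b assume "A \<in> {Z}" "Y \<in> W \<union> B" "a \<noteq> b" "{a, b} \<subseteq> A" "{a, b} \<subseteq> Y"
    then show "Y \<in> {Z}" using Z W_unique[of Y Z a b] B_unique[of Y Z a b] by blast
  qed (use Z in auto)
  then have "W \<subseteq> {Z}" by blast
  then have "card W \<le> card {Z}" by (intro card_mono) auto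
  with card_W show False by simp
qed

lemma nbrs_eq: "{u. u \<noteq> v \<and> (\<exists>A\<in>W. {u, v} \<subseteq> A)} = {u. u \<noteq> v \<and> (\<exists>A\<in>B. {u, v} \<subseteq> A)}"
  using W_imp_B B_imp_W by metis

lemma card_star_W: "2 * card {Z \<in> W. v \<in> Z} = card {u. u \<noteq> v \<and> (\<exists>A\<in>W. {u, v} \<subseteq> A)}"
  and card_star_B: "2 * card {Z \<in> B. v \<in> Z} = card {u. u \<noteq> v \<and> (\<exists>A\<in>W. {u, v} \<subseteq> A)}"
proof -
  have *: "2 * card {Z \<in> F. v \<in> Z} = card {u. u \<noteq> v \<and> (\<exists>A\<in>F. {u, v} \<subseteq> A)}"
    if F: "F \<subseteq> W \<union> B" "finite F"
      "\<And>A C u. A \<in> F \<Longrightarrow> C \<in> F \<Longrightarrow> u \<noteq> v \<Longrightarrow> {u, v} \<subseteq> A \<Longrightarrow> {u, v} \<subseteq> C \<Longrightarrow> A = C" for F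
  proof -
    have "(\<Sum>A\<in>{A \<in> F. v \<in> A}. \<Sum>u\<in>A. 1::nat) =
      (\<Sum>A\<in>{A \<in> F. v \<in> A}. 1) + (\<Sum>u\<in>{u. u \<noteq> v \<and> (\<exists>A\<in>F. {u, v} \<subseteq> A)}. 1)"
    proof (rule sum_star)
      show "finite A" if "A \<in> F" for A using finite_triple that F(1) by blast
    qed (use F in blast)+
    moreover have "(\<Sum>A\<in>{A \<in> F. v \<in> A}. \<Sum>u\<in>A. 1::nat) = (\<Sum>A\<in>{A \<in> F. v \<in> A}. 3)"
      using F(1) triples by (intro sum.cong) auto
    ultimately show ?thesis by simp
  qed
  show "2 * card {Z \<in> W. v \<in> Z} = card {u. u \<noteq> v \<and> (\<exists>A\<in>W. {u, v} \<subseteq> A)}"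
    using finite_triples W_unique by (intro *) blast+
  have "2 * card {Z \<in> B. v \<in> Z} = card {u. u \<noteq> v \<and> (\<exists>A\<in>B. {u, v} \<subseteq> A)}"
    using finite_triples B_unique by (intro *) blast+
  then show "2 * card {Z \<in> B. v \<in> Z} = card {u. u \<noteq> v \<and> (\<exists>A\<in>W. {u, v} \<subseteq> A)}"
    by (simp only: nbrs_eq)
qed

definition wdeg :: "'v \<Rightarrow> nat" where
  "wdeg v = card {Z \<in> W. v \<in> Z}"

lemma wdeg_B: "wdeg v = card {Z \<in> B. v \<in> Z}"
  using card_star_W[of v] card_star_B[of v] by (simp add: wdeg_def)

text \<open>The colours alternate around \<open>v\<close>: there are equally many triples of each,
  and they reach the same neighbours. The identity is used for real vectors and in the free abelian
  group, hence the general codomain.\<close>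

lemma sum_star_W_eq_B:
  fixes f :: "'v \<Rightarrow> 'a::comm_monoid_add"
  shows "(\<Sum>Z\<in>{Z \<in> W. v \<in> Z}. \<Sum>u\<in>Z. f u) = (\<Sum>Z\<in>{Z \<in> B. v \<in> Z}. \<Sum>u\<in>Z. f u)"
proof -
  have "(\<Sum>Z\<in>{Z \<in> W. v \<in> Z}. \<Sum>u\<in>Z. f u) =
     (\<Sum>Z\<in>{Z \<in> W. v \<in> Z}. f v) + (\<Sum>u\<in>{u. u \<noteq> v \<and> (\<exists>A\<in>W. {u, v} \<subseteq> A)}. f u)"
    by (rule sum_star) (use finite_triples finite_triple W_unique in blast)+
  also have "(\<Sum>Z\<in>{Z \<in> W. v \<in> Z}. f v) = (\<Sum>Z\<in>{Z \<in> B. v \<in> Z}. f v)"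
    using finite_triples wdeg_B[of v] by (intro sum_const_card_eq) (auto simp: wdeg_def)
  also have "\<dots> + (\<Sum>u\<in>{u. u \<noteq> v \<and> (\<exists>A\<in>W. {u, v} \<subseteq> A)}. f u) = (\<Sum>Z\<in>{Z \<in> B. v \<in> Z}. \<Sum>u\<in>Z. f u)"
    unfolding nbrs_eq
    by (rule sum_star[symmetric]) (use finite_triples finite_triple B_unique in blast)+
  finally show ?thesis .
qed

lemma wdeg_pos:
  assumes "v \<in> V"
  shows "0 < wdeg v"
proof -
  obtain Z where "Z \<in> W \<union> B" "v \<in> Z" using assms cover by blast
  then have "{Z \<in> W. v \<in> Z} \<noteq> {} \<or> {Z \<in> B. v \<in> Z} \<noteq> {}" by blast
  then have "card {Z \<in> W. v \<in> Z} \<noteq> 0 \<or> card {Z \<in> B. v \<in> Z} \<noteq> 0" using finite_triples by auto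
  then show ?thesis using wdeg_B[of v] by (auto simp: wdeg_def)
qed

text \<open>A real vector with vanishing white triple sums also has vanishing black ones: by
  \<open>sum_star_W_eq_B\<close> the vector of black sums is orthogonal to itself.\<close>

lemma black_sums_zero:
  fixes p :: "'v \<Rightarrow> real"
  assumes "\<And>Z. Z \<in> W \<Longrightarrow> (\<Sum>v\<in>Z. p v) = 0" "Z \<in> B"
  shows "(\<Sum>v\<in>Z. p v) = 0"
proof -
  define s where "s Z = (\<Sum>v\<in>Z. p v)" for Z
  have "(\<Sum>Z\<in>B. s Z * s Z) = (\<Sum>Z\<in>B. \<Sum>v\<in>V. if v \<in> Z then p v * s Z else 0)"
  proof (intro sum.cong refl)
    fix Z assume "Z \<in> B"
    then have "Z \<subseteq> V" using triples by blast
    have "(\<Sum>v\<in>V. if v \<in> Z then p v * s Z else 0) = (\<Sum>v\<in>V \<inter> Z. p v * s Z)"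
      using finite_V by (simp add: sum.inter_restrict)
    also have "V \<inter> Z = Z" using \<open>Z \<subseteq> V\<close> by blast
    finally show "s Z * s Z = (\<Sum>v\<in>V. if v \<in> Z then p v * s Z else 0)"
      by (simp add: s_def sum_distrib_right)
  qed
  also have "\<dots> = (\<Sum>v\<in>V. \<Sum>Z\<in>B. if v \<in> Z then p v * s Z else 0)" by (rule sum.swap)
  also have "\<dots> = (\<Sum>v\<in>V. p v * (\<Sum>Z\<in>{Z \<in> B. v \<in> Z}. s Z))"
    using finite_triples by (intro sum.cong refl) (simp add: sum.inter_filter sum_distrib_left if_distrib[of "\<lambda>x. _ * x"] cong: if_cong)
  also have "\<dots> = 0"
  proof (intro sum.neutral ballI)
    fix v assume "v \<in> V"
    have "(\<Sum>Z\<in>{Z \<in> B. v \<in> Z}. s Z) = (\<Sum>Z\<in>{Z \<in> W. v \<in> Z}. s Z)"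
      unfolding s_def by (rule sum_star_W_eq_B[symmetric])
    also have "\<dots> = 0" using assms(1) by (simp add: s_def)
    finally show "p v * (\<Sum>Z\<in>{Z \<in> B. v \<in> Z}. s Z) = 0" by simp
  qed
  finally have "\<forall>Z\<in>B. s Z * s Z = 0"
    using finite_triples by (subst (asm) sum_nonneg_eq_0_iff) auto
  then show ?thesis using assms(2) by (simp add: s_def)
qed

text \<open>The vertices outnumber the white triples by two, so some nonzero vector has vanishing white
  sums and vanishes at one vertex. Its three values on a triple are the colours.\<close>

lemma three_colouring:
  "\<exists>col :: 'v \<Rightarrow> nat. \<forall>Z\<in>W \<union> B. col ` Z = {0, 1, 2}"
proof -
  have "W \<noteq> {}" using card_W by auto
  then obtain Z0 where Z0: "Z0 \<in> W" by blast
  then have "card Z0 = 3" using triples by blast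
  then obtain a b c where abc: "Z0 = {a, b, c}" "a \<noteq> b" "b \<noteq> c" "a \<noteq> c"
    by (auto simp: card_3_iff)
  define I where "I = insert None (Some ` W)"
  define f where "f = (\<lambda>i v. case i of None \<Rightarrow> if v = a then 1 else 0 | Some Z \<Rightarrow> if v \<in> Z then 1 else (0::real))"
  have "card I = card W + 1"
    unfolding I_def using finite_triples by (simp add: card_insert_if card_image)
  then have "card I < card V" using card_V by simp
  moreover have "finite I" using finite_triples by (simp add: I_def)
  ultimately obtain p where p: "\<exists>v\<in>V. p v \<noteq> 0" "\<And>i. i \<in> I \<Longrightarrow> (\<Sum>v\<in>V. f i v * p v) = 0"
    using homogeneous_system_nontrivial[OF _ finite_V, of I f] by blast
  have aV: "a \<in> V" using Z0 abc(1) triples by blast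
  have pa: "p a = 0"
    using p(2)[of None] aV finite_V by (simp add: I_def f_def if_distrib[of "\<lambda>x. x * _"] cong: if_cong)
  have pW: "(\<Sum>v\<in>Z. p v) = 0" if "Z \<in> W" for Z
  proof -
    have "Z \<subseteq> V" using triples that by blast
    have "0 = (\<Sum>v\<in>V. if v \<in> Z then p v else 0)"
      using p(2)[of "Some Z"] that by (simp add: I_def f_def if_distrib[of "\<lambda>x. x * _"] cong: if_cong)
    also have "\<dots> = (\<Sum>v\<in>V \<inter> Z. p v)" using finite_V by (simp add: sum.inter_restrict)
    also have "V \<inter> Z = Z" using \<open>Z \<subseteq> V\<close> by blast
    finally show ?thesis by simp
  qed
  have pZ: "(\<Sum>v\<in>Z. p v) = 0" if "Z \<in> W \<union> B" for Z using pW black_sums_zero[of p] that by blast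
  define \<beta> where "\<beta> = p b"
  have "p c = - \<beta>" using pW[OF Z0] abc pa by (simp add: \<beta>_def)
  then have im0: "p ` Z0 = {0, \<beta>, - \<beta>}" using abc(1) pa by (simp add: \<beta>_def)
  \<comment> \<open>The third value on a triple is minus the sum of the other two, so the set of
    values passes to every triple with a common pair.\<close>
  have "{Z \<in> W \<union> B. p ` Z = {0, \<beta>, - \<beta>}} = W \<union> B"
  proof (rule connected)
    show "{Z \<in> W \<union> B. p ` Z = {0, \<beta>, - \<beta>}} \<noteq> {}" using Z0 im0 by blast
  next
    fix Z Y x y
    assume Z: "Z \<in> {Z \<in> W \<union> B. p ` Z = {0, \<beta>, - \<beta>}}" and Y: "Y \<in> W \<union> B" and xy: "x \<noteq> y" "{x, y} \<subseteq> Z" "{x, y} \<subseteq> Y"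
    have "card Z = 3" "card Y = 3" using Z Y triples by blast+
    then obtain z w where zw: "Z = {x, y, z}" "z \<noteq> x" "z \<noteq> y" "Y = {x, y, w}" "w \<noteq> x" "w \<noteq> y"
      using card3_third[of Z x y] card3_third[of Y x y] xy by (metis insert_subset)
    have "p x + p y + p z = 0" "p x + p y + p w = 0" using pZ[of Z] pZ[of Y] Z Y zw xy by (auto simp: add.assoc)
    then have "p z = p w" by simp
    then have "p ` Y = p ` Z" by (simp add: zw)
    then show "Y \<in> {Z \<in> W \<union> B. p ` Z = {0, \<beta>, - \<beta>}}" using Z Y by simp
  qed blast
  then have im: "p ` Z = {0, \<beta>, - \<beta>}" if "Z \<in> W \<union> B" for Z using that by blast
  have "\<beta> \<noteq> 0"
  proof
    assume "\<beta> = 0"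
    obtain v where v: "v \<in> V" "p v \<noteq> 0" using p(1) by blast
    then obtain Z where "Z \<in> W \<union> B" "v \<in> Z" using cover by blast
    then have "p v \<in> {0, \<beta>, - \<beta>}" using im by blast
    with v \<open>\<beta> = 0\<close> show False by simp
  qed
  define col where "col = (\<lambda>v. if p v = 0 then 0 else if p v = \<beta> then 1 else 2 :: nat)"
  have "col ` Z = {0, 1, 2}" if "Z \<in> W \<union> B" for Z
  proof -
    have "col ` Z = (\<lambda>x. if x = 0 then 0 else if x = \<beta> then 1 else 2) ` (p ` Z)" by (auto simp: col_def image_image)
    also have "\<dots> = {0, 1, 2}" unfolding im[OF that] using \<open>\<beta> \<noteq> 0\<close> by auto
    finally show ?thesis .
  qed
  then show ?thesis by (intro exI[of _ col] ballI)
qed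

end

section \<open>The digraph on a colour class\<close>

text \<open>The colours are named by parameters so that each class can be contracted in turn: the
  digraph lives on colour \<open>i\<close>, and its 3-cycles are taken around vertices of colour
  \<open>j\<close>.\<close>

locale coloured_triples = bicoloured_triples V W B
  for V :: "'v set" and W B +
  fixes col :: "'v \<Rightarrow> nat" and i j l :: nat
  assumes col: "Z \<in> W \<union> B \<Longrightarrow> col ` Z = {0, 1, 2}"
    and ijl: "{i, j, l} = {0, 1, 2::nat}"
begin

lemma distinct_colours: "i \<noteq> j" "j \<noteq> l" "i \<noteq> l"
proof -
  have "card {i, j, l} = 3" unfolding ijl by simp
  then show "i \<noteq> j" "j \<noteq> l" "i \<noteq> l" by (auto simp: card_insert_if split: if_splits)
qed

lemma col_triple: "Z \<in> W \<union> B \<Longrightarrow> col ` Z = {i, j, l}"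
  using col ijl by simp

lemma inj_col:
  assumes "Z \<in> W \<union> B"
  shows "inj_on col Z"
proof (rule eq_card_imp_inj_on)
  show "finite Z" using finite_triple assms .
  show "card (col ` Z) = card Z" using col[OF assms] triples[OF assms] by simp
qed

definition pt :: "nat \<Rightarrow> 'v set \<Rightarrow> 'v" where
  "pt k Z = (THE v. v \<in> Z \<and> col v = k)"

lemma pt_eqI:
  assumes "Z \<in> W \<union> B" "v \<in> Z" "col v = k"
  shows "pt k Z = v"
  unfolding pt_def
proof (rule the_equality)
  show "v \<in> Z \<and> col v = k" using assms by simp
  show "u = v" if "u \<in> Z \<and> col u = k" for u
    using inj_onD[OF inj_col[OF assms(1)], of u v] assms that by simp
qed

lemma pt:
  assumes "Z \<in> W \<union> B" "k \<in> {i, j, l}"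
  shows "pt k Z \<in> Z" "col (pt k Z) = k"
proof -
  have "k \<in> col ` Z" using col_triple[OF assms(1)] assms(2) by simp
  then obtain v where v: "v \<in> Z" "col v = k" by auto
  then show "pt k Z \<in> Z" "col (pt k Z) = k" using pt_eqI[OF assms(1) v] by auto
qed

lemma triple_eq:
  assumes "Z \<in> W \<union> B"
  shows "Z = {pt i Z, pt j Z, pt l Z}"
proof (intro equalityI subsetI)
  fix v assume v: "v \<in> Z"
  then have "col v \<in> {i, j, l}" using col_triple[OF assms] by blast
  then show "v \<in> {pt i Z, pt j Z, pt l Z}" using pt_eqI[OF assms v] by auto
next
  fix v assume "v \<in> {pt i Z, pt j Z, pt l Z}"
  then show "v \<in> Z" using pt[OF assms] by auto
qed

lemma pt_neq:
  assumes "Z \<in> W \<union> B" "a \<in> {i, j, l}" "b \<in> {i, j, l}" "a \<noteq> b"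
  shows "pt a Z \<noteq> pt b Z"
  using pt(2)[OF assms(1,2)] pt(2)[OF assms(1,3)] assms(4) by auto

lemma sum_triple:
  fixes f :: "'v \<Rightarrow> 'a::comm_monoid_add"
  assumes "Z \<in> W \<union> B"
  shows "(\<Sum>u\<in>Z. f u) = f (pt i Z) + (f (pt j Z) + f (pt l Z))"
  using pt_neq[OF assms] distinct_colours by (subst triple_eq[OF assms]) auto

lemma pt_unique:
  assumes "Z \<in> W \<and> Y \<in> W \<or> Z \<in> B \<and> Y \<in> B" "a \<in> {i, j, l}" "b \<in> {i, j, l}" "a \<noteq> b" "pt a Z = pt a Y" "pt b Z = pt b Y"
  shows "Z = Y"
proof -
  have WB: "Z \<in> W \<union> B" "Y \<in> W \<union> B" using assms(1) by auto
  have "{pt a Z, pt b Z} \<subseteq> Z" "{pt a Z, pt b Z} \<subseteq> Y" "pt a Z \<noteq> pt b Z"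
    using pt(1)[OF WB(1) assms(2)] pt(1)[OF WB(1) assms(3)] pt(1)[OF WB(2) assms(2)] pt(1)[OF WB(2) assms(3)]
      pt_neq[OF WB(1) assms(2-4)] assms(5,6) by simp_all
  then show ?thesis using W_unique B_unique assms(1) by metis
qed

definition opp :: "'v set \<Rightarrow> 'v set" where
  "opp Z = (THE Y. Y \<in> W \<and> pt j Y = pt j Z \<and> pt l Y = pt l Z)"

lemma opp_eqI:
  assumes "Y \<in> W" "pt j Y = pt j Z" "pt l Y = pt l Z"
  shows "opp Z = Y"
  unfolding opp_def
proof (rule the_equality)
  show "Y \<in> W \<and> pt j Y = pt j Z \<and> pt l Y = pt l Z" using assms by simp
  show "Y' = Y" if "Y' \<in> W \<and> pt j Y' = pt j Z \<and> pt l Y' = pt l Z" for Y'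
    using pt_unique[of Y' Y j l] that assms distinct_colours by auto
qed

lemma other_colour:
  assumes "Z \<in> W \<union> B" "a \<in> {i, j, l}" "b \<in> {i, j, l}" "a \<noteq> b"
  shows "\<exists>Y\<in>W. pt a Y = pt a Z \<and> pt b Y = pt b Z" "\<exists>Y\<in>B. pt a Y = pt a Z \<and> pt b Y = pt b Z"
proof -
  have sub: "{pt a Z, pt b Z} \<subseteq> Z" "pt a Z \<noteq> pt b Z" using pt(1)[OF assms(1)] pt_neq[OF assms] assms(2,3) by auto
  have "\<exists>Y\<in>W. {pt a Z, pt b Z} \<subseteq> Y" using assms(1) sub B_imp_W[of Z "pt a Z" "pt b Z"] by blast
  then obtain Y where "Y \<in> W" "{pt a Z, pt b Z} \<subseteq> Y" by blast
  then show "\<exists>Y\<in>W. pt a Y = pt a Z \<and> pt b Y = pt b Z"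
    using pt_eqI[of Y "pt a Z" a] pt_eqI[of Y "pt b Z" b] pt(2)[OF assms(1,2)] pt(2)[OF assms(1,3)] by auto
  have "\<exists>Y\<in>B. {pt a Z, pt b Z} \<subseteq> Y" using assms(1) sub W_imp_B[of Z "pt a Z" "pt b Z"] by blast
  then obtain Y where "Y \<in> B" "{pt a Z, pt b Z} \<subseteq> Y" by blast
  then show "\<exists>Y\<in>B. pt a Y = pt a Z \<and> pt b Y = pt b Z"
    using pt_eqI[of Y "pt a Z" a] pt_eqI[of Y "pt b Z" b] pt(2)[OF assms(1,2)] pt(2)[OF assms(1,3)] by auto
qed

lemma opp:
  assumes "Z \<in> B"
  shows "opp Z \<in> W" "pt j (opp Z) = pt j Z" "pt l (opp Z) = pt l Z"
proof -
  obtain Y where Y: "Y \<in> W" "pt j Y = pt j Z" "pt l Y = pt l Z"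
    using other_colour(1)[of Z j l] assms distinct_colours by auto
  then show "opp Z \<in> W" "pt j (opp Z) = pt j Z" "pt l (opp Z) = pt l Z" using opp_eqI[OF Y] by auto
qed

lemma bij_opp: "bij_betw opp B W"
proof -
  have "inj_on opp B"
  proof (rule inj_onI)
    fix Z Y assume "Z \<in> B" "Y \<in> B" "opp Z = opp Y"
    then show "Z = Y" using opp(2,3)[of Z] opp(2,3)[of Y] pt_unique[of Z Y j l] distinct_colours by auto
  qed
  moreover have "opp ` B = W"
  proof (intro equalityI subsetI)
    fix Y assume Y: "Y \<in> W"
    then obtain Z where "Z \<in> B" "pt j Z = pt j Y" "pt l Z = pt l Y"
      using other_colour(2)[of Y j l] distinct_colours by auto
    then show "Y \<in> opp ` B" using opp_eqI[OF Y, of Z] by auto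
  qed (use opp(1) in auto)
  ultimately show ?thesis by (simp add: bij_betw_def)
qed

abbreviation tail :: "'v set \<Rightarrow> 'v" where "tail \<equiv> pt i"

definition head :: "'v set \<Rightarrow> 'v" where "head Z = pt i (opp Z)"

lemma head_neq_tail:
  assumes "Z \<in> B"
  shows "head Z \<noteq> tail Z"
proof
  assume "head Z = tail Z"
  then have "opp Z = Z"
    using triple_eq[of Z] triple_eq[of "opp Z"] opp[OF assms] assms by (simp add: head_def)
  then show False using opp(1)[OF assms] assms disjoint_colours by auto
qed

lemma col_tail: "Z \<in> B \<Longrightarrow> col (tail Z) = i" "Z \<in> B \<Longrightarrow> col (head Z) = i"
  using pt(2)[of Z i] pt(2)[of "opp Z" i] opp(1)[of Z] by (auto simp: head_def)

lemma tail_in_V: "Z \<in> B \<Longrightarrow> tail Z \<in> V" "Z \<in> B \<Longrightarrow> head Z \<in> V"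
  using pt(1)[of Z i] pt(1)[of "opp Z" i] opp(1)[of Z] triples by (auto simp: head_def)

lemma star_eq:
  assumes "k \<in> {i, j, l}" "col r = k"
  shows "{Z \<in> B. r \<in> Z} = {Z \<in> B. pt k Z = r}" "{Z \<in> W. r \<in> Z} = {Z \<in> W. pt k Z = r}"
proof -
  have "r \<in> Z \<longleftrightarrow> pt k Z = r" if "Z \<in> W \<union> B" for Z
    using pt_eqI[OF that _ assms(2)] pt(1)[OF that assms(1)] by metis
  then show "{Z \<in> B. r \<in> Z} = {Z \<in> B. pt k Z = r}" "{Z \<in> W. r \<in> Z} = {Z \<in> W. pt k Z = r}"
    by blast+
qed

lemma wdeg_tail: "col r = i \<Longrightarrow> wdeg r = card {Z \<in> B. tail Z = r}"
  using star_eq(1)[of i r] wdeg_B by simp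

text \<open>A black triple Z at r and \<open>opp Z\<close> differ only in the vertex of colour
  \<open>i\<close>, and by \<open>sum_star_W_eq_B\<close> the black sum at r is a white sum. Taken
  in the free abelian group, the right-hand side is a combination of white relations, so each row of
  the Laplacian is one.\<close>

lemma firing_relation:
  fixes f :: "'v \<Rightarrow> 'a::ab_group_add"
  assumes "col r = i"
  shows "(\<Sum>Z\<in>{Z \<in> B. tail Z = r}. f r - f (head Z)) =
    (\<Sum>Z\<in>{Z \<in> W. r \<in> Z}. \<Sum>u\<in>Z. f u) - (\<Sum>Z\<in>{Z \<in> B. tail Z = r}. \<Sum>u\<in>opp Z. f u)"
proof -
  have "(\<Sum>Z\<in>{Z \<in> W. r \<in> Z}. \<Sum>u\<in>Z. f u) = (\<Sum>Z\<in>{Z \<in> B. tail Z = r}. \<Sum>u\<in>Z. f u)"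
    using sum_star_W_eq_B[where v=r] star_eq(1)[of i r] assms by simp
  then have "(\<Sum>Z\<in>{Z \<in> W. r \<in> Z}. \<Sum>u\<in>Z. f u) - (\<Sum>Z\<in>{Z \<in> B. tail Z = r}. \<Sum>u\<in>opp Z. f u)
    = (\<Sum>Z\<in>{Z \<in> B. tail Z = r}. (\<Sum>u\<in>Z. f u) - (\<Sum>u\<in>opp Z. f u))"
    by (simp add: sum_subtractf)
  also have "\<dots> = (\<Sum>Z\<in>{Z \<in> B. tail Z = r}. f r - f (head Z))"
  proof (intro sum.cong refl)
    fix Z assume Z: "Z \<in> {Z \<in> B. tail Z = r}"
    then have "(\<Sum>u\<in>Z. f u) = f r + (f (pt j Z) + f (pt l Z))" using sum_triple[of Z f] by simp
    moreover have "(\<Sum>u\<in>opp Z. f u) = f (head Z) + (f (pt j Z) + f (pt l Z))"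
      using sum_triple[of "opp Z" f] opp[of Z] Z by (simp add: head_def)
    ultimately show "(\<Sum>u\<in>Z. f u) - (\<Sum>u\<in>opp Z. f u) = f r - f (head Z)" by simp
  qed
  finally show ?thesis by simp
qed

lemma in_triple: "v \<in> V \<Longrightarrow> \<exists>Z\<in>W \<union> B. v \<in> Z"
  using cover by (metis Union_iff)

definition cls :: "'v set" where "cls = {v \<in> V. col v = i}"

lemma finite_cls: "finite cls"
  using finite_V by (simp add: cls_def)

lemma sum_by_tail:
  fixes h :: "'v set \<Rightarrow> 'a::comm_monoid_add"
  shows "(\<Sum>r\<in>cls. \<Sum>Z\<in>{Z \<in> B. tail Z = r}. h Z) = (\<Sum>Z\<in>B. h Z)"
  using finite_triples finite_cls col_tail tail_in_V by (intro sum.group) (auto simp: cls_def)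

lemma card_W_eq_B: "card W = card B"
  using bij_opp by (simp add: bij_betw_same_card)

lemma sum_wdeg_cls: "(\<Sum>r\<in>cls. wdeg r) = card W"
proof -
  have "(\<Sum>r\<in>cls. wdeg r) = (\<Sum>r\<in>cls. \<Sum>Z\<in>{Z \<in> B. tail Z = r}. 1)"
    by (intro sum.cong refl) (simp add: wdeg_tail cls_def)
  also have "\<dots> = (\<Sum>Z\<in>B. 1)" by (rule sum_by_tail)
  finally show ?thesis by (simp add: card_W_eq_B)
qed

text \<open>The out-degree of r counts the black triples at r, the in-degree the white ones, and
  both are \<open>wdeg r\<close>.\<close>

lemma sum_tail_eq_sum_head:
  fixes h :: "'v \<Rightarrow> 'a::comm_monoid_add"
  shows "(\<Sum>Z\<in>B. h (tail Z)) = (\<Sum>Z\<in>B. h (head Z))"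
proof -
  have "(\<Sum>Z\<in>B. h (head Z)) = (\<Sum>Y\<in>W. h (pt i Y))"
    unfolding head_def using sum.reindex_bij_betw[OF bij_opp, of "\<lambda>Y. h (pt i Y)"] .
  also have "\<dots> = (\<Sum>r\<in>cls. \<Sum>Y\<in>{Y \<in> W. pt i Y = r}. h (pt i Y))"
  proof (rule sum.group[symmetric])
    show "pt i ` W \<subseteq> cls" using pt[of _ i] triples by (auto simp: cls_def)
  qed (use finite_triples finite_cls in auto)
  also have "\<dots> = (\<Sum>r\<in>cls. \<Sum>Z\<in>{Z \<in> B. tail Z = r}. h (tail Z))"
  proof (rule sum.cong[OF refl])
    fix r assume r: "r \<in> cls"
    then have "card {Y \<in> W. pt i Y = r} = card {Z \<in> B. tail Z = r}"
      using wdeg_tail[of r] star_eq(2)[of i r] by (simp add: wdeg_def cls_def)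
    then have "(\<Sum>Y\<in>{Y \<in> W. pt i Y = r}. h r) = (\<Sum>Z\<in>{Z \<in> B. tail Z = r}. h r)"
      using finite_triples by (intro sum_const_card_eq) auto
    then show "(\<Sum>Y\<in>{Y \<in> W. pt i Y = r}. h (pt i Y)) = (\<Sum>Z\<in>{Z \<in> B. tail Z = r}. h (tail Z))" by simp
  qed
  also have "\<dots> = (\<Sum>Z\<in>B. h (tail Z))" by (rule sum_by_tail)
  finally show ?thesis by simp
qed

text \<open>The digraph is Eulerian, so the quadratic form of its Laplacian is half the sum of the squared
  differences along the arcs.\<close>

lemma harmonic_zero:
  fixes q :: "'v \<Rightarrow> real"
  assumes \<rho>: "\<rho> \<in> cls" "q \<rho> = 0"
    and harm: "\<And>r. r \<in> cls \<Longrightarrow> r \<noteq> \<rho> \<Longrightarrow> (\<Sum>Z\<in>{Z \<in> B. tail Z = r}. q r - q (head Z)) = 0"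
    and r: "r \<in> cls"
  shows "q r = 0"
proof -
  have "(\<Sum>Z\<in>B. q (tail Z) * (q (tail Z) - q (head Z))) = (\<Sum>r\<in>cls. \<Sum>Z\<in>{Z \<in> B. tail Z = r}. q (tail Z) * (q (tail Z) - q (head Z)))"
    by (rule sum_by_tail[symmetric])
  also have "\<dots> = (\<Sum>r\<in>cls. q r * (\<Sum>Z\<in>{Z \<in> B. tail Z = r}. q r - q (head Z)))"
    by (intro sum.cong refl) (simp add: sum_distrib_left)
  also have "\<dots> = 0"
  proof (intro sum.neutral ballI)
    fix x assume "x \<in> cls"
    then show "q x * (\<Sum>Z\<in>{Z \<in> B. tail Z = x}. q x - q (head Z)) = 0"
      using harm \<rho>(2) by (cases "x = \<rho>") auto
  qed
  finally have 0: "(\<Sum>Z\<in>B. q (tail Z) * (q (tail Z) - q (head Z))) = 0" .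
  have "(\<Sum>Z\<in>B. (q (tail Z) - q (head Z))\<^sup>2) =
      (\<Sum>Z\<in>B. 2 * (q (tail Z) * (q (tail Z) - q (head Z))) + ((q (head Z))\<^sup>2 - (q (tail Z))\<^sup>2))"
    by (intro sum.cong refl) (simp add: power2_eq_square algebra_simps)
  also have "\<dots> = 2 * (\<Sum>Z\<in>B. q (tail Z) * (q (tail Z) - q (head Z))) + ((\<Sum>Z\<in>B. (q (head Z))\<^sup>2) - (\<Sum>Z\<in>B. (q (tail Z))\<^sup>2))"
    by (simp add: sum.distrib sum_subtractf sum_distrib_left)
  also have "\<dots> = 0" using 0 sum_tail_eq_sum_head[of "\<lambda>v. (q v)\<^sup>2"] by simp
  finally have "(\<Sum>Z\<in>B. (q (tail Z) - q (head Z))\<^sup>2) = 0" .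
  then have eq: "q (tail Z) = q (head Z)" if "Z \<in> B" for Z
    using that finite_triples by (subst (asm) sum_nonneg_eq_0_iff) auto
  have "{Z \<in> W \<union> B. q (pt i Z) = 0} = W \<union> B"
  proof (rule connected)
    obtain Z where Z: "Z \<in> W \<union> B" "\<rho> \<in> Z" using \<rho>(1) in_triple by (auto simp: cls_def)
    then have "pt i Z = \<rho>" using pt_eqI[OF Z] \<rho>(1) by (simp add: cls_def)
    then show "{Z \<in> W \<union> B. q (pt i Z) = 0} \<noteq> {}" using Z(1) \<rho>(2) by blast
  next
    fix Z Y a b
    assume Z: "Z \<in> {Z \<in> W \<union> B. q (pt i Z) = 0}" and Y: "Y \<in> W \<union> B" and ab: "a \<noteq> b" "{a, b} \<subseteq> Z" "{a, b} \<subseteq> Y"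
    \<comment> \<open>A common pair either contains the vertex of colour \<open>i\<close>, or has
      colours \<open>j\<close> and \<open>l\<close>. In the second case the triples coincide or form
      an arc, along which \<open>q\<close> is constant.\<close>
    have "q (pt i Y) = q (pt i Z)"
    proof (cases "col a = i \<or> col b = i")
      case True
      then show ?thesis using pt_eqI[of Z a i] pt_eqI[of Y a i] pt_eqI[of Z b i] pt_eqI[of Y b i] Z Y ab by auto
    next
      case False
      have cab: "col a \<in> {i, j, l}" "col b \<in> {i, j, l}" using col_triple[OF Y] ab(3) by blast+
      have "col a \<noteq> col b" using inj_onD[OF inj_col[OF Y], of a b] ab by auto
      then have "pt j Y = pt j Z \<and> pt l Y = pt l Z"
        using False cab pt_eqI[of Z a] pt_eqI[of Y a] pt_eqI[of Z b] pt_eqI[of Y b] Z Y ab by auto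
      then have jl: "pt j Y = pt j Z" "pt l Y = pt l Z" by auto
      consider "Y \<in> W" "Z \<in> W" | "Y \<in> B" "Z \<in> B" | "Y \<in> W" "Z \<in> B" | "Y \<in> B" "Z \<in> W" using Y Z by blast
      then show ?thesis
      proof cases
        case 1
        then have "Y = Z" using pt_unique[of Y Z j l] jl distinct_colours by auto
        then show ?thesis by simp
      next
        case 2
        then have "Y = Z" using pt_unique[of Y Z j l] jl distinct_colours by auto
        then show ?thesis by simp
      next
        case 3
        then have "opp Z = Y" using opp_eqI jl by simp
        then show ?thesis using eq[OF 3(2)] by (simp add: head_def)
      next
        case 4
        then have "opp Y = Z" using opp_eqI[of Z Y] jl by simp
        then show ?thesis using eq[OF 4(1)] by (simp add: head_def)
      qed
    qed
    then show "Y \<in> {Z \<in> W \<union> B. q (pt i Z) = 0}" using Z Y by simp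
  qed blast
  moreover obtain Z where Z: "Z \<in> W \<union> B" "r \<in> Z" using r in_triple by (auto simp: cls_def)
  ultimately have "q (pt i Z) = 0" by blast
  then show ?thesis using pt_eqI[OF Z] r by (simp add: cls_def)
qed

text \<open>Rotation about the vertex of colour \<open>j\<close>: cross the edge opposite to the
  tail into the white triple \<open>opp Z\<close>, then its edge of colours \<open>i\<close> and
  \<open>j\<close> into the next black triple. That triple starts where the arc Z ends, so orbits of
  \<open>nxt\<close> trace closed directed walks.\<close>

definition nxt :: "'v set \<Rightarrow> 'v set" where
  "nxt Z = (THE Y. Y \<in> B \<and> pt i Y = head Z \<and> pt j Y = pt j Z)"

lemma nxt:
  assumes "Z \<in> B"
  shows "nxt Z \<in> B" "tail (nxt Z) = head Z" "pt j (nxt Z) = pt j Z"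
proof -
  obtain Y where Y: "Y \<in> B" "pt i Y = head Z" "pt j Y = pt j Z"
    using other_colour(2)[of "opp Z" i j] opp[OF assms] distinct_colours by (auto simp: head_def)
  have "nxt Z = Y" unfolding nxt_def
  proof (rule the_equality)
    show "Y' = Y" if "Y' \<in> B \<and> pt i Y' = head Z \<and> pt j Y' = pt j Z" for Y'
      using pt_unique[of Y' Y i j] that Y distinct_colours by auto
  qed (use Y in simp)
  then show "nxt Z \<in> B" "tail (nxt Z) = head Z" "pt j (nxt Z) = pt j Z" using Y by auto
qed

lemma nxt_neq: "Z \<in> B \<Longrightarrow> nxt Z \<noteq> Z"
  using nxt(2)[of Z] head_neq_tail[of Z] by metis

lemma nxt_inj:
  assumes "Z \<in> B" "Y \<in> B" "nxt Z = nxt Y"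
  shows "Z = Y"
proof -
  have "head Z = head Y" "pt j Z = pt j Y" using nxt[OF assms(1)] nxt[OF assms(2)] assms(3) by auto
  then have "opp Z = opp Y"
    using pt_unique[of "opp Z" "opp Y" i j] opp[OF assms(1)] opp[OF assms(2)] distinct_colours by (auto simp: head_def)
  then show ?thesis using bij_opp assms by (auto simp: bij_betw_def dest: inj_onD)
qed

text \<open>Around a vertex of degree 6 the map \<open>nxt\<close> permutes three black triples without fixed points,
  hence cyclically.\<close>

lemma nxt_cycle:
  assumes "col v = j" "wdeg v = 3" "Z \<in> B" "v \<in> Z"
  shows "{Y \<in> B. v \<in> Y} = {Z, nxt Z, nxt (nxt Z)}" "nxt (nxt (nxt Z)) = Z"
    "Z \<noteq> nxt Z" "nxt Z \<noteq> nxt (nxt Z)" "Z \<noteq> nxt (nxt Z)"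
proof -
  define Bv where "Bv = {Y \<in> B. v \<in> Y}"
  have Bv: "Bv = {Y \<in> B. pt j Y = v}" unfolding Bv_def using star_eq(1)[of j v] assms(1) by simp
  have card: "card Bv = 3" using wdeg_B[of v] assms(2) by (simp add: Bv_def)
  have fin: "finite Bv" using finite_triples by (simp add: Bv_def)
  have nB: "nxt Y \<in> Bv" if "Y \<in> Bv" for Y using that nxt[of Y] unfolding Bv by auto
  have inB: "Y \<in> B" if "Y \<in> Bv" for Y using that unfolding Bv by auto
  have Z: "Z \<in> Bv" using assms by (simp add: Bv_def)
  show 1: "Z \<noteq> nxt Z" "nxt Z \<noteq> nxt (nxt Z)" using nxt_neq[of Z] nxt_neq[of "nxt Z"] nxt(1)[of Z] assms(3) by auto
  obtain Y where Y: "Bv = {Z, nxt Z, Y}" "Y \<noteq> Z" "Y \<noteq> nxt Z"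
    using card3_third[OF card Z nB[OF Z] 1(1)] by blast
  have YB: "Y \<in> Bv" using Y(1) by blast
  \<comment> \<open>If \<open>nxt\<close> swapped two of the triples, injectivity would leave no
    image for the third but itself.\<close>
  show 2: "Z \<noteq> nxt (nxt Z)"
  proof
    assume e: "Z = nxt (nxt Z)"
    have "nxt Y \<in> {Z, nxt Z}" using nB[OF YB] nxt_neq[OF inB[OF YB]] Y(1) by blast
    then have "nxt Y = nxt (nxt Z) \<or> nxt Y = nxt Z" using e by auto
    then have "Y = nxt Z \<or> Y = Z" using nxt_inj[OF inB[OF YB]] inB[OF nB[OF Z]] inB[OF Z] by blast
    with Y show False by blast
  qed
  have "nxt (nxt Z) \<in> Bv" using nB Z by blast
  then have YY: "Y = nxt (nxt Z)" using Y(1) 1 2 by blast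
  show "{Y \<in> B. v \<in> Y} = {Z, nxt Z, nxt (nxt Z)}" using Y(1) YY by (simp add: Bv_def)
  have "nxt Y \<in> {Z, nxt Z}" using nB[OF YB] nxt_neq[OF inB[OF YB]] Y(1) by blast
  moreover have "nxt Y \<noteq> nxt Z" using nxt_inj[OF inB[OF YB] inB[OF Z]] Y(2) by blast
  ultimately have "nxt Y = Z" by blast
  then show "nxt (nxt (nxt Z)) = Z" by (simp only: YY)
qed

definition arcs :: "'v \<Rightarrow> 'v \<Rightarrow> nat" where
  "arcs x y = card {Z \<in> B. tail Z = x \<and> head Z = y}"

lemma arcs_diag: "arcs x x = 0"
proof -
  have "{Z \<in> B. tail Z = x \<and> head Z = x} = {}" using head_neq_tail by auto
  then show ?thesis unfolding arcs_def by (simp only: card.empty)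
qed

lemma sum_arcs:
  fixes f :: "'v \<Rightarrow> 'a::comm_semiring_1"
  shows "(\<Sum>Z\<in>{Z \<in> B. tail Z = x}. f (head Z)) = (\<Sum>y\<in>cls. of_nat (arcs x y) * f y)"
proof -
  have "(\<Sum>y\<in>cls. of_nat (arcs x y) * f y) = (\<Sum>y\<in>cls. \<Sum>Z\<in>{Z \<in> {Z \<in> B. tail Z = x}. head Z = y}. f (head Z))"
    unfolding arcs_def by (intro sum.cong refl) (simp add: conj_assoc)
  also have "\<dots> = (\<Sum>Z\<in>{Z \<in> B. tail Z = x}. f (head Z))"
    using finite_triples finite_cls col_tail tail_in_V by (intro sum.group) (auto simp: cls_def)
  finally show ?thesis by simp
qed

text \<open>The vertices of degree 6 whose 3-cycle stays inside R; with R the class without the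
  root, these 3-cycles survive in the reduced Laplacian.\<close>

definition good :: "'v set \<Rightarrow> 'v set" where
  "good R = {v \<in> V. col v = j \<and> wdeg v = 3 \<and> (\<forall>Y\<in>B. v \<in> Y \<longrightarrow> tail Y \<in> R)}"

text \<open>Each good vertex gives a directed 3-cycle through the tails of its three black triples,
  and the triple sum on the right sees it from each of its three starting points, hence the factor
  3. Different good vertices may give the same cycle of vertices; the arc multiplicities account for
  this.\<close>

lemma three_cycles:
  assumes R: "R \<subseteq> cls"
  shows "3 * (\<Sum>v\<in>good R. \<Prod>Y\<in>{Y \<in> B. v \<in> Y}. 1 / real (wdeg (tail Y))) \<le>
    (\<Sum>x\<in>R. \<Sum>y\<in>R. \<Sum>z\<in>R. real (arcs x y) / wdeg x * (real (arcs y z) / wdeg y) * (real (arcs z x) / wdeg z))"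
proof -
  have finR: "finite R" using R finite_cls finite_subset by blast
  define G where "G = {Z \<in> B. pt j Z \<in> good R}"
  define d where "d x = 1 / real (wdeg x)" for x
  define w where "w = (\<lambda>(x, y, z). d x * d y * d z)"
  define t where "t Z = (tail Z, tail (nxt Z), tail (nxt (nxt Z)))" for Z
  have finG: "finite G" using finite_triples by (simp add: G_def)
  have in_good: "v \<in> V" "col v = j" "wdeg v = 3" "\<And>Y. Y \<in> B \<Longrightarrow> v \<in> Y \<Longrightarrow> tail Y \<in> R" if "v \<in> good R" for v
    using that by (auto simp: good_def)
  have prod: "(\<Prod>Y\<in>{Y \<in> B. v \<in> Y}. d (tail Y)) = w (t Z)" if "v \<in> good R" "Z \<in> B" "v \<in> Z" for v Z
    using nxt_cycle[OF in_good(2,3)[OF that(1)] that(2,3)] by (simp add: w_def t_def mult.assoc)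
  have tR: "t Z \<in> R \<times> R \<times> R" and hd: "tail (nxt Z) = head Z" "tail (nxt (nxt Z)) = head (nxt Z)" "tail Z = head (nxt (nxt Z))"
    "nxt Z \<in> B" "nxt (nxt Z) \<in> B" "Z \<in> B" if "Z \<in> G" for Z
  proof -
    have Z: "Z \<in> B" "pt j Z \<in> good R" using that by (auto simp: G_def)
    have "pt j Z \<in> Z" using pt(1) Z(1) by simp
    note cyc = nxt_cycle[OF in_good(2,3)[OF Z(2)] Z(1) this]
    have mem: "Y \<in> B \<and> pt j Z \<in> Y" if "Y \<in> {Z, nxt Z, nxt (nxt Z)}" for Y using that cyc(1) by blast
    show "t Z \<in> R \<times> R \<times> R" using in_good(4)[OF Z(2)] mem by (simp add: t_def)
    show "nxt Z \<in> B" "nxt (nxt Z) \<in> B" "Z \<in> B" using mem by auto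
    then show "tail (nxt Z) = head Z" "tail (nxt (nxt Z)) = head (nxt Z)" "tail Z = head (nxt (nxt Z))"
      using nxt(2)[of Z] nxt(2)[of "nxt Z"] nxt(2)[of "nxt (nxt Z)"] cyc(2) by auto
  qed
  have "3 * (\<Sum>v\<in>good R. \<Prod>Y\<in>{Y \<in> B. v \<in> Y}. d (tail Y)) = (\<Sum>v\<in>good R. \<Sum>Z\<in>{Z \<in> G. pt j Z = v}. w (t Z))"
    unfolding sum_distrib_left
  proof (intro sum.cong refl)
    fix v assume v: "v \<in> good R"
    have Gv: "{Z \<in> G. pt j Z = v} = {Z \<in> B. v \<in> Z}"
    proof -
      have "{Z \<in> B. v \<in> Z} = {Z \<in> B. pt j Z = v}" by (rule star_eq(1)) (simp_all add: in_good(2)[OF v])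
      moreover have "{Z \<in> G. pt j Z = v} = {Z \<in> B. pt j Z = v}" unfolding G_def using v by blast
      ultimately show ?thesis by simp
    qed
    have "(\<Sum>Z\<in>{Z \<in> G. pt j Z = v}. w (t Z)) = (\<Sum>Z\<in>{Z \<in> B. v \<in> Z}. \<Prod>Y\<in>{Y \<in> B. v \<in> Y}. d (tail Y))"
      unfolding Gv using prod[OF v] by (intro sum.cong) auto
    also have "\<dots> = 3 * (\<Prod>Y\<in>{Y \<in> B. v \<in> Y}. d (tail Y))"
      using in_good(3)[OF v] wdeg_B[of v] by simp
    finally show "3 * (\<Prod>Y\<in>{Y \<in> B. v \<in> Y}. d (tail Y)) = (\<Sum>Z\<in>{Z \<in> G. pt j Z = v}. w (t Z))" by simp
  qed
  also have "\<dots> = (\<Sum>Z\<in>G. w (t Z))"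
    using finG finite_V by (intro sum.group) (auto simp: G_def good_def)
  also have "\<dots> = (\<Sum>xyz\<in>R \<times> R \<times> R. \<Sum>Z\<in>{Z \<in> G. t Z = xyz}. w (t Z))"
    using finG finR by (intro sum.group[symmetric] image_subsetI tR) auto
  also have "\<dots> \<le> (\<Sum>(x, y, z)\<in>R \<times> R \<times> R. real (arcs x y) * d x * (real (arcs y z) * d y) * (real (arcs z x) * d z))"
  proof (intro sum_mono)
    fix xyz assume "xyz \<in> R \<times> R \<times> R"
    obtain x y z where xyz: "xyz = (x, y, z)" by (cases xyz) auto
    define Gx where "Gx = {Z \<in> G. t Z = (x, y, z)}"
    \<comment> \<open>Each Z counted is itself an arc from x to y. The other two factors are at
      least 1 because of the arcs \<open>nxt Z\<close> and \<open>nxt (nxt Z)\<close>.\<close>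
    have "card Gx \<le> arcs x y * arcs y z * arcs z x"
    proof (cases "Gx = {}")
      case False
      then obtain Z where Z: "Z \<in> G" "t Z = (x, y, z)" by (auto simp: Gx_def)
      have "nxt Z \<in> {Z \<in> B. tail Z = y \<and> head Z = z}" "nxt (nxt Z) \<in> {Z \<in> B. tail Z = z \<and> head Z = x}"
        using hd[OF Z(1)] Z(2) by (auto simp: t_def)
      then have "{Z \<in> B. tail Z = y \<and> head Z = z} \<noteq> {}" "{Z \<in> B. tail Z = z \<and> head Z = x} \<noteq> {}" by blast+
      then have "1 \<le> arcs y z" "1 \<le> arcs z x"
        using finite_triples unfolding arcs_def by (simp_all add: Suc_le_eq card_gt_0_iff)
      moreover have "card Gx \<le> arcs x y"
        unfolding arcs_def using finite_triples hd by (intro card_mono) (auto simp: Gx_def t_def)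
      ultimately have "card Gx * 1 * 1 \<le> arcs x y * arcs y z * arcs z x" by (intro mult_le_mono) auto
      then show ?thesis by simp
    qed simp
    then have "real (card Gx) \<le> real (arcs x y) * real (arcs y z) * real (arcs z x)"
      by (metis of_nat_le_iff of_nat_mult)
    then have "real (card Gx) * (d x * d y * d z) \<le> (real (arcs x y) * real (arcs y z) * real (arcs z x)) * (d x * d y * d z)"
      by (intro mult_right_mono) (auto simp: d_def)
    moreover have "(\<Sum>Z\<in>{Z \<in> G. t Z = xyz}. w (t Z)) = real (card Gx) * (d x * d y * d z)"
      by (simp add: xyz w_def Gx_def)
    ultimately show "(\<Sum>Z\<in>{Z \<in> G. t Z = xyz}. w (t Z)) \<le>
      (case xyz of (x, y, z) \<Rightarrow> real (arcs x y) * d x * (real (arcs y z) * d y) * (real (arcs z x) * d z))"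
      by (simp add: xyz mult_ac)
  qed
  also have "\<dots> = (\<Sum>x\<in>R. \<Sum>y\<in>R. \<Sum>z\<in>R. real (arcs x y) * d x * (real (arcs y z) * d y) * (real (arcs z x) * d z))"
    by (simp add: sum.cartesian_product case_prod_beta)
  finally show ?thesis by (simp add: d_def)
qed

end

section \<open>Torsion and the Laplacian\<close>

text \<open>Additive subgroups without a carrier, so that computations with relations are plain
  arithmetic in the type of finitely supported functions.\<close>

definition diff_closed :: "'a::ab_group_add set \<Rightarrow> bool" where
  "diff_closed N \<longleftrightarrow> 0 \<in> N \<and> (\<forall>a\<in>N. \<forall>b\<in>N. a - b \<in> N)"

lemma diff_closedD:
  assumes "diff_closed N"
  shows "0 \<in> N" "a \<in> N \<Longrightarrow> b \<in> N \<Longrightarrow> a - b \<in> N" "a \<in> N \<Longrightarrow> - a \<in> N" "a \<in> N \<Longrightarrow> b \<in> N \<Longrightarrow> a + b \<in> N"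
proof -
  have d: "a - b \<in> N" if "a \<in> N" "b \<in> N" for a b using assms that by (simp add: diff_closed_def)
  have 0: "0 \<in> N" using assms by (simp add: diff_closed_def)
  have m: "- a \<in> N" if "a \<in> N" for a using d[OF 0 that] by simp
  show "0 \<in> N" by (rule 0)
  show "a - b \<in> N" if "a \<in> N" "b \<in> N" using that by (rule d)
  show "- a \<in> N" if "a \<in> N" using that by (rule m)
  show "a + b \<in> N" if "a \<in> N" "b \<in> N" using d[OF that(1) m[OF that(2)]] by simp
qed

lemma diff_closed_sum:
  assumes "diff_closed N" "\<And>x. x \<in> S \<Longrightarrow> f x \<in> N"
  shows "(\<Sum>x\<in>S. f x) \<in> N"
  using assms(2) diff_closedD[OF assms(1)] by (induction S rule: infinite_finite_induct) auto

lemma diff_closed_frag_cmul: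
  assumes "diff_closed N" "x \<in> N"
  shows "frag_cmul k x \<in> N"
proof (induction k rule: int_induct[of _ 0])
  case base
  then show ?case using diff_closedD(1)[OF assms(1)] by simp
next
  case (step1 k)
  then show ?case using diff_closedD(4)[OF assms(1) _ assms(2)] by (simp add: frag_cmul_distrib)
next
  case (step2 k)
  then show ?case using diff_closedD(2)[OF assms(1) _ assms(2)] by (simp add: frag_cmul_diff_distrib)
qed

lemma sum_const_frag: "(\<Sum>_\<in>S. x) = frag_cmul (int (card S)) x"
  by (induction S rule: infinite_finite_induct) (auto simp: frag_cmul_distrib)

text \<open>The value at x of the homomorphism to the integers that is \<open>\<omega>\<close> on
  the generators.\<close>

definition frag_pairing :: "'v set \<Rightarrow> ('v \<Rightarrow> int) \<Rightarrow> ('v \<Rightarrow>\<^sub>0 int) \<Rightarrow> int" where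
  "frag_pairing V \<omega> x = (\<Sum>v\<in>V. Poly_Mapping.lookup x v * \<omega> v)"

lemma frag_pairing_add: "frag_pairing V \<omega> (x + y) = frag_pairing V \<omega> x + frag_pairing V \<omega> y"
  by (simp add: frag_pairing_def lookup_add distrib_right sum.distrib)

lemma frag_pairing_minus: "frag_pairing V \<omega> (- x) = - frag_pairing V \<omega> x"
  by (simp add: frag_pairing_def sum_negf)

lemma frag_pairing_cmul: "frag_pairing V \<omega> (frag_cmul k x) = k * frag_pairing V \<omega> x"
  by (simp add: frag_pairing_def sum_distrib_left mult.assoc)

lemma frag_pairing_of: "finite V \<Longrightarrow> v \<in> V \<Longrightarrow> frag_pairing V \<omega> (frag_of v) = \<omega> v"
  by (simp add: frag_pairing_def if_distrib[of "\<lambda>x. x * _"] cong: if_cong)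

lemma frag_pairing_sum: "frag_pairing V \<omega> (\<Sum>i\<in>S. f i) = (\<Sum>i\<in>S. frag_pairing V \<omega> (f i))"
proof (induction S rule: infinite_finite_induct)
  case (insert a S)
  then show ?case by (simp add: frag_pairing_add)
qed (auto simp: frag_pairing_def)

context coloured_triples
begin

definition laplacian :: "(nat \<Rightarrow> 'v) \<Rightarrow> nat \<Rightarrow> nat \<Rightarrow> int" where
  "laplacian g x y = (if x = y then int (wdeg (g x)) else 0) - int (arcs (g x) (g y))"

definition laplacian_mat :: "(nat \<Rightarrow> 'v) \<Rightarrow> nat \<Rightarrow> int mat" where
  "laplacian_mat g n = Matrix.mat n n (\<lambda>(x, y). laplacian g x y)"

lemma sum_arcs_row:
  assumes "x \<in> cls"
  shows "(\<Sum>y\<in>cls. arcs x y) = wdeg x"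
  using sum_arcs[where x=x and f="\<lambda>_. 1::nat"] wdeg_tail[of x] assms by (simp add: cls_def)

text \<open>The row sum at x is the number of arcs from x to the root, so
  \<open>det_dominant_le\<close> applies, with the transition probabilities of the random walk on
  the digraph as \<open>b\<close>. Its 2-cycle sum is nonnegative and is discarded;
  \<open>three_cycles\<close> bounds the other one.\<close>

lemma laplacian_det:
  assumes \<rho>: "\<rho> \<in> cls" and g: "bij_betw g {..<n} (cls - {\<rho>})"
  shows "Determinant.det (laplacian_mat g n) \<noteq> 0"
    and "real_of_int \<bar>Determinant.det (laplacian_mat g n)\<bar> \<le> (\<Prod>r\<in>cls - {\<rho>}. real (wdeg r)) *
      exp (- (\<Sum>v\<in>good (cls - {\<rho>}). \<Prod>Y\<in>{Y \<in> B. v \<in> Y}. 1 / real (wdeg (tail Y))))"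
proof -
  define R where "R = cls - {\<rho>}"
  define a where "a = (\<lambda>x y. real_of_int (laplacian g x y))"
  define A where "A = Matrix.mat n n (\<lambda>(x, y). a x y)"
  have A: "A \<in> carrier_mat n n" by (simp add: A_def)
  have finR: "finite R" using finite_cls by (simp add: R_def)
  have gR: "g x \<in> R" if "x < n" for x using g that by (auto simp: bij_betw_def R_def)
  have gc: "g x \<in> cls" "g x \<noteq> \<rho>" if "x < n" for x using gR[OF that] by (auto simp: R_def)
  have ginj: "g x = g y \<longleftrightarrow> x = y" if "x < n" "y < n" for x y
    using g that by (auto simp: bij_betw_def inj_on_def)
  have re: "(\<Sum>x<n. f (g x)) = (\<Sum>r\<in>R. f r)" for f :: "'v \<Rightarrow> real"
    unfolding R_def using sum.reindex_bij_betw[OF g] .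
  have A_eq: "A = map_mat real_of_int (laplacian_mat g n)"
    by (rule eq_matI) (auto simp: A_def laplacian_mat_def a_def)
  have det_eq: "Determinant.det A = real_of_int (Determinant.det (laplacian_mat g n))"
    unfolding A_eq by (rule of_int_hom.hom_det)
  have a_diag: "a x x = real (wdeg (g x))" for x by (simp add: a_def laplacian_def arcs_diag)
  have a_off: "a x y = - real (arcs (g x) (g y))" if "x \<noteq> y" for x y using that by (simp add: a_def laplacian_def)
  have row: "(\<Sum>y\<in>R. real (arcs x y)) = real (wdeg x) - real (arcs x \<rho>)" if "x \<in> cls" for x
  proof -
    have "real (wdeg x) = (\<Sum>y\<in>cls. real (arcs x y))" using sum_arcs_row[OF that] by (metis of_nat_sum)
    also have "\<dots> = real (arcs x \<rho>) + (\<Sum>y\<in>R. real (arcs x y))"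
      unfolding R_def using finite_cls \<rho> by (rule sum.remove)
    finally show ?thesis by simp
  qed
  have a_sum: "(\<Sum>y<n. a x y * f y) = real (wdeg (g x)) * f x - (\<Sum>y<n. real (arcs (g x) (g y)) * f y)"
    if "x < n" for x f
  proof -
    have "(\<Sum>y<n. a x y * f y) = (\<Sum>y<n. (if x = y then real (wdeg (g x)) * f y else 0) - real (arcs (g x) (g y)) * f y)"
      by (intro sum.cong refl) (auto simp: a_def laplacian_def algebra_simps)
    then show ?thesis using that by (simp add: sum_subtractf)
  qed
  have rows: "0 \<le> (\<Sum>y<n. a x y)" if "x < n" for x
    using a_sum[OF that, of "\<lambda>_. 1"] re[of "\<lambda>r. real (arcs (g x) r)"] row[OF gc(1)[OF that]] by simp
  define b where "b = (\<lambda>x y. if x = y then 0 else - a x y / a x x)"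
  have b_eq: "b x y = real (arcs (g x) (g y)) / wdeg (g x)" for x y
    by (cases "x = y") (auto simp: b_def a_diag a_off arcs_diag)
  have dom: "0 \<le> Determinant.det A"
    "Determinant.det A \<le> (\<Prod>x<n. a x x) * exp (- ((\<Sum>x<n. \<Sum>y<n. b x y * b y x) / 2 + (\<Sum>x<n. \<Sum>y<n. \<Sum>z<n. b x y * b y z * b z x) / 3))"
    unfolding A_def b_def using a_off rows by (intro det_dominant_le; simp)+
  have "0 \<le> (\<Sum>x<n. \<Sum>y<n. b x y * b y x)" by (intro sum_nonneg) (simp add: b_eq)
  moreover have "3 * (\<Sum>v\<in>good R. \<Prod>Y\<in>{Y \<in> B. v \<in> Y}. 1 / real (wdeg (tail Y))) \<le> (\<Sum>x<n. \<Sum>y<n. \<Sum>z<n. b x y * b y z * b z x)"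
  proof -
    have re3: "(\<Sum>x<n. \<Sum>y<n. \<Sum>z<n. h (g x) (g y) (g z)) = (\<Sum>x\<in>R. \<Sum>y\<in>R. \<Sum>z\<in>R. h x y z)"
      for h :: "'v \<Rightarrow> 'v \<Rightarrow> 'v \<Rightarrow> real"
    proof -
      have 1: "(\<Sum>z<n. h (g x) (g y) (g z)) = (\<Sum>z\<in>R. h (g x) (g y) z)" for x y by (rule re)
      have 2: "(\<Sum>y<n. \<Sum>z\<in>R. h (g x) (g y) z) = (\<Sum>y\<in>R. \<Sum>z\<in>R. h (g x) y z)" for x
        by (rule re[of "\<lambda>y. \<Sum>z\<in>R. h (g x) y z"])
      show ?thesis unfolding 1 2 by (rule re[of "\<lambda>x. \<Sum>y\<in>R. \<Sum>z\<in>R. h x y z"])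
    qed
    have "R \<subseteq> cls" by (simp add: R_def)
    then show ?thesis unfolding b_eq
      re3[of "\<lambda>x y z. real (arcs x y) / wdeg x * (real (arcs y z) / wdeg y) * (real (arcs z x) / wdeg z)"]
      by (rule three_cycles)
  qed
  ultimately have "exp (- ((\<Sum>x<n. \<Sum>y<n. b x y * b y x) / 2 + (\<Sum>x<n. \<Sum>y<n. \<Sum>z<n. b x y * b y z * b z x) / 3))
     \<le> exp (- (\<Sum>v\<in>good R. \<Prod>Y\<in>{Y \<in> B. v \<in> Y}. 1 / real (wdeg (tail Y))))" by simp
  moreover have "(\<Prod>x<n. a x x) = (\<Prod>r\<in>R. real (wdeg r))"
    unfolding a_diag R_def using prod.reindex_bij_betw[OF g] .
  ultimately have "Determinant.det A \<le> (\<Prod>r\<in>R. real (wdeg r)) *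
      exp (- (\<Sum>v\<in>good R. \<Prod>Y\<in>{Y \<in> B. v \<in> Y}. 1 / real (wdeg (tail Y))))"
    using dom(2) by (smt (verit) mult_left_mono prod_nonneg of_nat_0_le_iff)
  then show "real_of_int \<bar>Determinant.det (laplacian_mat g n)\<bar> \<le> (\<Prod>r\<in>cls - {\<rho>}. real (wdeg r)) *
      exp (- (\<Sum>v\<in>good (cls - {\<rho>}). \<Prod>Y\<in>{Y \<in> B. v \<in> Y}. 1 / real (wdeg (tail Y))))"
    using dom(1) det_eq by (simp add: R_def)
  have "Determinant.det A \<noteq> 0"
  proof
    assume "Determinant.det A = 0"
    then obtain x where x: "x \<in> carrier_vec n" "x \<noteq> 0\<^sub>v n" "A *\<^sub>v x = 0\<^sub>v n"
      using det_0_iff_vec_prod_zero_field[OF A] by blast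
    \<comment> \<open>A kernel vector, extended by 0 to the root, is harmonic away from the
      root.\<close>
    define q where "q = (\<lambda>v. if v \<in> R then vec_index x (inv_into {..<n} g v) else 0)"
    have qg: "q (g m) = vec_index x m" if "m < n" for m
      using gR[OF that] that g by (simp add: q_def bij_betw_def)
    have q\<rho>: "q \<rho> = 0" by (simp add: q_def R_def)
    have q0: "q r = 0" if "r \<in> cls" for r
    proof (rule harmonic_zero[where \<rho> = \<rho> and q = q, OF \<rho> q\<rho> _ that])
      fix r assume "r \<in> cls" "r \<noteq> \<rho>"
      then have "r \<in> g ` {..<n}" using g by (simp add: bij_betw_def)
      then obtain m where m: "m < n" "r = g m" by auto
      have "(\<Sum>Z\<in>{Z \<in> B. tail Z = r}. q r - q (head Z)) = real (wdeg r) * q r - (\<Sum>y\<in>cls. real (arcs r y) * q y)"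
        using wdeg_tail[of r] sum_arcs[where x=r and f=q] \<open>r \<in> cls\<close> by (simp add: sum_subtractf cls_def)
      also have "(\<Sum>y\<in>cls. real (arcs r y) * q y) = (\<Sum>y\<in>R. real (arcs r y) * q y)"
        unfolding R_def using finite_cls \<rho> q\<rho> by (subst sum.remove[of cls \<rho>]) auto
      also have "\<dots> = (\<Sum>y<n. real (arcs (g m) (g y)) * q (g y))" using re[of "\<lambda>y. real (arcs r y) * q y"] m by simp
      also have "real (wdeg r) * q r - \<dots> = (\<Sum>y<n. a m y * q (g y))" using a_sum[OF m(1), of "\<lambda>y. q (g y)"] m(2) by simp
      also have "\<dots> = (\<Sum>y<n. A $$ (m, y) * vec_index x y)"
        using m(1) by (intro sum.cong refl) (simp add: A_def qg)
      also have "\<dots> = vec_index (A *\<^sub>v x) m"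
        using A x(1) m(1) by (simp add: scalar_prod_def atLeast0LessThan)
      also have "\<dots> = 0" using x(3) m(1) by simp
      finally show "(\<Sum>Z\<in>{Z \<in> B. tail Z = r}. q r - q (head Z)) = 0" .
    qed
    have "x = 0\<^sub>v n"
    proof (rule eq_vecI)
      fix m assume "m < dim_vec (0\<^sub>v n)"
      then show "vec_index x m = vec_index (0\<^sub>v n) m" using qg[of m] q0 gc(1)[of m] by simp
    qed (use x(1) in simp)
    with x(2) show False by simp
  qed
  then show "Determinant.det (laplacian_mat g n) \<noteq> 0" using det_eq by simp
qed

text \<open>Modulo the relations, a root \<open>\<rho>\<close> and a vertex \<open>c\<close> of a second colour, the vertices of one colour
  generate the free abelian group, subject to the rows of the Laplacian. The homomorphisms to \<open>\<int>\<close>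
  that are \<open>1\<close>, \<open>- 1\<close> and \<open>0\<close> on the colours show that no torsion is lost.\<close>

lemma torsion_representatives:
  fixes N :: "('v \<Rightarrow>\<^sub>0 int) set"
  assumes N: "diff_closed N"
    and rel: "\<And>Z. Z \<in> W \<Longrightarrow> (\<Sum>v\<in>Z. frag_of v) \<in> N"
    and van: "\<And>x \<omega>. x \<in> N \<Longrightarrow> (\<And>Z. Z \<in> W \<Longrightarrow> (\<Sum>v\<in>Z. \<omega> v) = 0) \<Longrightarrow> frag_pairing V \<omega> x = 0"
    and \<rho>: "\<rho> \<in> cls" and g: "bij_betw g {..<n} (cls - {\<rho>})"
  obtains R :: "(nat \<Rightarrow> int) set" and \<phi> where "finite R" "card R \<le> nat \<bar>Determinant.det (laplacian_mat g n)\<bar>"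
    "\<forall>u. Poly_Mapping.keys u \<subseteq> V \<longrightarrow> \<phi> u \<in> R"
    "\<forall>u v m. Poly_Mapping.keys u \<subseteq> V \<longrightarrow> Poly_Mapping.keys v \<subseteq> V \<longrightarrow> \<phi> u = \<phi> v \<longrightarrow> m \<noteq> 0 \<longrightarrow>
       frag_cmul m (u - v) \<in> N \<longrightarrow> u - v \<in> N"
proof -
  let ?M = "laplacian_mat g n"
  have M: "?M \<in> carrier_mat n n" by (simp add: laplacian_mat_def)
  obtain R where R: "finite R" "card R \<le> nat \<bar>Determinant.det ?M\<bar>"
    "\<forall>c. \<exists>r\<in>R. \<exists>y. \<forall>j<n. c j = r j + (\<Sum>i<n. y i * ?M $$ (i, j))"
    using int_lattice_representatives[OF M laplacian_det(1)[OF \<rho> g]] by blast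
  note Nd = diff_closedD[OF N]
  have "B \<noteq> {}" using card_W card_W_eq_B by auto
  then obtain Z0 where Z0: "Z0 \<in> B" by blast
  define c0 where "c0 = pt j Z0"
  have c0: "col c0 = j" "c0 \<in> V" using pt[of Z0 j] Z0 triples by (auto simp: c0_def)
  \<comment> \<open>Adding the root and \<open>c0\<close> to N accounts for the two free
    summands.\<close>
  define K where "K = {x. \<exists>y\<in>N. \<exists>\<alpha> \<gamma>. x = y + frag_cmul \<alpha> (frag_of \<rho>) + frag_cmul \<gamma> (frag_of c0)}"
  have NK: "x \<in> K" if "x \<in> N" for x
    unfolding K_def using that by (intro CollectI bexI[of _ x] exI[of _ 0]) simp_all
  have \<rho>K: "frag_of \<rho> \<in> K"
    unfolding K_def using Nd(1) by (intro CollectI bexI[of _ 0] exI[of _ 1] exI[of _ 0]) simp_all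
  have c0K: "frag_of c0 \<in> K"
    unfolding K_def using Nd(1) by (intro CollectI bexI[of _ 0] exI[of _ 0] exI[of _ 1]) simp_all
  have Kc: "diff_closed K"
    unfolding diff_closed_def
  proof (intro conjI ballI)
    show "0 \<in> K" using NK Nd(1) .
    fix x y assume "x \<in> K" "y \<in> K"
    then obtain x' \<alpha> \<gamma> y' \<alpha>' \<gamma>' where xy: "x' \<in> N" "x = x' + frag_cmul \<alpha> (frag_of \<rho>) + frag_cmul \<gamma> (frag_of c0)"
      "y' \<in> N" "y = y' + frag_cmul \<alpha>' (frag_of \<rho>) + frag_cmul \<gamma>' (frag_of c0)" unfolding K_def by blast
    have "x - y = (x' - y') + frag_cmul (\<alpha> - \<alpha>') (frag_of \<rho>) + frag_cmul (\<gamma> - \<gamma>') (frag_of c0)"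
      unfolding xy(2,4) by (simp add: frag_cmul_diff_distrib)
    then show "x - y \<in> K" unfolding K_def using Nd(2)[OF xy(1,3)] by blast
  qed
  note Kd = diff_closedD[OF Kc]
  define L where "L = (\<lambda>c. \<Sum>m<n. frag_cmul (c m) (frag_of (g m)))"
  have L_diff: "L (\<lambda>m. c m - c' m) = L c - L c'" for c c' by (simp add: L_def frag_cmul_diff_distrib sum_subtractf)
  \<comment> \<open>\<open>Q x\<close>: modulo K, x is an integer combination of vertices of the
    contracted class other than the root.\<close>
  define Q where "Q x \<longleftrightarrow> (\<exists>c. x - L c \<in> K)" for x
  have L0: "L (\<lambda>_. 0) = 0" by (simp add: L_def)
  have QK: "Q x" if "x \<in> K" for x unfolding Q_def using that L0 by (intro exI[of _ "\<lambda>_. 0"]) simp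
  have Qdiff: "Q (x - y)" if xy: "Q x" "Q y" for x y
  proof -
    obtain c c' where "x - L c \<in> K" "y - L c' \<in> K" using xy unfolding Q_def by blast
    then have "(x - L c) - (y - L c') \<in> K" by (rule Kd(2))
    then have "(x - y) - L (\<lambda>m. c m - c' m) \<in> K" by (simp add: L_diff algebra_simps)
    then show ?thesis by (auto simp: Q_def)
  qed
  have Qc: "diff_closed (Collect Q)" using Qdiff QK[OF Kd(1)] by (simp add: diff_closed_def)
  note Qd = diff_closedD[OF Qc, simplified]
  have Qcls: "Q (frag_of r)" if "r \<in> cls" for r
  proof (cases "r = \<rho>")
    case False
    then have "r \<in> g ` {..<n}" using g that by (simp add: bij_betw_def)
    then obtain m where m: "m < n" "r = g m" by auto
    have "L (\<lambda>k. if k = m then 1 else 0) = frag_of r"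
      using m by (simp add: L_def if_distrib[of "\<lambda>k. frag_cmul k _"] cong: if_cong)
    then show ?thesis unfolding Q_def using Kd(1) by (intro exI[of _ "\<lambda>k. if k = m then 1 else 0"]) simp
  qed (use QK \<rho>K in simp)
  \<comment> \<open>In the relation of a white triple the vertex of colour \<open>i\<close> already
    satisfies Q, so the other two satisfy it together or not at all.\<close>
  have QW: "Q (frag_of (pt j Z)) \<longleftrightarrow> Q (frag_of (pt l Z))" if "Z \<in> W" for Z
  proof -
    have "pt i Z \<in> cls" using pt[of Z i] that triples by (auto simp: cls_def)
    then have "Q (frag_of (pt i Z))" by (rule Qcls)
    moreover have "Q (frag_of (pt i Z) + (frag_of (pt j Z) + frag_of (pt l Z)))"
      using QK[OF NK[OF rel[OF that]]] sum_triple[of Z frag_of] that by simp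
    ultimately have jl: "Q (frag_of (pt j Z) + frag_of (pt l Z))"
      using Qdiff by fastforce
    show ?thesis using Qdiff[OF jl, of "frag_of (pt j Z)"] Qdiff[OF jl, of "frag_of (pt l Z)"] by auto
  qed
  have QWB: "Q (frag_of (pt j Z)) \<longleftrightarrow> Q (frag_of (pt l Z))" if "Z \<in> W \<union> B" for Z
    using that QW[of Z] QW[of "opp Z"] opp[of Z] by auto
  \<comment> \<open>From \<open>c0\<close> the property spreads everywhere, since two triples with a
    common pair share a vertex of colour \<open>j\<close> or \<open>l\<close>.\<close>
  have "{Z \<in> W \<union> B. Q (frag_of (pt j Z))} = W \<union> B"
  proof (rule connected)
    have "Q (frag_of (pt j Z0))" using QK[OF c0K] by (simp add: c0_def)
    then show "{Z \<in> W \<union> B. Q (frag_of (pt j Z))} \<noteq> {}" using Z0 by blast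
  next
    fix Z Y a b
    assume Z: "Z \<in> {Z \<in> W \<union> B. Q (frag_of (pt j Z))}" and Y: "Y \<in> W \<union> B" and ab: "a \<noteq> b" "{a, b} \<subseteq> Z" "{a, b} \<subseteq> Y"
    have "col a \<noteq> col b" using inj_onD[OF inj_col[OF Y], of a b] ab by auto
    then obtain e where e: "e \<in> Z" "e \<in> Y" "col e \<noteq> i" using ab by (cases "col a = i") auto
    then have "col e = j \<or> col e = l" using col_triple[OF Y] by blast
    then have "Q (frag_of (pt j Y))"
    proof
      assume "col e = j"
      then show ?thesis using Z pt_eqI[of Z e j] pt_eqI[OF Y e(2), of j] e(1) by auto
    next
      assume "col e = l"
      then have "pt l Z = e" "pt l Y = e" using Z pt_eqI[of Z e l] pt_eqI[OF Y e(2), of l] e(1) by auto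
      then show ?thesis using Z QWB[of Z] QWB[OF Y] by auto
    qed
    then show "Y \<in> {Z \<in> W \<union> B. Q (frag_of (pt j Z))}" using Y by simp
  qed blast
  then have Qj: "Q (frag_of (pt j Z))" if "Z \<in> W \<union> B" for Z using that by blast
  have QV: "Q (frag_of v)" if v: "v \<in> V" for v
  proof -
    obtain Z where Z: "Z \<in> W \<union> B" "v \<in> Z" using in_triple[OF v] by blast
    then have "col v = i \<or> col v = j \<or> col v = l" using col_triple by blast
    then show ?thesis
    proof (elim disjE)
      assume "col v = i"
      then show ?thesis using Qcls v by (simp add: cls_def)
    next
      assume "col v = j"
      then show ?thesis using Qj[OF Z(1)] pt_eqI[OF Z] by simp
    next
      assume "col v = l"
      then show ?thesis using Qj[OF Z(1)] QWB[OF Z(1)] pt_eqI[OF Z] by simp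
    qed
  qed
  have Qall: "Q u" if "Poly_Mapping.keys u \<subseteq> V" for u
    using that
  proof (induction u rule: frag_induction)
    case zero
    then show ?case using Qd(1) .
  next
    case (one x)
    then show ?case using QV by simp
  next
    case (diff a b)
    then show ?case using Qdiff by blast
  qed
  have row: "(\<Sum>y<n. frag_cmul (laplacian g m y) (frag_of (g y))) \<in> K" if m: "m < n" for m
  proof -
    let ?r = "g m"
    have r: "?r \<in> cls" "?r \<noteq> \<rho>" "col ?r = i" using g m by (auto simp: bij_betw_def cls_def)
    have heads: "(\<Sum>Z\<in>{Z \<in> B. tail Z = ?r}. frag_of (head Z)) = (\<Sum>y\<in>cls. frag_cmul (int (arcs ?r y)) (frag_of y))"
    proof -
      have "(\<Sum>y\<in>cls. frag_cmul (int (arcs ?r y)) (frag_of y)) =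
          (\<Sum>y\<in>cls. \<Sum>Z\<in>{Z \<in> {Z \<in> B. tail Z = ?r}. head Z = y}. frag_of (head Z))"
      proof (rule sum.cong[OF refl])
        fix y
        have "{Z \<in> {Z \<in> B. tail Z = ?r}. head Z = y} = {Z \<in> B. tail Z = ?r \<and> head Z = y}" by blast
        then have "(\<Sum>Z\<in>{Z \<in> {Z \<in> B. tail Z = ?r}. head Z = y}. frag_of (head Z)) = (\<Sum>Z\<in>{Z \<in> B. tail Z = ?r \<and> head Z = y}. frag_of y)"
          by (intro sum.cong) auto
        then show "frag_cmul (int (arcs ?r y)) (frag_of y) = (\<Sum>Z\<in>{Z \<in> {Z \<in> B. tail Z = ?r}. head Z = y}. frag_of (head Z))"
          by (simp add: sum_const_frag arcs_def)
      qed
      also have "\<dots> = (\<Sum>Z\<in>{Z \<in> B. tail Z = ?r}. frag_of (head Z))"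
        using finite_triples finite_cls col_tail tail_in_V by (intro sum.group) (auto simp: cls_def)
      finally show ?thesis by simp
    qed
    have "(\<Sum>Z\<in>{Z \<in> B. tail Z = ?r}. frag_of ?r - frag_of (head Z)) \<in> N"
      unfolding firing_relation[OF r(3), of frag_of]
      by (rule Nd(2)[OF diff_closed_sum[OF N] diff_closed_sum[OF N]]) (use rel opp(1) in auto)
    also have "(\<Sum>Z\<in>{Z \<in> B. tail Z = ?r}. frag_of ?r - frag_of (head Z)) =
        frag_cmul (int (wdeg ?r)) (frag_of ?r) - (\<Sum>y\<in>cls. frag_cmul (int (arcs ?r y)) (frag_of y))"
      by (simp add: sum_subtractf heads sum_const_frag wdeg_tail[OF r(3)])
    also have "(\<Sum>y\<in>cls. frag_cmul (int (arcs ?r y)) (frag_of y)) =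
        frag_cmul (int (arcs ?r \<rho>)) (frag_of \<rho>) + (\<Sum>y\<in>cls - {\<rho>}. frag_cmul (int (arcs ?r y)) (frag_of y))"
      using finite_cls \<rho> by (rule sum.remove)
    also have "(\<Sum>y\<in>cls - {\<rho>}. frag_cmul (int (arcs ?r y)) (frag_of y)) = (\<Sum>y<n. frag_cmul (int (arcs ?r (g y))) (frag_of (g y)))"
      by (rule sum.reindex_bij_betw[OF g, symmetric])
    finally have mem: "frag_cmul (int (wdeg ?r)) (frag_of ?r) - (frag_cmul (int (arcs ?r \<rho>)) (frag_of \<rho>) + (\<Sum>y<n. frag_cmul (int (arcs ?r (g y))) (frag_of (g y)))) \<in> K"
      by (rule NK)
    have "(\<Sum>y<n. frag_cmul (laplacian g m y) (frag_of (g y))) =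
        (\<Sum>y<n. (if m = y then frag_cmul (int (wdeg ?r)) (frag_of (g y)) else 0) - frag_cmul (int (arcs ?r (g y))) (frag_of (g y)))"
      by (intro sum.cong refl) (auto simp: laplacian_def frag_cmul_diff_distrib)
    also have "\<dots> = frag_cmul (int (wdeg ?r)) (frag_of ?r) - (\<Sum>y<n. frag_cmul (int (arcs ?r (g y))) (frag_of (g y)))"
      using m by (simp add: sum_subtractf)
    also have "\<dots> = (frag_cmul (int (wdeg ?r)) (frag_of ?r) - (frag_cmul (int (arcs ?r \<rho>)) (frag_of \<rho>) + (\<Sum>y<n. frag_cmul (int (arcs ?r (g y))) (frag_of (g y)))))
        + frag_cmul (int (arcs ?r \<rho>)) (frag_of \<rho>)" by (simp add: algebra_simps)
    also have "\<dots> \<in> K" using mem diff_closed_frag_cmul[OF Kc \<rho>K] by (rule Kd(4))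
    finally show ?thesis .
  qed
  \<comment> \<open>The coefficient vector may be changed by rows of the Laplacian, which lie in K
    by \<open>row\<close>, until it is one of the representatives.\<close>
  have "\<exists>r\<in>R. u - L r \<in> K" if u: "Poly_Mapping.keys u \<subseteq> V" for u
  proof -
    obtain c where c: "u - L c \<in> K" using Qall[OF u] by (auto simp: Q_def)
    obtain r y where ry: "r \<in> R" "\<forall>k<n. c k = r k + (\<Sum>m<n. y m * ?M $$ (m, k))" using R(3) by blast
    have "L c - L r = L (\<lambda>k. c k - r k)" by (simp add: L_diff)
    also have "\<dots> = (\<Sum>k<n. \<Sum>m<n. frag_cmul (y m * laplacian g m k) (frag_of (g k)))"
    proof -
      have "frag_cmul (c k - r k) (frag_of (g k)) = (\<Sum>m<n. frag_cmul (y m * laplacian g m k) (frag_of (g k)))" if "k < n" for k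
      proof -
        have "c k - r k = (\<Sum>m<n. y m * laplacian g m k)" using ry(2) that by (simp add: laplacian_mat_def)
        moreover have "frag_cmul (\<Sum>m\<in>S. h m) x = (\<Sum>m\<in>S. frag_cmul (h m) x)" for S :: "nat set" and h and x :: "'v \<Rightarrow>\<^sub>0 int"
          by (induction S rule: infinite_finite_induct) (auto simp: frag_cmul_distrib)
        ultimately show ?thesis by simp
      qed
      then show ?thesis unfolding L_def by (intro sum.cong) auto
    qed
    also have "\<dots> = (\<Sum>m<n. \<Sum>k<n. frag_cmul (y m * laplacian g m k) (frag_of (g k)))" by (rule sum.swap)
    also have "\<dots> = (\<Sum>m<n. frag_cmul (y m) (\<Sum>k<n. frag_cmul (laplacian g m k) (frag_of (g k))))"
      by (simp add: frag_cmul_sum)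
    also have "\<dots> \<in> K" by (rule diff_closed_sum[OF Kc], rule diff_closed_frag_cmul[OF Kc], rule row) simp
    finally have "(u - L c) + (L c - L r) \<in> K" using c by (intro Kd(4))
    then show ?thesis using ry(1) by (intro bexI[of _ r]) simp_all
  qed
  then have "\<forall>u. \<exists>r. Poly_Mapping.keys u \<subseteq> V \<longrightarrow> r \<in> R \<and> u - L r \<in> K" by blast
  then obtain \<phi> where "\<forall>u. Poly_Mapping.keys u \<subseteq> V \<longrightarrow> \<phi> u \<in> R \<and> u - L (\<phi> u) \<in> K" by (rule choice[THEN exE])
  then have \<phi>: "\<phi> u \<in> R" "u - L (\<phi> u) \<in> K" if "Poly_Mapping.keys u \<subseteq> V" for u using that by blast+
  have "u - v \<in> N" if uv: "Poly_Mapping.keys u \<subseteq> V" "Poly_Mapping.keys v \<subseteq> V" "\<phi> u = \<phi> v" "m \<noteq> 0" "frag_cmul m (u - v) \<in> N" for u v m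
  proof -
    have "(u - L (\<phi> u)) - (v - L (\<phi> v)) \<in> K" by (rule Kd(2)[OF \<phi>(2)[OF uv(1)] \<phi>(2)[OF uv(2)]])
    then have "u - v \<in> K" using uv(3) by simp
    then obtain y \<alpha> \<gamma> where y: "y \<in> N" "u - v = y + frag_cmul \<alpha> (frag_of \<rho>) + frag_cmul \<gamma> (frag_of c0)"
      unfolding K_def by blast
    \<comment> \<open>The pairing with \<open>\<omega>\<close> vanishes on N, and the factor m
      cancels in the integers, so only the multiples of the root and of \<open>c0\<close>
      remain.\<close>
    have zero: "\<alpha> * \<omega> \<rho> + \<gamma> * \<omega> c0 = 0" if \<omega>: "\<And>Z. Z \<in> W \<Longrightarrow> (\<Sum>v\<in>Z. \<omega> v) = 0" for \<omega>
    proof -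
      have "m * frag_pairing V \<omega> (u - v) = 0"
        using van[OF uv(5) \<omega>] by (simp add: frag_pairing_cmul)
      then have "frag_pairing V \<omega> (u - v) = 0" using uv(4) by simp
      moreover have "frag_pairing V \<omega> y = 0" using van[OF y(1) \<omega>] .
      moreover have "\<rho> \<in> V" using \<rho> by (simp add: cls_def)
      ultimately show ?thesis unfolding y(2)
        using finite_V c0(2) by (simp add: frag_pairing_add frag_pairing_cmul frag_pairing_of)
    qed
    have c\<rho>: "col \<rho> = i" using \<rho> by (simp add: cls_def)
    \<comment> \<open>Weights depending only on the colour, with sum 0 on every triple: (1, -1, 0)
      and (0, 1, -1) suffice for the root of colour \<open>i\<close> and \<open>c0\<close> of colour
      \<open>j\<close>.\<close>
    define \<omega> where "\<omega> = (\<lambda>s t u v. if col v = i then s else if col v = j then t else (u::int))"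
    have \<omega>W: "(\<Sum>v\<in>Z. \<omega> s t u v) = s + (t + u)" if "Z \<in> W" for Z s t u
      using sum_triple[of Z "\<omega> s t u"] pt(2)[of Z] that distinct_colours by (simp add: \<omega>_def)
    have "\<alpha> * 1 + \<gamma> * (- 1) = 0" using zero[of "\<omega> 1 (- 1) 0"] \<omega>W c\<rho> c0(1) distinct_colours by (simp add: \<omega>_def)
    moreover have "\<alpha> * 0 + \<gamma> * 1 = 0" using zero[of "\<omega> 0 1 (- 1)"] \<omega>W c\<rho> c0(1) distinct_colours by (simp add: \<omega>_def)
    ultimately have "\<alpha> = 0" "\<gamma> = 0" by auto
    then show ?thesis using y by simp
  qed
  then show ?thesis using that[OF R(1,2), of \<phi>] \<phi>(1) by blast
qed

end

section \<open>Faces and edges of a triangulation\<close>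

lemma closure_finite_Union: "finite \<A> \<Longrightarrow> closure (\<Union>\<A>) = \<Union>(closure ` \<A>)"
  by (induction rule: finite_induct) auto

lemma arc_graph_drawing: "graph_on_sphere T \<longleftrightarrow> arc_graph (verts T) (edges T)"
  by (simp add: graph_on_sphere_def arc_graph_def)

lemma openin_face:
  assumes "graph_on_sphere T" "F \<in> faces T"
  shows "openin (top_of_set S2) F"
proof -
  have "openin (top_of_set S2) (S2 - (verts T \<union> \<Union>(edges T)))"
    using assms(1) arc_graph_complement_open arc_graph_drawing by blast
  then show ?thesis using assms(2) openin_S2_component by (auto simp: faces_def components_def)
qed

lemma bdry_eq: "openin (top_of_set S2) F \<Longrightarrow> bdry F = closure F - F"
proof -
  assume F: "openin (top_of_set S2) F"
  then have "F \<subseteq> S2" by (rule openin_imp_subset)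
  then have "closure F \<subseteq> S2" by (rule closure_minimal) simp
  moreover have "top_of_set S2 closure_of F = S2 \<inter> closure F"
    using \<open>F \<subseteq> S2\<close> by (simp add: closure_of_subtopology Int_absorb1)
  ultimately show ?thesis
    unfolding bdry_def frontier_of_def using F by (auto simp: interior_of_openin)
qed

lemma edge_path_component:
  assumes "graph_on_sphere T" "f \<in> edges T" "f \<inter> verts T = {a, b}" "f \<subseteq> Z"
  shows "path_component Z a b"
proof -
  obtain g where g: "arc g" "path_image g = f" "f \<inter> verts T = {pathstart g, pathfinish g}"
    "pathstart g \<noteq> pathfinish g" "compact f" "f \<subseteq> S2"
    using assms(1)[unfolded arc_graph_drawing] assms(2) by (rule arc_graphE)
  then have "path_component Z (pathstart g) (pathfinish g)"
    unfolding path_component_def using assms(4) arc_imp_path by blast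
  moreover have "{a, b} = {pathstart g, pathfinish g}" using g(3) assms(3) by simp
  ultimately show ?thesis using path_component_sym by (metis doubleton_eq_iff)
qed

locale drawing =
  fixes T :: coloured_drawing
  assumes tri: "face_2_coloured_triangulation T" and simple: "simple_drawing T"
    and fin: "finite (white T)" "finite (black T)" and two: "2 \<le> card (white T)"
    and card_eq: "card (black T) = card (white T)"
begin

abbreviation "graph_set \<equiv> verts T \<union> \<Union>(edges T)"

lemma graph: "graph_on_sphere T"
  using tri by (simp add: face_2_coloured_triangulation_def)

lemma arcs: "arc_graph (verts T) (edges T)"
  using graph arc_graph_drawing by blast

lemma triangular: "F \<in> faces T \<Longrightarrow> triangular_face T F"
  using tri by (simp add: face_2_coloured_triangulation_def)

lemma faces_eq: "faces T = white T \<union> black T" and disjoint: "white T \<inter> black T = {}"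
  using tri by (auto simp: face_2_coloured_triangulation_def)

lemma opposite: "F \<in> faces T \<Longrightarrow> G \<in> faces T \<Longrightarrow> F \<noteq> G \<Longrightarrow> share_edge T F G \<Longrightarrow> F \<in> white T \<longleftrightarrow> G \<in> black T"
  using tri by (simp add: face_2_coloured_triangulation_def)

lemma finite_faces: "finite (faces T)"
  using fin faces_eq by simp

lemma faceD:
  assumes "F \<in> faces T"
  shows "openin (top_of_set S2) F" "F \<subseteq> S2 - graph_set" "F \<noteq> {}" "connected F" "bdry F = closure F - F"
proof -
  show op: "openin (top_of_set S2) F" using openin_face[OF graph assms] .
  show "F \<subseteq> S2 - graph_set" "F \<noteq> {}" "connected F"
    using assms in_components_subset in_components_nonempty in_components_connected unfolding faces_def by blast+
  show "bdry F = closure F - F" using bdry_eq[OF op] .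
qed

lemma edge_interior_point:
  assumes "e \<in> edges T"
  shows "\<exists>p\<in>e. p \<notin> verts T"
proof -
  obtain g where g: "arc g" "path_image g = e" "e \<inter> verts T = {pathstart g, pathfinish g}"
    "pathstart g \<noteq> pathfinish g" "compact e" "e \<subseteq> S2"
    using arcs assms by (rule arc_graphE)
  have "connected e" using g(1,2) arc_imp_path connected_path_image by blast
  then have "infinite e" using connected_finite_iff_sing[of e] g(2,4) pathstart_in_path_image pathfinish_in_path_image
    by (metis empty_iff singletonD)
  then have "\<not> e \<subseteq> e \<inter> verts T" unfolding g(3) using finite_subset by blast
  then show ?thesis by blast
qed

lemma ends:
  assumes "e \<in> edges T"
  obtains a b where "e \<inter> verts T = {a, b}" "a \<noteq> b"
  using arcs assms by (rule arc_graphE)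

text \<open>The graph has dense complement, so p is a limit of points of A inside faces; as there
  are finitely many faces, one of them has p in its closure.\<close>

lemma face_near:
  assumes "openin (top_of_set S2) A" "p \<in> closure A" "p \<in> graph_set"
  shows "\<exists>F\<in>faces T. p \<in> bdry F \<and> F \<inter> A \<noteq> {}"
proof -
  have "A \<subseteq> S2" using assms(1) by (rule openin_imp_subset)
  have "p \<in> closure (A - graph_set)"
  proof (rule ccontr)
    assume n: "p \<notin> closure (A - graph_set)"
    define U where "U = A \<inter> - closure (A - graph_set)"
    have "openin (top_of_set S2) U" unfolding U_def using assms(1) by (intro openin_Int_open) auto
    moreover have "- closure (A - graph_set) \<inter> A \<noteq> {}"
      using open_Int_closure_eq_empty[of "- closure (A - graph_set)" A] assms(2) n by blast
    then have "U \<noteq> {}" unfolding U_def by blast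
    ultimately have "U - graph_set \<noteq> {}" using arc_graph_dense[OF arcs] by blast
    then show False unfolding U_def using closure_subset[of "A - graph_set"] by blast
  qed
  moreover have "A - graph_set \<subseteq> \<Union>{F \<in> faces T. F \<inter> A \<noteq> {}}"
  proof
    fix x assume x: "x \<in> A - graph_set"
    then have "x \<in> S2 - graph_set" using \<open>A \<subseteq> S2\<close> by blast
    then obtain F where "F \<in> faces T" "x \<in> F" unfolding faces_def using Union_components[of "S2 - graph_set"] by blast
    with x show "x \<in> \<Union>{F \<in> faces T. F \<inter> A \<noteq> {}}" by blast
  qed
  ultimately have "p \<in> closure (\<Union>{F \<in> faces T. F \<inter> A \<noteq> {}})" using closure_mono by blast
  moreover have "finite {F \<in> faces T. F \<inter> A \<noteq> {}}" using finite_faces by simp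
  ultimately have "p \<in> \<Union>(closure ` {F \<in> faces T. F \<inter> A \<noteq> {}})" by (simp only: closure_finite_Union)
  then obtain F where F: "F \<in> faces T" "F \<inter> A \<noteq> {}" "p \<in> closure F" by blast
  moreover have "p \<notin> F" using faceD(2)[OF F(1)] assms(3) by blast
  ultimately show ?thesis using faceD(5)[OF F(1)] by blast
qed

lemma graph_in_S2: "graph_set \<subseteq> S2"
  using arcs by (auto simp: arc_graph_def)

lemma face_at:
  assumes "p \<in> graph_set"
  shows "\<exists>F\<in>faces T. p \<in> bdry F"
  using face_near[of S2 p] assms graph_in_S2 closure_subset[of S2] openin_subtopology_self by blast

lemma edge_inter: "e \<in> edges T \<Longrightarrow> f \<in> edges T \<Longrightarrow> p \<in> e \<Longrightarrow> p \<in> f \<Longrightarrow> p \<notin> verts T \<Longrightarrow> e = f"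
  using arcs unfolding arc_graph_def by blast

text \<open>Faces are bounded by whole edges, and an inner point of an edge lies on no other
  edge.\<close>

lemma edge_in_bdry:
  assumes "e \<in> edges T" "p \<in> e" "p \<notin> verts T" "F \<in> faces T" "p \<in> bdry F"
  shows "e \<subseteq> bdry F"
proof -
  obtain r c s e' f' g' where "e' \<in> edges T" "f' \<in> edges T" "g' \<in> edges T" "bdry F = e' \<union> f' \<union> g'"
    using triangular[OF assms(4)] unfolding triangular_face_def by blast
  then show ?thesis using assms edge_inter[OF assms(1)] by blast
qed

lemma triangle:
  assumes "F \<in> faces T"
  obtains r c s e f g where "e \<in> edges T" "f \<in> edges T" "g \<in> edges T" "r \<noteq> c" "c \<noteq> s" "r \<noteq> s"
    "e \<inter> verts T = {r, c}" "f \<inter> verts T = {c, s}" "g \<inter> verts T = {s, r}" "bdry F = e \<union> f \<union> g"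
  using triangular[OF assms] unfolding triangular_face_def by blast

lemma edges_of_bdry:
  assumes "e \<in> edges T" "f \<in> edges T" "g \<in> edges T" "bdry F = e \<union> f \<union> g" "h \<in> edges T" "h \<subseteq> bdry F"
  shows "h = e \<or> h = f \<or> h = g"
proof -
  obtain p where "p \<in> h" "p \<notin> verts T" using edge_interior_point[OF assms(5)] by blast
  then show ?thesis using assms edge_inter by blast
qed

text \<open>The other two edges of the triangle lead around \<open>h\<close>, which is what
  \<open>edge_separates\<close> requires.\<close>

lemma ends_joined:
  assumes F: "F \<in> faces T" and h: "h \<in> edges T" "h \<subseteq> bdry F" "h \<inter> verts T = {a, b}"
  shows "path_component (verts T \<union> \<Union>(edges T - {h})) a b"
proof -
  let ?Y = "verts T \<union> \<Union>(edges T - {h})"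
  obtain r c s e f g where t: "e \<in> edges T" "f \<in> edges T" "g \<in> edges T" "r \<noteq> c" "c \<noteq> s" "r \<noteq> s"
    "e \<inter> verts T = {r, c}" "f \<inter> verts T = {c, s}" "g \<inter> verts T = {s, r}" "bdry F = e \<union> f \<union> g"
    using F by (rule triangle)
  have ne: "e \<noteq> f" "f \<noteq> g" "e \<noteq> g" using t(4-9) by auto
  have pc: "path_component ?Y x y" if "k \<in> edges T" "k \<noteq> h" "k \<inter> verts T = {x, y}" for k x y
    using that by (intro edge_path_component[OF graph that(1,3)]) blast
  consider "h = e" | "h = f" | "h = g" using edges_of_bdry[OF t(1-3,10) h(1,2)] by blast
  then have "path_component ?Y r c \<and> {a, b} = {r, c} \<or> path_component ?Y c s \<and> {a, b} = {c, s}
    \<or> path_component ?Y s r \<and> {a, b} = {s, r}"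
  proof cases
    case 1
    have "path_component ?Y c s" "path_component ?Y s r" using pc[OF t(2) _ t(8)] pc[OF t(3) _ t(9)] ne 1 by auto
    note * = this
    then show ?thesis using path_component_sym[OF path_component_trans[OF *(1) *(2)]] h(3) t(7) 1 by simp
  next
    case 2
    have "path_component ?Y r c" "path_component ?Y s r" using pc[OF t(1) _ t(7)] pc[OF t(3) _ t(9)] ne 2 by auto
    note * = this
    then show ?thesis using path_component_sym[OF path_component_trans[OF *(2) *(1)]] h(3) t(8) 2 by simp
  next
    case 3
    have "path_component ?Y r c" "path_component ?Y c s" using pc[OF t(1) _ t(7)] pc[OF t(2) _ t(8)] ne 3 by auto
    note * = this
    then show ?thesis using path_component_sym[OF path_component_trans[OF *(1) *(2)]] h(3) t(9) 3 by simp
  qed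
  then show ?thesis by (elim disjE conjE) (auto simp: doubleton_eq_iff path_component_sym)
qed

text \<open>The edge e lies on a Jordan curve in the graph. A face approaching p from one side
  cannot be the face approaching it from the other, since faces are connected, and faces that share
  an edge have different colours.\<close>

lemma two_faces:
  assumes e: "e \<in> edges T"
  obtains F G where "F \<in> white T" "G \<in> black T" "e \<subseteq> bdry F" "e \<subseteq> bdry G"
proof -
  obtain p where p: "p \<in> e" "p \<notin> verts T" using edge_interior_point[OF e] by blast
  then have pX: "p \<in> graph_set" using e by blast
  obtain a b where ab: "e \<inter> verts T = {a, b}" "a \<noteq> b" using e by (rule ends)
  obtain H where H: "H \<in> faces T" "p \<in> bdry H" using face_at[OF pX] by blast
  have joined: "path_component (verts T \<union> \<Union>(edges T - {e})) a b"
    using ends_joined[OF H(1) e edge_in_bdry[OF e p H] ab(1)] .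
  have ins: "insert e (edges T - {e}) = edges T" using e by blast
  obtain I O' where IO: "openin (top_of_set S2) I" "openin (top_of_set S2) O'" "I \<inter> O' = {}"
    "S2 - graph_set \<subseteq> I \<union> O'" "e \<subseteq> closure I" "e \<subseteq> closure O'"
    using edge_separates[of "verts T" e "edges T - {e}", unfolded ins, OF arcs _ ab(1) joined] by blast
  obtain F where F: "F \<in> faces T" "p \<in> bdry F" "F \<inter> I \<noteq> {}" using face_near[OF IO(1) _ pX] IO(5) p(1) by blast
  obtain G where G: "G \<in> faces T" "p \<in> bdry G" "G \<inter> O' \<noteq> {}" using face_near[OF IO(2) _ pX] IO(6) p(1) by blast
  have "F \<noteq> G"
  proof
    assume "F = G"
    obtain I1 where I1: "open I1" "I = S2 \<inter> I1" using IO(1) by (auto simp: openin_open)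
    obtain O1 where O1: "open O1" "O' = S2 \<inter> O1" using IO(2) by (auto simp: openin_open)
    have sub: "F \<subseteq> S2 - graph_set" using faceD(2)[OF F(1)] .
    then have "F \<subseteq> I1 \<union> O1" "I1 \<inter> O1 \<inter> F = {}" using IO(3,4) I1(2) O1(2) by blast+
    moreover have "I1 \<inter> F \<noteq> {}" using F(3) I1(2) by blast
    moreover have "O1 \<inter> F \<noteq> {}" using G(3) O1(2) \<open>F = G\<close> by blast
    ultimately show False using connectedD[OF faceD(4)[OF F(1)] I1(1) O1(1)] by blast
  qed
  moreover have b: "e \<subseteq> bdry F" "e \<subseteq> bdry G" using edge_in_bdry[OF e p] F G by blast+
  ultimately have "F \<in> white T \<longleftrightarrow> G \<in> black T"
    using opposite[OF F(1) G(1)] e unfolding share_edge_def by blast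
  then show ?thesis using that b F(1) G(1) unfolding faces_eq by blast
qed

lemma face_edge_unique_colour:
  assumes "e \<in> edges T" "e \<subseteq> bdry F" "e \<subseteq> bdry G" "F \<in> white T \<and> G \<in> white T \<or> F \<in> black T \<and> G \<in> black T"
  shows "F = G"
proof (rule ccontr)
  assume "F \<noteq> G"
  then have "F \<in> white T \<longleftrightarrow> G \<in> black T" "G \<in> white T \<longleftrightarrow> F \<in> black T"
    using opposite[of F G] opposite[of G F] assms unfolding share_edge_def faces_eq by blast+
  then show False using assms(4) disjoint by blast
qed

lemma face_verts_pair:
  assumes "F \<in> faces T" "a \<noteq> b" "{a, b} \<subseteq> face_verts T F"
  obtains h where "h \<in> edges T" "h \<subseteq> bdry F" "h \<inter> verts T = {a, b}"
proof -
  obtain r c s e f g where t: "e \<in> edges T" "f \<in> edges T" "g \<in> edges T" "r \<noteq> c" "c \<noteq> s" "r \<noteq> s"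
    "e \<inter> verts T = {r, c}" "f \<inter> verts T = {c, s}" "g \<inter> verts T = {s, r}" "bdry F = e \<union> f \<union> g"
    using assms(1) by (rule triangle)
  have "face_verts T F = {r, c, s}" unfolding face_verts_def t(10) using t(7-9) by blast
  then have "{a, b} = {r, c} \<or> {a, b} = {c, s} \<or> {a, b} = {s, r}" using assms(2,3) by auto
  then show ?thesis
  proof (elim disjE)
    assume "{a, b} = {r, c}"
    then show ?thesis using t(7,10) by (intro that[OF t(1)]) auto
  next
    assume "{a, b} = {c, s}"
    then show ?thesis using t(8,10) by (intro that[OF t(2)]) auto
  next
    assume "{a, b} = {s, r}"
    then show ?thesis using t(9,10) by (intro that[OF t(3)]) auto
  qed
qed

lemma face_verts_card:
  assumes "F \<in> faces T"
  shows "card (face_verts T F) = 3" "card {e \<in> edges T. e \<subseteq> bdry F} = 3"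
proof -
  obtain r c s e f g where t: "e \<in> edges T" "f \<in> edges T" "g \<in> edges T" "r \<noteq> c" "c \<noteq> s" "r \<noteq> s"
    "e \<inter> verts T = {r, c}" "f \<inter> verts T = {c, s}" "g \<inter> verts T = {s, r}" "bdry F = e \<union> f \<union> g"
    using assms by (rule triangle)
  have "face_verts T F = {r, c, s}" unfolding face_verts_def t(10) using t(7-9) by blast
  then show "card (face_verts T F) = 3" using t(4-6) by simp
  have "{e \<in> edges T. e \<subseteq> bdry F} = {e, f, g}"
    using edges_of_bdry[OF t(1-3,10)] t(1-3,10) by blast
  moreover have "e \<noteq> f" "f \<noteq> g" "e \<noteq> g" using t(4-9) by auto
  ultimately show "card {e \<in> edges T. e \<subseteq> bdry F} = 3" by simp
qed

lemma edge_ends_face_verts: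
  assumes "h \<subseteq> bdry F" "h \<inter> verts T = {a, b}"
  shows "{a, b} \<subseteq> face_verts T F"
  unfolding face_verts_def using assms by blast

text \<open>This is where simplicity enters: a pair of vertices determines the edge, so faces can be
  replaced by triples of vertices.\<close>

lemma same_pair_same_edge:
  assumes "F \<in> faces T" "G \<in> faces T" "a \<noteq> b" "{a, b} \<subseteq> face_verts T F" "{a, b} \<subseteq> face_verts T G"
  obtains h where "h \<in> edges T" "h \<subseteq> bdry F" "h \<subseteq> bdry G" "h \<inter> verts T = {a, b}"
proof -
  obtain h where h: "h \<in> edges T" "h \<subseteq> bdry F" "h \<inter> verts T = {a, b}" using assms(1,3,4) by (rule face_verts_pair)
  obtain k where k: "k \<in> edges T" "k \<subseteq> bdry G" "k \<inter> verts T = {a, b}" using assms(2,3,5) by (rule face_verts_pair)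
  have "h = k" using simple[unfolded simple_drawing_def, rule_format, OF h(1) k(1)] h(3) k(3) by simp
  with k(2) show ?thesis using that[OF h(1,2) _ h(3)] by simp
qed

lemma same_pair_same_face:
  assumes "F \<in> white T \<and> G \<in> white T \<or> F \<in> black T \<and> G \<in> black T"
    "a \<noteq> b" "{a, b} \<subseteq> face_verts T F" "{a, b} \<subseteq> face_verts T G"
  shows "F = G"
proof -
  have "F \<in> faces T" "G \<in> faces T" using assms(1) faces_eq by blast+
  then obtain h where h: "h \<in> edges T" "h \<subseteq> bdry F" "h \<subseteq> bdry G" "h \<inter> verts T = {a, b}"
    using assms(2-4) by (rule same_pair_same_edge)
  show ?thesis using face_edge_unique_colour[OF h(1-3) assms(1)] .
qed

lemma inj_face_verts: "inj_on (face_verts T) (white T)"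
proof (rule inj_onI)
  fix F G assume FG: "F \<in> white T" "G \<in> white T" "face_verts T F = face_verts T G"
  then have "card (face_verts T F) = 3" using face_verts_card faces_eq by blast
  then obtain a b c where abc: "face_verts T F = {a, b, c}" "a \<noteq> b"
    by (auto simp: card_3_iff)
  then have "{a, b} \<subseteq> face_verts T F" "{a, b} \<subseteq> face_verts T G" using FG(3) by auto
  then show "F = G" using same_pair_same_face[OF _ abc(2)] FG(1,2) by blast
qed

text \<open>The sphere without the vertices is connected and is covered by the closed sets P and Q,
  the closures of the faces in S and of the others. A common point of P and Q would be an inner
  point of an edge on the boundary of faces of both kinds.\<close>

lemma faces_connected:
  assumes "S \<subseteq> face_verts T ` faces T" "S \<noteq> {}"
    "\<And>Z Y a b. Z \<in> S \<Longrightarrow> Y \<in> face_verts T ` faces T \<Longrightarrow> a \<noteq> b \<Longrightarrow> {a, b} \<subseteq> Z \<Longrightarrow> {a, b} \<subseteq> Y \<Longrightarrow> Y \<in> S"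
  shows "S = face_verts T ` faces T"
proof (rule ccontr)
  assume "S \<noteq> face_verts T ` faces T"
  then obtain G0 where G0: "G0 \<in> faces T" "face_verts T G0 \<notin> S" using assms(1) by blast
  obtain F0 where F0: "F0 \<in> faces T" "face_verts T F0 \<in> S" using assms(1,2) by blast
  define P where "P = \<Union>(closure ` {F \<in> faces T. face_verts T F \<in> S})"
  define Q where "Q = \<Union>(closure ` {F \<in> faces T. face_verts T F \<notin> S})"
  have cl: "closed P" "closed Q" unfolding P_def Q_def using finite_faces by (auto intro!: closed_Union)
  have "finite (verts T)" using arcs by (simp add: arc_graph_def)
  then have conn: "connected (S2 - verts T)" by (rule connected_S2_minus_finite)
  have cov: "S2 - verts T \<subseteq> P \<union> Q"
  proof
    fix x assume x: "x \<in> S2 - verts T"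
    have "\<exists>F\<in>faces T. x \<in> closure F"
    proof (cases "x \<in> graph_set")
      case True
      then show ?thesis using face_at[OF True] faceD(5) by blast
    next
      case False
      then have "x \<in> S2 - graph_set" using x by blast
      then show ?thesis unfolding faces_def using Union_components[of "S2 - graph_set"] closure_subset by blast
    qed
    then show "x \<in> P \<union> Q" unfolding P_def Q_def by blast
  qed
  have "P \<inter> Q \<inter> (S2 - verts T) = {}"
  proof (rule ccontr)
    assume "P \<inter> Q \<inter> (S2 - verts T) \<noteq> {}"
    then obtain p F G where p: "p \<in> S2" "p \<notin> verts T" and F: "F \<in> faces T" "face_verts T F \<in> S" "p \<in> closure F"
      and G: "G \<in> faces T" "face_verts T G \<notin> S" "p \<in> closure G" unfolding P_def Q_def by blast
    \<comment> \<open>Off the graph, p would lie in one open face, which meets, and hence equals,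
      every face with p in its closure.\<close>
    have "p \<in> graph_set"
    proof (rule ccontr)
      assume "p \<notin> graph_set"
      then have "p \<in> S2 - graph_set" using p by blast
      then obtain H where H: "H \<in> faces T" "p \<in> H" unfolding faces_def using Union_components[of "S2 - graph_set"] by blast
      have "H = K" if K: "K \<in> faces T" "p \<in> closure K" for K
      proof -
        obtain U where U: "open U" "H = S2 \<inter> U" using faceD(1)[OF H(1)] by (auto simp: openin_open)
        then have "U \<inter> K \<noteq> {}" using open_Int_closure_eq_empty[OF U(1), of K] K(2) H(2) by blast
        then have "H \<inter> K \<noteq> {}" using U(2) faceD(2)[OF K(1)] by blast
        then show ?thesis using components_nonoverlap[of H "S2 - graph_set" K] H(1) K(1) unfolding faces_def by blast
      qed
      then show False using F G by blast
    qed
    then obtain e where e: "e \<in> edges T" "p \<in> e" using p(2) by blast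
    have "p \<in> bdry F" "p \<in> bdry G" using \<open>p \<in> graph_set\<close> F G faceD(2,5) by blast+
    then have b: "e \<subseteq> bdry F" "e \<subseteq> bdry G" using edge_in_bdry[OF e p(2)] F(1) G(1) by blast+
    obtain a b where ab: "e \<inter> verts T = {a, b}" "a \<noteq> b" using e(1) by (rule ends)
    have "face_verts T G \<in> S"
      using assms(3)[OF F(2) imageI[OF G(1)] ab(2)] edge_ends_face_verts[OF _ ab(1)] b by blast
    with G(2) show False by blast
  qed
  moreover have "F0 \<subseteq> P \<inter> (S2 - verts T)" using F0 faceD(2)[OF F0(1)] closure_subset unfolding P_def by blast
  then have "P \<inter> (S2 - verts T) \<noteq> {}" using faceD(3)[OF F0(1)] by blast
  moreover have "G0 \<subseteq> Q \<inter> (S2 - verts T)" using G0 faceD(2)[OF G0(1)] closure_subset unfolding Q_def by blast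
  then have "Q \<inter> (S2 - verts T) \<noteq> {}" using faceD(3)[OF G0(1)] by blast
  ultimately show False using conn cl cov unfolding connected_closed by blast
qed

lemma card_edges: "card (edges T) = 3 * card (white T)"
proof -
  have fin_e: "finite (edges T)" using arcs by (simp add: arc_graph_def)
  have "edges T = (\<Union>F\<in>white T. {e \<in> edges T. e \<subseteq> bdry F})"
  proof (intro equalityI subsetI)
    fix e assume e: "e \<in> edges T"
    then obtain F G where "F \<in> white T" "G \<in> black T" "e \<subseteq> bdry F" "e \<subseteq> bdry G" by (rule two_faces)
    with e show "e \<in> (\<Union>F\<in>white T. {e \<in> edges T. e \<subseteq> bdry F})" by blast
  qed blast
  also have "card \<dots> = (\<Sum>F\<in>white T. card {e \<in> edges T. e \<subseteq> bdry F})"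
    using fin fin_e face_edge_unique_colour by (intro card_UN_disjoint) auto
  also have "\<dots> = (\<Sum>F\<in>white T. 3)" using face_verts_card(2) faces_eq by (intro sum.cong) auto
  finally show ?thesis by simp
qed

lemma triple_system: "bicoloured_triples (verts T) (face_verts T ` white T) (face_verts T ` black T)"
proof
  have un: "face_verts T ` white T \<union> face_verts T ` black T = face_verts T ` faces T"
    by (simp add: faces_eq image_Un)
  have cW: "card (face_verts T ` white T) = card (white T)" using inj_face_verts by (rule card_image)
  show "finite (verts T)" using arcs by (simp add: arc_graph_def)
  show "A \<subseteq> verts T \<and> card A = 3" if "A \<in> face_verts T ` white T \<union> face_verts T ` black T" for A
    using that unfolding un using face_verts_card(1) by (auto simp: face_verts_def)
  show "A = C" if A: "A \<in> face_verts T ` white T" "C \<in> face_verts T ` white T" "a \<noteq> b" "{a, b} \<subseteq> A" "{a, b} \<subseteq> C" for A C a b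
  proof -
    obtain F G where FG: "F \<in> white T" "A = face_verts T F" "G \<in> white T" "C = face_verts T G" using A(1,2) by auto
    have "F = G" using same_pair_same_face[OF _ A(3) A(4)[unfolded FG(2)] A(5)[unfolded FG(4)]] FG(1,3) by simp
    then show ?thesis using FG by simp
  qed
  show "A = C" if A: "A \<in> face_verts T ` black T" "C \<in> face_verts T ` black T" "a \<noteq> b" "{a, b} \<subseteq> A" "{a, b} \<subseteq> C" for A C a b
  proof -
    obtain F G where FG: "F \<in> black T" "A = face_verts T F" "G \<in> black T" "C = face_verts T G" using A(1,2) by auto
    have "F = G" using same_pair_same_face[OF _ A(3) A(4)[unfolded FG(2)] A(5)[unfolded FG(4)]] FG(1,3) by simp
    then show ?thesis using FG by simp
  qed
  have other: "(\<exists>G\<in>white T. {a, b} \<subseteq> face_verts T G) \<and> (\<exists>G\<in>black T. {a, b} \<subseteq> face_verts T G)"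
    if F: "F \<in> faces T" "a \<noteq> b" "{a, b} \<subseteq> face_verts T F" for F a b
  proof -
    obtain h where h: "h \<in> edges T" "h \<subseteq> bdry F" "h \<inter> verts T = {a, b}" using F by (rule face_verts_pair)
    obtain F' G where FG: "F' \<in> white T" "G \<in> black T" "h \<subseteq> bdry F'" "h \<subseteq> bdry G" using h(1) by (rule two_faces)
    show ?thesis using FG edge_ends_face_verts[OF FG(3) h(3)] edge_ends_face_verts[OF FG(4) h(3)] by blast
  qed
  show "\<exists>Y\<in>face_verts T ` black T. {a, b} \<subseteq> Y" if A: "A \<in> face_verts T ` white T" "a \<noteq> b" "{a, b} \<subseteq> A" for A a b
  proof -
    obtain F where F: "F \<in> white T" "A = face_verts T F" using A(1) by auto
    then have "F \<in> faces T" by (simp add: faces_eq)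
    from other[OF this A(2) A(3)[unfolded F(2)]] show ?thesis by auto
  qed
  show "\<exists>Y\<in>face_verts T ` white T. {a, b} \<subseteq> Y" if A: "A \<in> face_verts T ` black T" "a \<noteq> b" "{a, b} \<subseteq> A" for A a b
  proof -
    obtain F where F: "F \<in> black T" "A = face_verts T F" using A(1) by auto
    then have "F \<in> faces T" by (simp add: faces_eq)
    from other[OF this A(2) A(3)[unfolded F(2)]] show ?thesis by auto
  qed
  show "S = face_verts T ` white T \<union> face_verts T ` black T"
    if "S \<subseteq> face_verts T ` white T \<union> face_verts T ` black T" "S \<noteq> {}"
    "\<And>Z Y a b. Z \<in> S \<Longrightarrow> Y \<in> face_verts T ` white T \<union> face_verts T ` black T \<Longrightarrow> a \<noteq> b \<Longrightarrow>
      {a, b} \<subseteq> Z \<Longrightarrow> {a, b} \<subseteq> Y \<Longrightarrow> Y \<in> S" for S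
    using that unfolding un by (rule faces_connected)
  show "verts T = \<Union>(face_verts T ` white T \<union> face_verts T ` black T)"
    unfolding un
  proof (intro equalityI subsetI)
    fix v assume v: "v \<in> verts T"
    then obtain F where "F \<in> faces T" "v \<in> bdry F" using face_at[of v] by blast
    with v show "v \<in> \<Union>(face_verts T ` faces T)" unfolding face_verts_def by blast
  qed (auto simp: face_verts_def)
  show "2 \<le> card (face_verts T ` white T)" using cW two by simp
  obtain F where "F \<in> white T" using two by (metis all_not_in_conv card.empty not_numeral_le_zero)
  then have "card (face_verts T F) = 3" using face_verts_card(1) faces_eq by blast
  then have "verts T \<noteq> {}" unfolding face_verts_def by auto
  moreover have "card (faces T) = 2 * card (white T)"
    unfolding faces_eq using fin disjoint card_eq by (simp add: card_Un_disjoint)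
  \<comment> \<open>With t white faces there are 3 t edges and 2 t faces, so Euler's inequality
    becomes t + 2 \<le> \<open>card (verts T)\<close>.\<close>
  ultimately show "card (face_verts T ` white T) + 2 \<le> card (verts T)"
    using arc_graph_euler[OF arcs] finite_faces card_edges cW unfolding faces_def by simp
qed

end

section \<open>The growth rate\<close>

text \<open>The value of \<open>\<kappa>\<close> makes a vertex of degree 6 exceed its share \<open>3 \<kappa>\<close> by exactly \<open>1 / 36\<close>.\<close>

definition \<kappa> :: real where "\<kappa> = ln 3 / 3 - 1 / 108"

lemma ln3: "ln 3 = 3 * \<kappa> + 1 / 36"
  by (simp add: \<kappa>_def)

lemma ln_ge_one_minus_inverse: "0 < x \<Longrightarrow> 1 - 1 / x \<le> ln (x::real)"
  using ln_le_minus_one[of "1 / x"] by (simp add: ln_div)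

lemma ln_3_ge_1: "1 \<le> ln (3::real)"
  using exp_le by (subst ln_ge_iff) auto

text \<open>The difference of the two sides is 1 / 108 - ln (9 / 8) / 15, and ln (9 / 8) \<le> 1 / 8
  bounds the subtracted term by 1 / 120.\<close>

lemma kappa_less: "\<kappa> < ln 6 / 5"
proof -
  have "ln (9 / 8) \<le> (1 / 8 :: real)" using ln_le_minus_one[of "9 / 8"] by simp
  moreover have "ln (9 / 8) = 2 * ln 3 - 3 * ln (2::real)"
    using ln_realpow[of 3 2] ln_realpow[of 2 3] by (simp add: ln_div)
  moreover have "ln 6 = ln 2 + ln (3::real)" using ln_mult[of 2 3] by simp
  ultimately show ?thesis unfolding \<kappa>_def by linarith
qed

text \<open>What a vertex of degree d leaves of its share \<open>\<kappa>\<close>, per incident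
  triple. At 3 the formula would give -1 / 108; it is set to 0 there because the excess 3 / 108 = 1
  / 36 is entered separately.\<close>

definition gain :: "nat \<Rightarrow> real" where
  "gain d = (if d = 3 then 0 else \<kappa> - ln (real d) / real d)"

text \<open>The right-hand side is ln (9 / 8) / 6 - 1 / 108, and ln (9 / 8) \<ge> 1 / 9. The same
  quantity is the gain at 4, as ln 4 / 4 = ln 2 / 2.\<close>

lemma gain_2: "1 / 108 \<le> \<kappa> - ln 2 / 2"
proof -
  have "1 / 9 \<le> ln (9 / 8 :: real)" using ln_ge_one_minus_inverse[of "9 / 8"] by simp
  moreover have "ln (9 / 8) = 2 * ln 3 - 3 * ln (2::real)"
    using ln_realpow[of 3 2] ln_realpow[of 2 3] by (simp add: ln_div)
  ultimately show ?thesis unfolding \<kappa>_def by linarith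
qed

lemma gain_small: "0 \<le> gain 1" "0 \<le> gain 2" "gain 3 = 0" "1 / 108 \<le> gain 4"
proof -
  have "ln 4 = 2 * ln (2::real)" using ln_realpow[of 2 2] by simp
  then show "0 \<le> gain 1" "0 \<le> gain 2" "gain 3 = 0" "1 / 108 \<le> gain 4"
    using gain_2 ln_3_ge_1 by (simp_all add: gain_def \<kappa>_def)
qed

text \<open>At d = 5 the claim is 5 ln 3 - 3 ln 5 = ln (243 / 125) \<ge> 5 / 9, obtained from 139 /
  100 as a rational lower bound for the square root of 243 / 125.\<close>

lemma gain_large:
  assumes "5 \<le> d"
  shows "1 / 36 \<le> gain d"
proof -
  have "(139 / 100)\<^sup>2 \<le> (243 / 125 :: real)" by (simp add: power2_eq_square)
  then have "ln ((139 / 100)\<^sup>2) \<le> ln (243 / 125 :: real)" by (subst ln_le_cancel_iff) auto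
  moreover have "ln ((139 / 100)\<^sup>2) = 2 * ln (139 / 100 :: real)" by (simp add: ln_realpow)
  moreover have "39 / 139 \<le> ln (139 / 100 :: real)" using ln_ge_one_minus_inverse[of "139 / 100"] by simp
  moreover have "ln (243 / 125) = 5 * ln 3 - 3 * ln (5::real)"
    using ln_realpow[of 3 5] ln_realpow[of 5 3] by (simp add: ln_div)
  ultimately have "3 * ln 5 + 5 / 9 \<le> 5 * ln (3::real)" by simp
  then have 5: "ln 5 / 5 \<le> \<kappa> - 1 / 36" unfolding \<kappa>_def by linarith
  have "ln 3 \<le> ln (5::real)" by simp
  then have ln5: "1 \<le> ln (5::real)" using ln_3_ge_1 by linarith
  have d: "5 \<le> real d" using assms by simp
  \<comment> \<open>The tangent of ln at 5 replaces the monotonicity of ln d / d beyond 5.\<close>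
  have "ln (real d / 5) \<le> real d / 5 - 1" using d by (intro ln_le_minus_one) simp
  then have "ln (real d) \<le> (ln 5 - 1) + real d / 5" using d by (simp add: ln_div)
  also have "\<dots> \<le> (ln 5 - 1) * (real d / 5) + real d / 5"
    using d ln5 mult_left_mono[of 1 "real d / 5" "ln 5 - 1"] by simp
  also have "\<dots> = real d * (ln 5 / 5)" by (simp add: field_simps)
  finally have "ln (real d) / real d \<le> ln 5 / 5" using d by (simp add: divide_le_eq mult.commute)
  then show ?thesis using 5 assms by (simp add: gain_def)
qed

lemma gain_nonneg:
  assumes "1 \<le> d"
  shows "0 \<le> gain d"
proof -
  consider "d = 1" | "d = 2" | "d = 3" | "d = 4" | "5 \<le> d" using assms by linarith
  then show ?thesis using gain_small gain_large[of d] by cases auto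
qed

text \<open>If no degree exceeds 4, the product alone suffices unless two of the degrees are 4.\<close>

lemma gain_triple:
  assumes "1 \<le> a" "1 \<le> b" "1 \<le> c"
  shows "1 / 36 \<le> gain a + gain b + gain c + 1 / (real a * real b * real c)"
proof -
  have nn: "0 \<le> gain a" "0 \<le> gain b" "0 \<le> gain c" using gain_nonneg assms by auto
  show ?thesis
  proof (cases "5 \<le> a \<or> 5 \<le> b \<or> 5 \<le> c")
    case True
    moreover have "0 \<le> 1 / (real a * real b * real c)" by simp
    ultimately show ?thesis using gain_large[of a] gain_large[of b] gain_large[of c] nn by linarith
  next
    case False
    then have "a \<in> {1, 2, 3, 4}" "b \<in> {1, 2, 3, 4}" "c \<in> {1, 2, 3, 4}" using assms by auto
    then show ?thesis using nn gain_small by auto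
  qed
qed

section \<open>Charging the vertices of degree 6 to the contracted class\<close>

context coloured_triples
begin

text \<open>Double counting over the black triples. Each vertex of colour \<open>j\<close> with
  \<open>wdeg\<close> 3 collects at least 1 / 36 from the gains at its three tails together with the
  saving of its 3-cycle. A vertex r of the class is asked for its gain once per black triple,
  \<open>wdeg r\<close> times in all, which sums to \<open>\<kappa> * wdeg r - ln (wdeg r)\<close>,
  plus 1 / 36 when \<open>wdeg r\<close> is 3.\<close>

lemma class_bound:
  assumes \<rho>: "\<rho> \<in> cls"
  shows "(\<Sum>r\<in>cls - {\<rho>}. ln (real (wdeg r))) - (\<Sum>v\<in>good (cls - {\<rho>}). \<Prod>Y\<in>{Y \<in> B. v \<in> Y}. 1 / real (wdeg (tail Y)))
    \<le> \<kappa> * card W + card {v \<in> V. col v = i \<and> wdeg v = 3} / 36 - card {v \<in> V. col v = j \<and> wdeg v = 3} / 36"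
proof -
  define prd where "prd v = (\<Prod>Y\<in>{Y \<in> B. v \<in> Y}. 1 / real (wdeg (tail Y)))" for v
  \<comment> \<open>The root has no factor in the product, so its full share \<open>\<kappa>\<close>
    is available. As \<open>\<kappa>\<close> is at least 1 / 36, it serves the vertices whose
    3-cycle is lost by passing through the root.\<close>
  define g where "g r = (if r = \<rho> then \<kappa> else gain (wdeg r))" for r
  define C where "C = {v \<in> V. col v = j}"
  define C3 where "C3 = {v \<in> V. col v = j \<and> wdeg v = 3}"
  have \<kappa>: "1 / 36 \<le> \<kappa>" using ln_3_ge_1 by (simp add: \<kappa>_def)
  have pos: "1 \<le> wdeg r" if "r \<in> V" for r using wdeg_pos[OF that] by simp
  have g_nn: "0 \<le> g r" if "r \<in> V" for r using gain_nonneg[OF pos[OF that]] \<kappa> by (simp add: g_def)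
  have fin: "finite C" "finite C3" "C3 \<subseteq> C" using finite_V by (auto simp: C_def C3_def)
  have gd: "good R \<subseteq> C3" for R by (auto simp: good_def C3_def)
  have loc: "1 / 36 \<le> (\<Sum>Z\<in>{Z \<in> B. pt j Z = v}. g (tail Z)) + (if v \<in> good (cls - {\<rho>}) then prd v else 0)" if v: "v \<in> C3" for v
  proof -
    have v': "v \<in> V" "col v = j" "wdeg v = 3" using v by (auto simp: C3_def)
    have se: "{Z \<in> B. v \<in> Z} = {Z \<in> B. pt j Z = v}" by (rule star_eq(1)) (simp_all add: v')
    have "card {Z \<in> B. v \<in> Z} = 3" using wdeg_B[of v] v'(3) by simp
    then obtain Z1 Z2 Z3 where Z: "{Z \<in> B. v \<in> Z} = {Z1, Z2, Z3}" "Z1 \<noteq> Z2" "Z2 \<noteq> Z3" "Z1 \<noteq> Z3"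
      by (auto simp: card_3_iff)
    have inB: "Z1 \<in> B" "Z2 \<in> B" "Z3 \<in> B" using Z(1) by blast+
    have sum: "(\<Sum>Z\<in>{Z \<in> B. pt j Z = v}. g (tail Z)) = g (tail Z1) + g (tail Z2) + g (tail Z3)"
      unfolding se[symmetric] Z(1) using Z(2-4) by (simp add: add.assoc)
    have tV: "tail Z1 \<in> V" "tail Z2 \<in> V" "tail Z3 \<in> V" using tail_in_V inB by auto
    note nn = g_nn[OF tV(1)] g_nn[OF tV(2)] g_nn[OF tV(3)]
    have prd: "prd v = 1 / (real (wdeg (tail Z1)) * real (wdeg (tail Z2)) * real (wdeg (tail Z3)))"
      unfolding prd_def Z(1) using Z(2-4) by (simp add: mult.assoc)
    show ?thesis
    proof (cases "\<rho> \<in> {tail Z1, tail Z2, tail Z3}")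
      case True
      moreover have "g \<rho> = \<kappa>" by (simp add: g_def)
      ultimately have "1 / 36 \<le> g (tail Z1) + g (tail Z2) + g (tail Z3)" using nn \<kappa> by auto
      moreover have "0 \<le> prd v" by (simp add: prd)
      ultimately show ?thesis unfolding sum by simp
    next
      case False
      then have "\<forall>Y\<in>{Z1, Z2, Z3}. tail Y \<in> cls - {\<rho>}" using tV col_tail inB by (auto simp: cls_def)
      then have "\<forall>Y\<in>{Y \<in> B. v \<in> Y}. tail Y \<in> cls - {\<rho>}" by (simp only: Z(1))
      then have "v \<in> good (cls - {\<rho>})" using v' by (auto simp: good_def)
      moreover have "g (tail Z1) = gain (wdeg (tail Z1))" "g (tail Z2) = gain (wdeg (tail Z2))" "g (tail Z3) = gain (wdeg (tail Z3))"
        using False by (auto simp: g_def)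
      ultimately show ?thesis using gain_triple[OF pos[OF tV(1)] pos[OF tV(2)] pos[OF tV(3)]] by (simp add: sum prd)
    qed
  qed
  have "card C3 / 36 = (\<Sum>v\<in>C3. 1 / 36)" by simp
  also have "\<dots> \<le> (\<Sum>v\<in>C3. (\<Sum>Z\<in>{Z \<in> B. pt j Z = v}. g (tail Z)) + (if v \<in> good (cls - {\<rho>}) then prd v else 0))"
    by (intro sum_mono loc)
  also have "\<dots> = (\<Sum>v\<in>C3. \<Sum>Z\<in>{Z \<in> B. pt j Z = v}. g (tail Z)) + (\<Sum>v\<in>C3 \<inter> good (cls - {\<rho>}). prd v)"
    using fin by (simp add: sum.distrib sum.inter_restrict)
  also have "C3 \<inter> good (cls - {\<rho>}) = good (cls - {\<rho>})" using gd by blast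
  also have "(\<Sum>v\<in>C3. \<Sum>Z\<in>{Z \<in> B. pt j Z = v}. g (tail Z)) \<le> (\<Sum>v\<in>C. \<Sum>Z\<in>{Z \<in> B. pt j Z = v}. g (tail Z))"
    using fin g_nn tail_in_V by (intro sum_mono2 sum_nonneg) auto
  also have "\<dots> = (\<Sum>Z\<in>B. g (tail Z))"
  proof (rule sum.group)
    show "pt j ` B \<subseteq> C" using pt[of _ j] triples unfolding C_def by blast
  qed (use finite_triples fin in auto)
  also have "\<dots> = (\<Sum>r\<in>cls. \<Sum>Z\<in>{Z \<in> B. tail Z = r}. g (tail Z))" by (rule sum_by_tail[symmetric])
  also have "\<dots> = (\<Sum>r\<in>cls. wdeg r * g r)"
    by (intro sum.cong refl) (simp add: wdeg_tail cls_def)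
  finally have 1: "card C3 / 36 \<le> (\<Sum>r\<in>cls. wdeg r * g r) + (\<Sum>v\<in>good (cls - {\<rho>}). prd v)" by simp
  have "(\<Sum>r\<in>cls. wdeg r * g r) = \<kappa> * wdeg \<rho> + (\<Sum>r\<in>cls - {\<rho>}. wdeg r * gain (wdeg r))"
    using finite_cls \<rho> by (subst sum.remove[of cls \<rho>]) (auto simp: g_def)
  also have "(\<Sum>r\<in>cls - {\<rho>}. wdeg r * gain (wdeg r)) =
      (\<Sum>r\<in>cls - {\<rho>}. \<kappa> * wdeg r - ln (wdeg r) + (if wdeg r = 3 then 1 / 36 else 0))"
  proof (intro sum.cong refl)
    fix r assume "r \<in> cls - {\<rho>}"
    then have "1 \<le> wdeg r" using pos by (simp add: cls_def)
    then show "wdeg r * gain (wdeg r) = \<kappa> * wdeg r - ln (wdeg r) + (if wdeg r = 3 then 1 / 36 else 0)"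
      using ln3 by (auto simp: gain_def field_simps)
  qed
  also have "\<dots> = \<kappa> * (\<Sum>r\<in>cls - {\<rho>}. real (wdeg r)) - (\<Sum>r\<in>cls - {\<rho>}. ln (wdeg r)) + card {r \<in> cls - {\<rho>}. wdeg r = 3} / 36"
    using finite_cls by (simp add: sum.distrib sum_subtractf sum_distrib_left sum.inter_filter[symmetric])
  also have "(\<Sum>r\<in>cls - {\<rho>}. real (wdeg r)) = real (card W) - wdeg \<rho>"
  proof -
    have "real (card W) = (\<Sum>r\<in>cls. real (wdeg r))" using sum_wdeg_cls by (metis of_nat_sum)
    then show ?thesis using finite_cls \<rho> by (simp add: sum.remove[of cls \<rho>])
  qed
  finally have 2: "(\<Sum>r\<in>cls. wdeg r * g r) = \<kappa> * card W - (\<Sum>r\<in>cls - {\<rho>}. ln (wdeg r)) + card {r \<in> cls - {\<rho>}. wdeg r = 3} / 36"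
    by (simp add: algebra_simps)
  have "card {r \<in> cls - {\<rho>}. wdeg r = 3} \<le> card {v \<in> V. col v = i \<and> wdeg v = 3}"
    using finite_V by (intro card_mono) (auto simp: cls_def)
  then have "real (card {r \<in> cls - {\<rho>}. wdeg r = 3}) \<le> card {v \<in> V. col v = i \<and> wdeg v = 3}" by simp
  with 1 2 show ?thesis unfolding C3_def prd_def by simp
qed

end

section \<open>From representatives to the order of the canonical group\<close>

context drawing
begin

abbreviation Fr :: "((real^3) \<Rightarrow>\<^sub>0 int) monoid" where
  "Fr \<equiv> free_Abelian_group (verts T)"

definition rels :: "((real^3) \<Rightarrow>\<^sub>0 int) set" where
  "rels = generate Fr (white_relations T)"

lemma white_relations_carrier: "white_relations T \<subseteq> carrier Fr"
proof
  fix x assume "x \<in> white_relations T"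
  then obtain F where x: "x = (\<Sum>v\<in>face_verts T F. frag_of v)" by (auto simp: white_relations_def)
  show "x \<in> carrier Fr"
    unfolding x by (rule sum_closed_free_Abelian_group) (simp add: face_verts_def)
qed

lemma subgroup_rels: "subgroup rels Fr"
  unfolding rels_def using white_relations_carrier
  by (intro group.generate_is_subgroup) simp_all

lemma normal_rels: "rels \<lhd> Fr"
  using comm_group.subgroup_imp_normal[OF abelian_free_Abelian_group subgroup_rels] .

lemma diff_closed_rels: "diff_closed rels"
  unfolding diff_closed_def
proof (intro conjI ballI)
  show "0 \<in> rels" using subgroup.one_closed[OF subgroup_rels] by simp
  fix a b assume ab: "a \<in> rels" "b \<in> rels"
  have "b \<in> carrier Fr" using subgroup.mem_carrier[OF subgroup_rels ab(2)] .
  then have "- b \<in> rels" using subgroup.m_inv_closed[OF subgroup_rels ab(2)] by simp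
  then show "a - b \<in> rels" using subgroup.m_closed[OF subgroup_rels ab(1)] by fastforce
qed

lemma rels_pairing:
  assumes "x \<in> rels" "\<And>Z. Z \<in> face_verts T ` white T \<Longrightarrow> (\<Sum>v\<in>Z. \<omega> v) = 0"
  shows "frag_pairing (verts T) \<omega> x = 0"
proof -
  have fin: "finite (verts T)" using arcs by (simp add: arc_graph_def)
  have rel: "frag_pairing (verts T) \<omega> h = 0" if h: "h \<in> white_relations T" for h
  proof -
    obtain F where F: "F \<in> white T" "h = (\<Sum>v\<in>face_verts T F. frag_of v)" using h by (auto simp: white_relations_def)
    have "frag_pairing (verts T) \<omega> h = (\<Sum>v\<in>face_verts T F. \<omega> v)"
      unfolding F(2) frag_pairing_sum using fin by (intro sum.cong) (auto simp: frag_pairing_of face_verts_def)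
    then show ?thesis using assms(2) F(1) by simp
  qed
  show ?thesis using assms(1) unfolding rels_def
  proof (induction rule: generate.induct)
    case one
    then show ?case by (simp add: frag_pairing_def)
  next
    case (incl h)
    then show ?case by (rule rel)
  next
    case (inv h)
    then have "Poly_Mapping.keys h \<subseteq> verts T" using subsetD[OF white_relations_carrier] by auto
    then show ?case using rel[OF inv] by (simp add: frag_pairing_minus)
  next
    case (eng h1 h2)
    then show ?case by (simp add: frag_pairing_add)
  qed
qed

text \<open>Each torsion coset is lifted to an element \<open>U x\<close> with a positive multiple
  in \<open>rels\<close>. If \<open>\<phi>\<close> agrees on two lifts, the product of their
  multipliers takes the difference into \<open>rels\<close>, so by \<open>inj\<close> the cosets
  coincide.\<close>

lemma order_canonical_group_le:
  assumes R: "finite R"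
    and \<phi>: "\<And>u. Poly_Mapping.keys u \<subseteq> verts T \<Longrightarrow> \<phi> u \<in> R"
    and inj: "\<And>u v m. Poly_Mapping.keys u \<subseteq> verts T \<Longrightarrow> Poly_Mapping.keys v \<subseteq> verts T \<Longrightarrow> \<phi> u = \<phi> v \<Longrightarrow> m \<noteq> 0 \<Longrightarrow>
       frag_cmul m (u - v) \<in> rels \<Longrightarrow> u - v \<in> rels"
  shows "order (canonical_group T) \<le> card R"
proof -
  let ?G = "Fr Mod rels"
  have G: "white_group T = ?G" by (simp add: white_group_def rels_def)
  have grG: "group ?G" using normal.factorgroup_is_group[OF normal_rels] .
  interpret Fr: group Fr by simp
  let ?h = "\<lambda>a. rels #>\<^bsub>Fr\<^esub> a"
  have hom: "?h \<in> hom Fr ?G" using normal.r_coset_hom_Mod[OF normal_rels] .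
  define C where "C = carrier (canonical_group T)"
  have ex: "\<exists>u n. Poly_Mapping.keys u \<subseteq> verts T \<and> x = ?h u \<and> n > 0 \<and> frag_cmul (int n) u \<in> rels" if x: "x \<in> C" for x
  proof -
    obtain n :: nat where n: "x \<in> carrier ?G" "n > 0" "x [^]\<^bsub>?G\<^esub> n = \<one>\<^bsub>?G\<^esub>"
      using x by (auto simp: C_def canonical_group_def torsion_subgroup_def G)
    then obtain u where u: "u \<in> carrier Fr" "x = ?h u"
      by (auto simp: FactGroup_def RCOSETS_def)
    have "?h (u [^]\<^bsub>Fr\<^esub> n) = x [^]\<^bsub>?G\<^esub> n"
      unfolding u(2) using hom_nat_pow[OF hom u(1) Fr.is_group grG] by simp
    also have "\<dots> = rels" using n(3) by (simp add: FactGroup_def)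
    finally have "?h (frag_cmul (int n) u) = rels" by simp
    moreover have "frag_cmul (int n) u \<in> carrier Fr" using u(1) keys_cmul[of "int n" u] by auto
    ultimately have "frag_cmul (int n) u \<in> rels" using Fr.coset_join1[OF _ _ subgroup_rels] by blast
    then show ?thesis using u n(2) by auto
  qed
  obtain U M where UM: "\<And>x. x \<in> C \<Longrightarrow> Poly_Mapping.keys (U x) \<subseteq> verts T" "\<And>x. x \<in> C \<Longrightarrow> x = ?h (U x)"
    "\<And>x. x \<in> C \<Longrightarrow> (M x :: nat) > 0" "\<And>x. x \<in> C \<Longrightarrow> frag_cmul (int (M x)) (U x) \<in> rels"
    using ex by metis
  have "inj_on (\<lambda>x. \<phi> (U x)) C"
  proof (rule inj_onI)
    fix x y assume xy: "x \<in> C" "y \<in> C" "\<phi> (U x) = \<phi> (U y)"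
    define m where "m = int (M x) * int (M y)"
    have "m \<noteq> 0" using UM(3)[OF xy(1)] UM(3)[OF xy(2)] by (simp add: m_def)
    have "frag_cmul (int (M y)) (frag_cmul (int (M x)) (U x)) \<in> rels" "frag_cmul (int (M x)) (frag_cmul (int (M y)) (U y)) \<in> rels"
      using UM(4) xy diff_closed_frag_cmul[OF diff_closed_rels] by blast+
    then have "frag_cmul m (U x) - frag_cmul m (U y) \<in> rels"
      using diff_closedD(2)[OF diff_closed_rels] by (simp add: m_def mult.commute)
    moreover have "frag_cmul m (U x - U y) = frag_cmul m (U x) - frag_cmul m (U y)"
      using frag_cmul_distrib2[of m "U x" "- U y"] by (simp add: poly_mapping_eq_iff fun_eq_iff lookup_minus right_diff_distrib)
    ultimately have "U x - U y \<in> rels" using inj[OF UM(1)[OF xy(1)] UM(1)[OF xy(2)] xy(3) \<open>m \<noteq> 0\<close>] by simp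
    then have "U x \<in> ?h (U y)" by (auto simp: r_coset_def intro!: bexI[of _ "U x - U y"])
    then have "?h (U y) = ?h (U x)"
      using Fr.repr_independence[OF _ _ subgroup_rels, of "U x" "U y"] UM(1)[OF xy(2)] by simp
    then show "x = y" using UM(2) xy by metis
  qed
  moreover have "(\<lambda>x. \<phi> (U x)) ` C \<subseteq> R" using \<phi> UM(1) by blast
  ultimately have "card C \<le> card R" using R by (intro card_inj_on_le)
  then show ?thesis by (simp add: order_def C_def)
qed

lemma order_canonical_group_bound: "real (order (canonical_group T)) \<le> exp (\<kappa> * card (white T))"
proof (cases "order (canonical_group T) = 0")
  case False
  let ?V = "verts T" and ?W = "face_verts T ` white T" and ?B = "face_verts T ` black T"
  interpret bicoloured_triples ?V ?W ?B by (rule triple_system)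
  obtain col :: "real^3 \<Rightarrow> nat" where col: "\<forall>Z\<in>?W \<union> ?B. col ` Z = {0, 1, 2}"
    using three_colouring by blast
  have cW: "card ?W = card (white T)" using inj_face_verts by (rule card_image)
  define D where "D i = real (card {v \<in> ?V. col v = i \<and> wdeg v = 3})" for i
  have ln_le: "ln (order (canonical_group T)) \<le> \<kappa> * card (white T) + D i / 36 - D j / 36"
    if ijl: "{i, j, l} = {0, 1, 2::nat}" for i j l
  proof -
    interpret c: coloured_triples ?V ?W ?B col i j l
      by unfold_locales (use col ijl in auto)
    have "?B \<noteq> {}" using card_W c.card_W_eq_B by auto
    then obtain Z where "Z \<in> ?B" by blast
    then have \<rho>: "c.tail Z \<in> c.cls" using c.col_tail c.tail_in_V by (auto simp: c.cls_def)
    define \<rho> where "\<rho> = c.tail Z"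
    have \<rho>c: "\<rho> \<in> c.cls" using \<rho> by (simp add: \<rho>_def)
    have "finite (c.cls - {\<rho>})" using c.finite_cls by simp
    then obtain g where "bij_betw g {0..<card (c.cls - {\<rho>})} (c.cls - {\<rho>})" using ex_bij_betw_nat_finite by blast
    then have g: "bij_betw g {..<card (c.cls - {\<rho>})} (c.cls - {\<rho>})" by (simp add: atLeast0LessThan)
    let ?d = "Determinant.det (c.laplacian_mat g (card (c.cls - {\<rho>})))"
    have rel: "(\<Sum>v\<in>Z. frag_of v) \<in> rels" if "Z \<in> ?W" for Z
      unfolding rels_def using that by (intro generate.incl) (auto simp: white_relations_def)
    obtain R :: "(nat \<Rightarrow> int) set" and \<phi> where R: "finite R" "card R \<le> nat \<bar>?d\<bar>"
      "\<forall>u. Poly_Mapping.keys u \<subseteq> ?V \<longrightarrow> \<phi> u \<in> R"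
      "\<forall>u v m. Poly_Mapping.keys u \<subseteq> ?V \<longrightarrow> Poly_Mapping.keys v \<subseteq> ?V \<longrightarrow> \<phi> u = \<phi> v \<longrightarrow> m \<noteq> 0 \<longrightarrow>
         frag_cmul m (u - v) \<in> rels \<longrightarrow> u - v \<in> rels"
      by (rule c.torsion_representatives[OF diff_closed_rels rel rels_pairing \<rho>c g])
    have "order (canonical_group T) \<le> card R"
      by (rule order_canonical_group_le[OF R(1), of \<phi>]) (use R(3,4) in blast)+
    then have "order (canonical_group T) \<le> nat \<bar>?d\<bar>" using R(2) by linarith
    then have "real (order (canonical_group T)) \<le> real_of_int \<bar>?d\<bar>" by linarith
    also note c.laplacian_det(2)[OF \<rho>c g]
    finally have le: "real (order (canonical_group T)) \<le> (\<Prod>r\<in>c.cls - {\<rho>}. real (wdeg r)) *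
      exp (- (\<Sum>v\<in>c.good (c.cls - {\<rho>}). \<Prod>Y\<in>{Y \<in> ?B. v \<in> Y}. 1 / real (wdeg (c.tail Y))))" .
    have pos: "0 < real (wdeg r)" if "r \<in> c.cls - {\<rho>}" for r using that wdeg_pos by (simp add: c.cls_def)
    have "ln (order (canonical_group T)) \<le> ln ((\<Prod>r\<in>c.cls - {\<rho>}. real (wdeg r)) *
      exp (- (\<Sum>v\<in>c.good (c.cls - {\<rho>}). \<Prod>Y\<in>{Y \<in> ?B. v \<in> Y}. 1 / real (wdeg (c.tail Y)))))"
      using le False by (intro ln_mono) auto
    also have "\<dots> = (\<Sum>r\<in>c.cls - {\<rho>}. ln (real (wdeg r))) - (\<Sum>v\<in>c.good (c.cls - {\<rho>}). \<Prod>Y\<in>{Y \<in> ?B. v \<in> Y}. 1 / real (wdeg (c.tail Y)))"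
    proof -
      have nz: "real (wdeg r) \<noteq> 0" if "r \<in> c.cls - {\<rho>}" for r using pos[OF that] by simp
      have "0 < (\<Prod>r\<in>c.cls - {\<rho>}. real (wdeg r))" using pos by (rule prod_pos)
      then have "ln ((\<Prod>r\<in>c.cls - {\<rho>}. real (wdeg r)) * exp x) = ln (\<Prod>r\<in>c.cls - {\<rho>}. real (wdeg r)) + x" for x
        by (simp add: ln_mult)
      moreover have "ln (\<Prod>r\<in>c.cls - {\<rho>}. real (wdeg r)) = (\<Sum>r\<in>c.cls - {\<rho>}. ln (real (wdeg r)))"
        using \<open>finite (c.cls - {\<rho>})\<close> nz by (rule ln_prod)
      ultimately show ?thesis by simp
    qed
    also have "\<dots> \<le> \<kappa> * card ?W + D i / 36 - D j / 36"
      unfolding D_def by (rule c.class_bound[OF \<rho>c])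
    finally show ?thesis by (simp add: cW)
  qed
  \<comment> \<open>For the cyclic choices of colours the counts \<open>D\<close> telescope to
    0.\<close>
  have "3 * ln (order (canonical_group T)) \<le> 3 * (\<kappa> * card (white T))"
    using ln_le[of 0 1 2] ln_le[of 1 2 0] ln_le[of 2 0 1] by (simp add: insert_commute)
  then have "ln (order (canonical_group T)) \<le> \<kappa> * card (white T)" by simp
  then show ?thesis using False by (metis exp_le_cancel_iff exp_ln of_nat_0_less_iff gr0I)
qed simp

end

lemma max_canonical_order_bound:
  assumes "2 \<le> t"
  shows "real (max_canonical_order t) \<le> exp (\<kappa> * t)"
proof -
  have le: "real m \<le> exp (\<kappa> * t)" if m: "m \<in> canonical_orders t" for m
  proof -
    obtain T where T: "m = order (canonical_group T)" "face_2_coloured_triangulation T" "simple_drawing T"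
      "card (white T) = t" "card (black T) = t" using m by (auto simp: canonical_orders_def)
    interpret drawing T
      by unfold_locales (use T assms in \<open>auto intro: card_ge_0_finite\<close>)
    show ?thesis using order_canonical_group_bound T by simp
  qed
  show ?thesis
  proof (cases "canonical_orders t = {}")
    \<comment> \<open>The supremum of the empty set of naturals is 0.\<close>
    case True
    then show ?thesis by (simp add: max_canonical_order_def Sup_nat_def)
  next
    case False
    have "m \<le> nat \<lfloor>exp (\<kappa> * t)\<rfloor>" if "m \<in> canonical_orders t" for m
      using le[OF that] by linarith
    then have "finite (canonical_orders t)" by (meson finite_nat_set_iff_bounded_le)
    then have "max_canonical_order t \<in> canonical_orders t"
      using False unfolding max_canonical_order_def by (simp add: Sup_nat_def)
    then show ?thesis by (rule le)
  qed
qed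

theorem theorem3p3:
  shows "limsup (\<lambda>t::nat. ereal (real (max_canonical_order t) powr (1 / real t)))
           < ereal (6 powr (1 / 5))"
proof -
  have "real (max_canonical_order t) powr (1 / real t) \<le> exp \<kappa>" if "2 \<le> t" for t
  proof -
    have "real (max_canonical_order t) powr (1 / real t) \<le> exp (\<kappa> * t) powr (1 / real t)"
      using max_canonical_order_bound[OF that] by (intro powr_mono2) auto
    also have "\<dots> = exp \<kappa>" using that by (simp add: powr_def)
    finally show ?thesis .
  qed
  then have "limsup (\<lambda>t::nat. ereal (real (max_canonical_order t) powr (1 / real t))) \<le> ereal (exp \<kappa>)"
    by (intro Limsup_bounded) (auto simp: eventually_sequentially intro!: exI[of _ 2])
  also have "exp \<kappa> < 6 powr (1 / 5)" using kappa_less by (simp add: powr_def)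
  then have "ereal (exp \<kappa>) < ereal (6 powr (1 / 5))" by simp
  finally show ?thesis .
qed

end
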